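(* There is a constant $C>0$ such that, for all $n$ and $1\le\ell\le\frac{n}{2}$, the size of every extension for $\mathrm{P}_{\mathrm{match}}^{\ell}(n)$ that is symmetric (with respect to the group $\mathfrak{S}(n)$ acting via permuting the nodes of $K_n$) is bounded from below by $$C\cdot\binom{n}{\lfloor(\ell-1)/2\rfloor}.$$
   Context: $K_n=([n],E_n)$ is the complete graph on $[n]=\{1,\dots,n\}$. $\mathcal{M}^{\ell}(n)$ is the set of all matchings $M\subseteq E_n$ (sets of edges no two of which share a node) with $|M|=\ell$; $\chi(M)\in\{0,1\}^{E_n}$ is the characteristic vector of $M$; and $\mathrm{P}_{\mathrm{match}}^{\ell}(n)=\operatorname{conv}\{\chi(M): M\in\mathcal{M}^{\ell}(n)\}\subseteq\mathbb{R}^{E_n}$. The symmetric group $\mathfrak{S}(n)$ of all permutations of $[n]$ acts on $E_n$ by $\pi.\{v,w\}=\{\pi(v),\pi(w)\}$ and hence on $\mathbb{R}^{E_n}$ by $(\pi.x)_{\{v,w\}}=x_{\{\pi^{-1}(v),\pi^{-1}(w)\}}$; this action maps $\mathrm{P}_{\mathrm{match}}^{\ell}(n)$ to itself. An extension of a polytope $P\subseteq\mathbb{R}^m$ is a polyhedron $Q\subseteq\mathbb{R}^d$ together with an affine map $p:\mathbb{R}^d\to\mathbb{R}^m$ with $p(Q)=P$. The size of the extension is the number of facets of $Q$. Let $\mathcal{O}(d)$ be the group of affine isometries of $\mathbb{R}^d$ (maps $y\mapsto Uy+u$ with $U$ an orthogonal matrix, $u\in\mathbb{R}^d$). If $G$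 is a group of affine transformations $\pi$ of $\mathbb{R}^m$ with $\pi.P=P$, the extension is symmetric (isometry-symmetric) with respect to $G$ if for every $\pi\in G$ there is $\varkappa_\pi\in\mathcal{O}(d)$ with $\varkappa_\pi.Q=Q$ and $p(\varkappa_\pi.y)=\pi.p(y)$ for all $y\in Q$.
   Formalization: Facets are taken as maximal proper faces with the empty set counted as a face, so an affine subspace (a point, a line) has one facet; with the usual count of 0 the claim fails for n = 2, ℓ = 1, where the polytope is a point. In all other cases the count is the usual one. *)

theory Defs
  imports "HOL-Analysis.Analysis" "HOL-Analysis.Finite_Function_Topology" "HOL-Combinatorics.Permutations"
begin

text \<open>
  Dimensions have to vary inside the statement (the constant must not depend on them), so for a
  finite index set \<open>I\<close> the space \<open>\<real>\<^sup>I\<close> is the space of finitely supported real functions whose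
  support lies in \<open>I\<close>.  In particular \<open>\<real>\<^sup>d\<close> is \<open>coord_space {..<d}\<close>.
\<close>

definition coord_space :: "'i set \<Rightarrow> ('i \<Rightarrow>\<^sub>0 real) set" where
  "coord_space I = {x. Poly_Mapping.keys x \<subseteq> I}"

abbreviation unit_vec_at :: "'i \<Rightarrow> ('i \<Rightarrow>\<^sub>0 real)" where
  "unit_vec_at i \<equiv> Poly_Mapping.single i 1"

definition polyhedron_in :: "'i set \<Rightarrow> ('i \<Rightarrow>\<^sub>0 real) set \<Rightarrow> bool" where
  "polyhedron_in I Q \<longleftrightarrow>
     (\<exists>H :: (('i \<Rightarrow> real) \<times> real) set. finite H \<and>
        Q = {y \<in> coord_space I. \<forall>(a, b)\<in>H. (\<Sum>i\<in>I. a i * Poly_Mapping.lookup y i) \<le> b})"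

definition affine_map_between ::
    "'i set \<Rightarrow> 'j set \<Rightarrow> (('i \<Rightarrow>\<^sub>0 real) \<Rightarrow> ('j \<Rightarrow>\<^sub>0 real)) \<Rightarrow> bool" where
  "affine_map_between I J p \<longleftrightarrow>
     p ` coord_space I \<subseteq> coord_space J \<and>
     (\<exists>f c. linear f \<and> (\<forall>y\<in>coord_space I. p y = f y + c))"

text \<open>
  Facets are the inclusion-maximal proper faces.  The empty set is a face (as it is for
  \<^const>\<open>face_of\<close>), so a nonempty affine subspace, which has no other proper face, has exactly one
  facet, namely \<open>{}\<close>; the facets of every other nonempty polyhedron are its faces of
  codimension one.  Compare \<^const>\<open>facet_of\<close>, which is confined to the class
  \<^class>\<open>euclidean_space\<close>, excludes \<open>{}\<close>, and so gives affine subspaces no facet at all.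
\<close>

definition facets :: "'a::real_vector set \<Rightarrow> 'a set set" where
  "facets Q = {F. F face_of Q \<and> F \<noteq> Q \<and> (\<forall>F'. F' face_of Q \<and> F' \<noteq> Q \<and> F \<subseteq> F' \<longrightarrow> F' = F)}"

definition orthogonal_mat_on :: "'i set \<Rightarrow> ('i \<Rightarrow> 'i \<Rightarrow> real) \<Rightarrow> bool" where
  "orthogonal_mat_on I U \<longleftrightarrow>
     (\<forall>i\<in>I. \<forall>j\<in>I. (\<Sum>k\<in>I. U k i * U k j) = (if i = j then 1 else 0)) \<and>
     (\<forall>i\<in>I. \<forall>j\<in>I. (\<Sum>k\<in>I. U i k * U j k) = (if i = j then 1 else 0))"

definition affine_isometry :: "'i set \<Rightarrow> (('i \<Rightarrow>\<^sub>0 real) \<Rightarrow> ('i \<Rightarrow>\<^sub>0 real)) \<Rightarrow> bool" where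
  "affine_isometry I \<kappa> \<longleftrightarrow>
     (\<exists>U u. orthogonal_mat_on I U \<and> u \<in> coord_space I \<and>
        (\<forall>y\<in>coord_space I.
           \<kappa> y = (\<Sum>i\<in>I. (\<Sum>j\<in>I. U i j * Poly_Mapping.lookup y j) *\<^sub>R unit_vec_at i) + u))"

definition extension ::
    "nat \<Rightarrow> (nat \<Rightarrow>\<^sub>0 real) set \<Rightarrow> ((nat \<Rightarrow>\<^sub>0 real) \<Rightarrow> ('j \<Rightarrow>\<^sub>0 real)) \<Rightarrow>
      'j set \<Rightarrow> ('j \<Rightarrow>\<^sub>0 real) set \<Rightarrow> bool" where
  "extension d Q p J P \<longleftrightarrow>
     polyhedron_in {..<d} Q \<and> affine_map_between {..<d} J p \<and> p ` Q = P"

definition extension_size :: "(nat \<Rightarrow>\<^sub>0 real) set \<Rightarrow> nat" where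
  "extension_size Q = card (facets Q)"

definition symmetric_extension ::
    "nat \<Rightarrow> (nat \<Rightarrow>\<^sub>0 real) set \<Rightarrow> ((nat \<Rightarrow>\<^sub>0 real) \<Rightarrow> ('j \<Rightarrow>\<^sub>0 real)) \<Rightarrow>
      (('j \<Rightarrow>\<^sub>0 real) \<Rightarrow> ('j \<Rightarrow>\<^sub>0 real)) set \<Rightarrow> bool" where
  "symmetric_extension d Q p G \<longleftrightarrow>
     (\<forall>g\<in>G. \<exists>\<kappa>. affine_isometry {..<d} \<kappa> \<and> \<kappa> ` Q = Q \<and> (\<forall>y\<in>Q. p (\<kappa> y) = g (p y)))"

definition complete_edges :: "nat \<Rightarrow> nat set set" where
  "complete_edges n = {{v, w} |v w. v \<in> {1..n} \<and> w \<in> {1..n} \<and> v \<noteq> w}"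

definition matchings :: "nat \<Rightarrow> nat \<Rightarrow> nat set set set" where
  "matchings l n = {M. M \<subseteq> complete_edges n \<and> pairwise disjnt M \<and> card M = l}"

definition char_vec :: "'i set \<Rightarrow> ('i \<Rightarrow>\<^sub>0 real)" where
  "char_vec M = (\<Sum>e\<in>M. unit_vec_at e)"

definition match_polytope :: "nat \<Rightarrow> nat \<Rightarrow> (nat set \<Rightarrow>\<^sub>0 real) set" where
  "match_polytope l n = convex hull (char_vec ` matchings l n)"

definition node_action :: "(nat \<Rightarrow> nat) \<Rightarrow> (nat set \<Rightarrow>\<^sub>0 real) \<Rightarrow> (nat set \<Rightarrow>\<^sub>0 real)" where
  "node_action \<pi> x = Poly_Mapping.map_key (\<lambda>e. inv \<pi> ` e) x"

lemma lookup_node_action: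
  assumes "\<pi> permutes {1..n}"
  shows "Poly_Mapping.lookup (node_action \<pi> x) e = Poly_Mapping.lookup x (inv \<pi> ` e)"
proof -
  have "inj (inv \<pi>)"
    using assms by (meson permutes_inj permutes_inv)
  then have "inj (\<lambda>e. inv \<pi> ` e)"
    by (simp add: inj_def inj_image_eq_iff)
  then show ?thesis
    by (simp add: node_action_def map_key.rep_eq)
qed

definition node_symmetries :: "nat \<Rightarrow> ((nat set \<Rightarrow>\<^sub>0 real) \<Rightarrow> (nat set \<Rightarrow>\<^sub>0 real)) set" where
  "node_symmetries n = {node_action \<pi> |\<pi>. \<pi> permutes {1..n}}"

end

theory Submission
  imports Defs "HOL-Computational_Algebra.Polynomial"
begin

text \<open>
  Write \<open>k = (l - 1) div 2\<close> and suppose that a symmetric extension has fewer than \<open>n choose k\<close> facets.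
  Scale the defining inequality of each facet to Lipschitz constant 1 on the polyhedron; then
  isometries permute the resulting slack functions.  Averaging preimages of the vertices
  over the finitely many occurring pairs (facet permutation, node permutation) gives an equivariant
  section, so the slack of a facet, viewed as a function on matchings, is invariant under a
  subgroup of the symmetric group whose index is smaller than \<open>n choose k\<close>.

  Such a subgroup contains, for large \<open>n\<close>, every 3-cycle that avoids some set \<open>W\<close> of at most \<open>k\<close> nodes:
  an element of minimal support shows that a group without 3-cycles on a set of \<open>9 t\<close> points has
  index at least \<open>t ^ t\<close>, so that "lying on a common 3-cycle" is an equivalence relation
  with few classes, and unless one class is huge the group permutes few sets of a medium size.
  Hence the slack of a matching depends only on its edges that touch \<open>W\<close>.

  Finally consider perfect matchings of two disjoint sets \<open>X\<close>, \<open>Y\<close> of size \<open>2 k + 1\<close> with \<open>i\<close>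
  crossing edges.  The average over them of a nonnegative function that depends on the edges at \<open>W\<close> only
  is a polynomial in \<open>i\<close> of degree at most \<open>k\<close> which is nonnegative at \<open>i = 0\<close>.
  Extrapolating from the odd values \<open>1, 3, \<dots>, 2 k + 1\<close> to \<open>0\<close> gives an affine combination of section
  points whose slacks are all nonnegative, although its image violates the inequality
  \<open>x(E(X)) \<le> k\<close>.
\<close>

section \<open>Permutation groups of small index\<close>

text \<open>Isometries are what makes the normalisation work: a lift of a node permutation may carry
  a chosen facet inequality to a positive multiple of another one, and a canonical scale removes the
  factor. Lifts need not compose like the permutations they lift, so the symmetric group need not
  act on the facets; it does act on functions of matchings, and there the translates of a facet
  slack are counted. Small index yields 3-cycles, hence only even permutations off \<open>W\<close>;
  as \<open>k < l\<close>, some edge of the matching misses \<open>W\<close>, and swapping its two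
  ends fixes the matching, which supplies the odd permutations. The final affine combination has
  coefficients of both signs, so convexity cannot place it in the polyhedron: the sign of every
  facet slack has to be checked. The odd size \<open>2 k + 1\<close> matters twice: no perfect
  matching has \<open>i = 0\<close> crossing edges, so extrapolation can leave the polytope,
  reaching the value \<open>k + 1/2\<close>; and the admissible \<open>i\<close> are exactly
  \<open>k + 1\<close> odd numbers, just enough to recover a polynomial of degree \<open>k\<close>.
  One extra fixed edge adjusts the parity of \<open>l\<close>.\<close>

lemma card_le_fibers:
  assumes "finite A" and "\<And>y. y \<in> f ` A \<Longrightarrow> card {x \<in> A. f x = y} \<le> q"
  shows "card A \<le> card (f ` A) * q"
proof -
  have "card A = card (\<Union>y\<in>f ` A. {x \<in> A. f x = y})"
    by (rule arg_cong[where f = card]) auto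
  also have "\<dots> \<le> (\<Sum>y\<in>f ` A. card {x \<in> A. f x = y})"
    using assms(1) by (intro card_UN_le) auto
  also have "\<dots> \<le> card (f ` A) * q"
    using sum_bounded_above[of "f ` A" "\<lambda>y. card {x \<in> A. f x = y}" q] assms(2) by simp
  finally show ?thesis .
qed

section \<open>Supports, commutators and 3-cycles\<close>

definition support :: "('a \<Rightarrow> 'a) \<Rightarrow> 'a set" where
  "support x = {z. x z \<noteq> z}"

lemma support_empty_iff: "support x = {} \<longleftrightarrow> x = id"
  by (auto simp: support_def)

lemma support_subset: "x permutes B \<Longrightarrow> support x \<subseteq> B"
  by (auto simp: support_def permutes_def)

lemma permutes_support: "x permutes B \<Longrightarrow> support x \<subseteq> B' \<Longrightarrow> x permutes B'"
  unfolding permutes_def support_def by blast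

lemma support_image: "bij x \<Longrightarrow> z \<in> support x \<Longrightarrow> x z \<in> support x"
  by (auto simp: support_def bij_def inj_def)

text \<open>Away from the overlap \<open>I\<close> and its two translates, each of \<open>x\<close>
  and \<open>y\<close> fixes whatever the other one moves along the path of the point, so each map
  is cancelled by its inverse. The commutator thus moves at most \<open>3 * card I\<close> points,
  which is how elements of small support are produced below.\<close>

lemma support_commutator:
  assumes "bij x" "bij y"
  defines "I \<equiv> support x \<inter> support y"
  shows "support (x \<circ> y \<circ> inv x \<circ> inv y) \<subseteq> I \<union> x ` I \<union> y ` I"
proof
  fix z assume z: "z \<in> support (x \<circ> y \<circ> inv x \<circ> inv y)"
  show "z \<in> I \<union> x ` I \<union> y ` I"
  proof (rule ccontr)
    assume n: "z \<notin> I \<union> x ` I \<union> y ` I"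
    have xi: "x (inv x w) = w" "inv x (x w) = w" for w
      using assms(1) by (simp_all add: bij_def surj_f_inv_f)
    have yi: "y (inv y w) = w" "inv y (y w) = w" for w
      using assms(2) by (simp_all add: bij_def surj_f_inv_f)
    have fx: "inv x w = w" if "x w = w" for w using that xi by metis
    have fy: "inv y w = w" if "y w = w" for w using that yi by metis
    have "(x \<circ> y \<circ> inv x \<circ> inv y) z = z"
    proof (cases "y z = z")
      case True
      have "y (inv x z) = inv x z"
      proof (rule ccontr)
        assume a: "y (inv x z) \<noteq> inv x z"
        then have "x (inv x z) \<noteq> inv x z" using True xi by metis
        then have "inv x z \<in> I" using a by (simp add: I_def support_def)
        then have "x (inv x z) \<in> x ` I" by blast
        then show False using n xi by simp
      qed
      then show ?thesis using True fy xi by simp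
    next
      case False
      then have xz: "x z = z" using n by (auto simp: I_def support_def)
      have "x (inv y z) = inv y z"
      proof (rule ccontr)
        assume a: "x (inv y z) \<noteq> inv y z"
        have "y (inv y z) \<noteq> inv y z" using False yi by metis
        then have "inv y z \<in> I" using a by (simp add: I_def support_def)
        then have "y (inv y z) \<in> y ` I" by blast
        then show False using n yi by simp
      qed
      then show ?thesis using xz fx yi by simp
    qed
    then show False using z by (simp add: support_def)
  qed
qed

text \<open>For distinct points this is the cycle \<open>a\<close> to \<open>b\<close> to
  \<open>c\<close> to \<open>a\<close>. As a product of two transpositions sharing a point it is
  directly usable in \<open>transpose_pair_mem\<close>.\<close>

definition cyc3 :: "'a \<Rightarrow> 'a \<Rightarrow> 'a \<Rightarrow> 'a \<Rightarrow> 'a" where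
  "cyc3 a b c = Transposition.transpose a b \<circ> Transposition.transpose b c"

lemma cyc3_apply:
  assumes "distinct [a, b, c]"
  shows "cyc3 a b c z = (if z = a then b else if z = b then c else if z = c then a else z)"
  using assms by (auto simp: cyc3_def Transposition.transpose_def)

lemma conj_transpose: "bij g \<Longrightarrow> g \<circ> Transposition.transpose a b \<circ> inv g = Transposition.transpose (g a) (g b)"
  by (rule ext) (auto simp: Transposition.transpose_def bij_def surj_f_inv_f inv_f_eq inj_def)

lemma conj_cyc3:
  assumes "bij g" shows "g \<circ> cyc3 a b c \<circ> inv g = cyc3 (g a) (g b) (g c)"
proof -
  have "inv g \<circ> g = id" using assms by (simp add: bij_def)
  then have "g \<circ> cyc3 a b c \<circ> inv g = (g \<circ> Transposition.transpose a b \<circ> inv g) \<circ> (g \<circ> Transposition.transpose b c \<circ> inv g)"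
    by (auto simp: cyc3_def fun_eq_iff)
  then show ?thesis using assms by (simp add: conj_transpose cyc3_def)
qed

lemma cyc3_rotate: "distinct [a, b, c] \<Longrightarrow> cyc3 b c a = cyc3 a b c"
  by (rule ext) (auto simp: cyc3_apply)

lemma inv_cyc3: "distinct [a, b, c] \<Longrightarrow> inv (cyc3 a b c) = cyc3 c b a"
  by (rule inv_unique_comp) (auto simp: fun_eq_iff cyc3_apply split: if_splits)

lemma support_card_3:
  assumes "bij x" "card (support x) = 3"
  obtains a b c where "distinct [a, b, c]" "support x = {a, b, c}" "x = cyc3 a b c"
proof -
  obtain a b c where s: "support x = {a, b, c}" "distinct [a, b, c]"
    using assms(2) by (auto simp: card_3_iff)
  have inj: "x u = x v \<longleftrightarrow> u = v" for u v using assms(1) by (auto simp: bij_def inj_def)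
  have m: "x a \<noteq> a" "x b \<noteq> b" "x c \<noteq> c" using s(1) by (auto simp: support_def)
  have i: "x a \<in> {a, b, c}" "x b \<in> {a, b, c}" "x c \<in> {a, b, c}"
    using support_image[OF assms(1)] s(1) by auto
  have f: "x z = z" if "z \<notin> {a, b, c}" for z using that s(1) by (auto simp: support_def)
  show ?thesis
  proof (cases "x a = b")
    case True
    then have "x b = c" using m i inj[of b a] inj[of b c] inj[of a c] s(2) by auto
    moreover have "x c = a" using calculation True m i inj[of b c] inj[of a c] s(2) by auto
    ultimately have "x z = cyc3 a b c z" for z
      using True f[of z] unfolding cyc3_apply[OF s(2)] by simp
    then have "x = cyc3 a b c" by blast
    then show ?thesis using that s by blast
  next
    case False
    then have "x a = c" using m i by auto
    then have "x c = b" using m i inj[of b a] inj[of b c] inj[of a c] s(2) by auto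
    moreover have "x b = a" using calculation \<open>x a = c\<close> m i inj[of b c] inj[of b a] s(2) by auto
    moreover have d: "distinct [a, c, b]" using s(2) by auto
    ultimately have "x z = cyc3 a c b z" for z
      using \<open>x a = c\<close> f[of z] unfolding cyc3_apply[OF d] by simp
    then have "x = cyc3 a c b" by blast
    then show ?thesis using that[of a c b] s by auto
  qed
qed

text \<open>Greedy choice: a chosen \<open>p\<close> rules out only \<open>p\<close>,
  \<open>x p\<close> and \<open>inv x p\<close>, so another point is available as long as
  \<open>3 * r < card S\<close>. The bound thus allows the ceiling of a third of
  \<open>card S\<close>, in particular one point when \<open>card S = 2\<close>.\<close>

lemma independent_subset:
  assumes "bij x" "finite S" "S \<subseteq> support x" "3 * r < card S + 3"
  shows "\<exists>R\<subseteq>S. card R = r \<and> (\<forall>p\<in>R. x p \<notin> R)"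
  using assms(4)
proof (induction r)
  case 0
  show ?case by (rule exI[of _ "{}"]) auto
next
  case (Suc r)
  then obtain R where R: "R \<subseteq> S" "card R = r" "\<forall>p\<in>R. x p \<notin> R" by auto
  have fR: "finite R" using R(1) assms(2) finite_subset by blast
  have inj: "x u = x v \<longleftrightarrow> u = v" for u v using assms(1) by (auto simp: bij_def inj_def)
  have "card (R \<union> x ` R \<union> inv x ` R) \<le> card R + card R + card R"
    by (intro order.trans[OF card_Un_le] add_mono card_image_le fR order.refl)
  then have "card (R \<union> x ` R \<union> inv x ` R) < card S" using R(2) Suc.prems by simp
  then have "\<not> S \<subseteq> R \<union> x ` R \<union> inv x ` R"
    using fR by (meson card_mono finite_Un finite_imageI linorder_not_less)
  then obtain q where q: "q \<in> S" "q \<notin> R" "q \<notin> x ` R" "q \<notin> inv x ` R" by auto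
  have "x q \<notin> R" using q(4) assms(1) by (metis bij_inv_eq_iff image_eqI)
  moreover have "x q \<noteq> q" using q(1) assms(3) by (auto simp: support_def)
  ultimately have "\<forall>p\<in>insert q R. x p \<notin> insert q R"
    using R(3) q by auto
  moreover have "card (insert q R) = Suc r" using q fR R(2) by simp
  ultimately show ?case using q R(1) by (intro exI[of _ "insert q R"]) auto
qed

lemma power_fact_le:
  assumes "t \<le> b" shows "t ^ r * fact b \<le> (fact (b + r) :: nat)"
proof (induction r)
  case (Suc r)
  have "t ^ Suc r * fact b = t * (t ^ r * fact b)" by simp
  also have "\<dots> \<le> (b + Suc r) * fact (b + r)"
    using Suc assms by (intro mult_mono) auto
  also have "\<dots> = fact (b + Suc r)" by simp
  finally show ?case .
qed simp

section \<open>Pointwise stabilizers inside a permutation group\<close>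

locale permutation_group =
  fixes X :: "'a set" and U :: "('a \<Rightarrow> 'a) set"
  assumes finite_X: "finite X"
    and permutes: "u \<in> U \<Longrightarrow> u permutes X"
    and id_mem: "id \<in> U"
    and comp_mem: "u \<in> U \<Longrightarrow> v \<in> U \<Longrightarrow> u \<circ> v \<in> U"
    and inv_mem: "u \<in> U \<Longrightarrow> inv u \<in> U"
begin

text \<open>Since \<open>u permutes B\<close> includes fixing every point outside \<open>B\<close>,
  this is the pointwise stabilizer of the complement of \<open>B\<close>, not the setwise stabilizer
  of \<open>B\<close>.\<close>

definition restr :: "'a set \<Rightarrow> ('a \<Rightarrow> 'a) set" where
  "restr B = {u \<in> U. u permutes B}"

lemma bij_mem: "u \<in> U \<Longrightarrow> bij u"
  using permutes permutes_bij by blast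

lemma finite_U: "finite U"
  using finite_permutations[OF finite_X] permutes by (metis (mono_tags) finite_subset mem_Collect_eq subsetI)

lemma finite_restr: "finite (restr B)"
  using finite_U by (simp add: restr_def)

lemma restr_X: "restr X = U"
  using permutes by (auto simp: restr_def)

lemma id_restr: "id \<in> restr B"
  by (simp add: restr_def id_mem)

lemma card_restr_pos: "0 < card (restr B)"
  using id_restr finite_restr card_gt_0_iff by blast

lemma card_restr_le: "finite B \<Longrightarrow> card (restr B) \<le> fact (card B)"
  using card_mono[OF finite_permutations, of B "restr B"] card_permutations[of B "card B"]
  by (auto simp: restr_def)

lemma restr_mono: "B' \<subseteq> B \<Longrightarrow> restr B' \<subseteq> restr B"
  by (auto simp: restr_def intro: permutes_subset)

text \<open>The products \<open>s \<circ> u\<close> with \<open>s\<close> permuting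
  \<open>B'\<close> and \<open>u\<close> in \<open>restr B\<close> are permutations of
  \<open>B\<close>, and two representations of the same product differ by an element of
  \<open>restr B'\<close>. Counting them compares two indices without division: passing to fewer
  points never increases the index in the symmetric group.\<close>

lemma index_mono:
  assumes "B' \<subseteq> B" "finite B"
  shows "fact (card B') * card (restr B) \<le> fact (card B) * card (restr B')"
proof -
  have fB': "finite B'" using assms finite_subset by blast
  define P where "P = {p. p permutes B'}"
  define f where "f = (\<lambda>(s :: 'a \<Rightarrow> 'a, u :: 'a \<Rightarrow> 'a). s \<circ> u)"
  have fP: "finite P" using fB' by (simp add: P_def finite_permutations)
  have fib: "card {z \<in> P \<times> restr B. f z = y} \<le> card (restr B')" if y: "y \<in> f ` (P \<times> restr B)" for y
  proof -
    obtain s0 u0 where z0: "s0 \<in> P" "u0 \<in> restr B" "y = s0 \<circ> u0"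
      using y by (auto simp: f_def)
    have b0: "bij s0" using z0(1) permutes_bij by (auto simp: P_def)
    define g where "g = (\<lambda>(s :: 'a \<Rightarrow> 'a, u :: 'a \<Rightarrow> 'a). inv s0 \<circ> s)"
    have "inj_on g {z \<in> P \<times> restr B. f z = y}"
    proof (rule inj_onI)
      fix z z' assume z: "z \<in> {z \<in> P \<times> restr B. f z = y}" "z' \<in> {z \<in> P \<times> restr B. f z = y}" "g z = g z'"
      obtain s u s' u' where zz: "z = (s, u)" "z' = (s', u')" by fastforce
      have a: "s \<in> P" "s' \<in> P" "s \<circ> u = y" "s' \<circ> u' = y" "inv s0 \<circ> s = inv s0 \<circ> s'"
        using z by (auto simp: zz f_def g_def)
      have "inv s0 (s z) = inv s0 (s' z)" for z using a(5) by (metis comp_apply)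
      then have "s z = s' z" for z using b0 by (metis bij_inv_eq_iff)
      then have ss: "s = s'" by blast
      have inj_s: "inj s" using a(1) permutes_inj by (auto simp: P_def)
      have "s (u z) = s (u' z)" for z using a(3,4) ss by (metis comp_apply)
      then have "u = u'" using inj_s by (auto simp: inj_def)
      then show "z = z'" using ss zz by simp
    qed
    moreover have "g ` {z \<in> P \<times> restr B. f z = y} \<subseteq> restr B'"
    proof
      fix w assume "w \<in> g ` {z \<in> P \<times> restr B. f z = y}"
      then obtain s u where a: "s \<in> P" "u \<in> restr B" "s \<circ> u = y" and w: "w = inv s0 \<circ> s"
        by (auto simp: f_def g_def)
      have bu: "bij u" using a(2) by (auto simp: restr_def bij_mem)
      have "s (u z) = s0 (u0 z)" for z using a(3) z0(3) by (metis comp_apply)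
      then have "inv s0 (s (u z)) = u0 z" for z using b0 by (simp add: bij_def)
      then have "inv s0 (s w) = u0 (inv u w)" for w using bu by (metis bij_inv_eq_iff)
      then have e: "inv s0 \<circ> s = u0 \<circ> inv u" by (auto simp: fun_eq_iff)
      have "u0 \<circ> inv u \<in> U" using a(2) z0(2) by (auto simp: restr_def intro: comp_mem inv_mem)
      moreover have "inv s0 \<circ> s permutes B'"
        using a(1) z0(1) by (auto simp: P_def intro: permutes_compose permutes_inv)
      ultimately show "w \<in> restr B'" using e w by (simp add: restr_def)
    qed
    ultimately show ?thesis by (rule card_inj_on_le[OF _ _ finite_restr])
  qed
  have "f ` (P \<times> restr B) \<subseteq> {p. p permutes B}"
    using assms(1) by (auto simp: f_def P_def restr_def intro: permutes_compose permutes_subset)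
  then have "card (f ` (P \<times> restr B)) \<le> card {p. p permutes B}"
    by (rule card_mono[OF finite_permutations[OF assms(2)]])
  also have "\<dots> = fact (card B)" by (rule card_permutations[OF refl assms(2)])
  finally have le: "card (f ` (P \<times> restr B)) \<le> fact (card B)" .
  have "fact (card B') * card (restr B) = card (P \<times> restr B)"
    using card_permutations[OF refl fB'] by (simp add: card_cartesian_product P_def)
  also have "\<dots> \<le> card (f ` (P \<times> restr B)) * card (restr B')"
    by (rule card_le_fibers) (use fP finite_restr fib in auto)
  also have "\<dots> \<le> fact (card B) * card (restr B')"
    using le by (rule mult_le_mono1)
  finally show ?thesis .
qed

section \<open>Without 3-cycles the index is large\<close>

definition no_cyc3 :: "'a set \<Rightarrow> bool" where
  "no_cyc3 B \<longleftrightarrow> (\<forall>a\<in>B. \<forall>b\<in>B. \<forall>c\<in>B. distinct [a, b, c] \<longrightarrow> cyc3 a b c \<notin> U)"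

lemma no_cyc3_support:
  assumes "no_cyc3 B" "u \<in> restr B"
  shows "card (support u) \<noteq> 3"
proof
  assume "card (support u) = 3"
  moreover have "bij u" using assms(2) by (simp add: restr_def bij_mem)
  ultimately obtain a b c where "distinct [a, b, c]" "support u = {a, b, c}" "u = cyc3 a b c"
    using support_card_3 by metis
  moreover have "support u \<subseteq> B" using assms(2) by (simp add: restr_def support_subset)
  ultimately show False using assms(1,2) by (auto simp: no_cyc3_def restr_def)
qed

text \<open>Take \<open>R\<close> inside \<open>S\<close> such that \<open>x\<close> maps
  \<open>R\<close> off itself. An element \<open>y\<close> of
  \<open>restr ((B - S) \<union> R)\<close> that moves a point of \<open>R\<close> has a nontrivial
  commutator with \<open>x\<close>, whose support has at most \<open>3 * card R\<close> points;
  minimality of \<open>x\<close> forbids this. So \<open>R\<close> can be added to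
  \<open>B - S\<close> without enlarging the group, while the factorial grows.\<close>

lemma fixed_points_gain:
  assumes B: "B \<subseteq> X" "no_cyc3 B" and x: "x \<in> restr B" "x \<noteq> id"
    and min: "\<And>y. y \<in> restr B \<Longrightarrow> y \<noteq> id \<Longrightarrow> card (support x) \<le> card (support y)"
  defines "S \<equiv> support x"
  shows "\<exists>R\<subseteq>S. card S \<le> 6 * card R \<and> 0 < card R \<and> restr ((B - S) \<union> R) = restr (B - S)"
proof -
  have fB: "finite B" using B finite_X finite_subset by blast
  have bx: "bij x" and xU: "x \<in> U" using x by (auto simp: restr_def bij_mem)
  have SB: "S \<subseteq> B" using x(1) by (simp add: S_def restr_def support_subset)
  then have fS: "finite S" using fB finite_subset by blast
  have S0: "S \<noteq> {}" using x(2) by (simp add: S_def support_empty_iff)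
  have "card S \<noteq> 1"
  proof
    assume "card S = 1"
    then obtain z where "S = {z}" by (auto simp: card_1_singleton_iff)
    then show False using support_image[OF bx, of z] by (auto simp: S_def support_def)
  qed
  moreover have "card S \<noteq> 0" using S0 fS by simp
  moreover have "card S \<noteq> 3" using no_cyc3_support[OF B(2) x(1)] by (auto simp: S_def)
  ultimately have s: "card S = 2 \<or> 4 \<le> card S" by linarith
  \<comment> \<open>The ceiling of \<open>card S / 6\<close>. It satisfies
    \<open>3 * r < card S\<close> once \<open>card S\<close> is at least 4; size 3 is excluded as a
    3-cycle, and size 2 is treated apart below.\<close>
  define r where "r = (card S + 5) div 6"
  have r: "card S \<le> 6 * r" "0 < r" "3 * r < card S + 3" "4 \<le> card S \<Longrightarrow> 3 * r < card S" "card S = 2 \<Longrightarrow> r = 1"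
    using s unfolding r_def by presburger+
  obtain R where R: "R \<subseteq> S" "card R = r" "\<forall>p\<in>R. x p \<notin> R"
    using independent_subset[OF bx fS _ r(3)] by (auto simp: S_def)
  have fR: "finite R" using R(1) fS finite_subset by blast
  have fixR: "y p = p" if y: "y \<in> restr ((B - S) \<union> R)" and p: "p \<in> R" for y p
  proof (rule ccontr)
    assume yp: "y p \<noteq> p"
    have yU: "y \<in> U" and by': "bij y" using y by (auto simp: restr_def bij_mem)
    have ys: "support y \<subseteq> (B - S) \<union> R" using y by (simp add: restr_def support_subset)
    define w where "w = x \<circ> y \<circ> inv x \<circ> inv y"
    define I where "I = support x \<inter> support y"
    have IR: "I \<subseteq> R" using ys by (auto simp: I_def S_def)
    \<comment> \<open>\<open>y\<close> fixes \<open>x p\<close> because \<open>x p\<close> lies in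
      \<open>S\<close> outside \<open>R\<close>; this is what makes the commutator
      nontrivial.\<close>
    have xp: "y (x p) = x p"
    proof -
      have "x p \<in> S" using support_image[OF bx] p R(1) by (auto simp: S_def)
      then have "x p \<notin> support y" using ys R(3) p by auto
      then show ?thesis by (simp add: support_def)
    qed
    have wid: "w \<noteq> id"
    proof
      assume "w = id"
      then have "w (y (x p)) = y (x p)" by simp
      then have "x (y p) = y (x p)" using bx by' by (simp add: w_def bij_def)
      then have "x (y p) = x p" using xp by simp
      then show False using yp bx by (simp add: bij_def inj_eq)
    qed
    have "y permutes B" using y SB R(1) by (auto simp: restr_def intro!: permutes_subset[of y "(B - S) \<union> R"])
    moreover have "x permutes B" using x by (simp add: restr_def)
    ultimately have "w permutes B" by (auto simp: w_def intro!: permutes_compose permutes_inv)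
    moreover have "w \<in> U" using xU yU by (auto simp: w_def intro!: comp_mem inv_mem)
    ultimately have wB: "w \<in> restr B" by (simp add: restr_def)
    have fI: "finite I" using IR fR finite_subset by blast
    have "card (support w) \<le> card (I \<union> x ` I \<union> y ` I)"
      using support_commutator[OF bx by'] fI by (auto simp: w_def I_def intro!: card_mono)
    also have "\<dots> \<le> card I + card I + card I"
      by (intro order.trans[OF card_Un_le] add_mono card_image_le fI order.refl)
    also have "\<dots> \<le> 3 * r" using card_mono[OF fR IR] R(2) by simp
    finally have cw: "card (support w) \<le> 3 * r" .
    show False
    \<comment> \<open>For a transposition \<open>x\<close> the commutator bound 3 does not
      contradict minimality. Instead the commutator moves exactly \<open>p\<close>,
      \<open>x p\<close> and \<open>y p\<close>, so its support has size 3 and it is a forbidden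
      3-cycle.\<close>
    proof (cases "card S = 2")
      case True
      then have c3: "card (support w) \<le> 3" using cw r(5) by simp
      then have "card (support w) \<noteq> 3" using no_cyc3_support[OF B(2) wB] by simp
      moreover have "{p, x p, y p} \<subseteq> support w"
      proof -
        have pS: "p \<in> S" using p R(1) by auto
        have xpS: "x p \<in> S" using support_image[OF bx] pS by (auto simp: S_def)
        have ne: "x p \<noteq> p" using pS by (auto simp: S_def support_def)
        have "{p, x p} = S" by (rule card_seteq[OF fS]) (use pS xpS ne True in auto)
        then have S2: "S = {p, x p}" by simp
        have "x (x p) \<noteq> x p" using ne bx by (simp add: bij_def inj_eq)
        moreover have "x (x p) \<in> S" using support_image[OF bx] xpS by (auto simp: S_def)
        ultimately have xxp: "x (x p) = p" using S2 by auto
        have yps: "y p \<in> support y" using support_image[OF by', of p] yp by (simp add: support_def)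
        have ypx: "y p \<noteq> x p" using xp yp by' by (metis bij_def injD)
        have ypS: "y p \<notin> S" using ypx yp S2 by simp
        have xyp: "x (y p) = y p" using ypS by (simp add: S_def support_def)
        have ix: "inv x (x z) = z" "inv y (y z) = z" for z using bx by' by (simp_all add: bij_def)
        have ixp: "inv x p = x p" using ix xxp by metis
        have iyxp: "inv y (x p) = x p" using ix xp by metis
        have ixyp: "inv x (y p) = y p" using ix xyp by metis
        have wyp: "w (y p) = p" using ix ixp xp xxp by (simp add: w_def)
        have wxp: "w (x p) = y p" using iyxp ix xyp by (simp add: w_def)
        have "inj w" using \<open>w permutes B\<close> by (rule permutes_inj)
        then have "w p \<noteq> p" using wyp yp by (metis injD)
        then show ?thesis using wyp wxp yp ypx by (auto simp: support_def)
      qed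
      then have "card {p, x p, y p} \<le> card (support w)"
        using finite_subset[OF support_subset[OF \<open>w permutes B\<close>] fB] by (rule card_mono[rotated])
      moreover have "card {p, x p, y p} = 3"
      proof -
        have "x p \<noteq> p" using p R(1) by (auto simp: S_def support_def)
        moreover have "y p \<noteq> x p" using xp yp by' by (metis bij_def injD)
        ultimately show ?thesis using yp by auto
      qed
      ultimately show False using c3 by simp
    next
      case False
      then show False using s r(4) cw min[OF wB wid] by (simp add: S_def)
    qed
  qed
  have "restr ((B - S) \<union> R) \<subseteq> restr (B - S)"
  proof
    fix y assume y: "y \<in> restr ((B - S) \<union> R)"
    then have "support y \<subseteq> (B - S) \<union> R" by (simp add: restr_def support_subset)
    moreover have "support y \<inter> R = {}" using fixR[OF y] by (auto simp: support_def)
    ultimately have "support y \<subseteq> B - S" by auto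
    then show "y \<in> restr (B - S)" using y permutes_support by (auto simp: restr_def)
  qed
  moreover have "restr (B - S) \<subseteq> restr ((B - S) \<union> R)" by (rule restr_mono) auto
  ultimately show ?thesis using R r by (intro exI[of _ R]) auto
qed

text \<open>Each round replaces \<open>B\<close> by \<open>B - S\<close> for the support
  \<open>S\<close> of an element of minimal support. It spends at most \<open>6 * r\<close> points,
  \<open>r = card R\<close>, and gains the factor \<open>(b + r)! / b!\<close>, at least
  \<open>t ^ r\<close>, where \<open>b\<close> is the number of points left; hence
  \<open>6 * e\<close> points pay for \<open>t ^ e\<close>. The further \<open>3 * t\<close> points
  keep \<open>b\<close> at least \<open>t\<close>, because the nontrivial elements on
  \<open>2 * t\<close> points force \<open>card S\<close> to be at most
  \<open>2 * t\<close>.\<close>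

lemma growth:
  assumes "B \<subseteq> X" "no_cyc3 B" "0 < t" "3 * t + 6 * e \<le> card B"
    and "\<And>B'. B' \<subseteq> B \<Longrightarrow> card B' = 2 * t \<Longrightarrow> restr B' \<noteq> {id}"
  shows "t ^ e * card (restr B) \<le> fact (card B)"
  using assms(1,2,4,5)
proof (induction e arbitrary: B rule: less_induct)
  case (less e B)
  have fB: "finite B" using less.prems(1) finite_X finite_subset by blast
  show ?case
  proof (cases "e = 0")
    case True
    then show ?thesis using card_restr_le[OF fB] by simp
  next
    case False
    have "2 * t \<le> card B" using less.prems(3) by simp
    then obtain B1 where B1: "B1 \<subseteq> B" "card B1 = 2 * t" "finite B1"
      by (rule obtain_subset_with_card_n)
    obtain y where y: "y \<in> restr B1" "y \<noteq> id" using less.prems(4)[OF B1(1,2)] id_restr by blast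
    have yB: "y \<in> restr B" using y(1) restr_mono[OF B1(1)] by blast
    define N where "N = (\<lambda>z. z \<in> restr B \<and> z \<noteq> id)"
    define x where "x = arg_min (\<lambda>z. card (support z)) N"
    have Nx: "N x" and min: "\<And>z. N z \<Longrightarrow> card (support x) \<le> card (support z)"
      using arg_min_nat_lemma[of N y "\<lambda>z. card (support z)"] y yB by (auto simp: N_def x_def)
    have x: "x \<in> restr B" "x \<noteq> id" using Nx by (simp_all add: N_def)
    define S where "S = support x"
    have SB: "S \<subseteq> B" using x(1) by (simp add: S_def restr_def support_subset)
    have fS: "finite S" using SB fB finite_subset by blast
    have "card S \<le> card (support y)" using min[of y] yB y(2) by (simp add: N_def S_def)
    also have "\<dots> \<le> card B1" using y(1) B1(3) by (intro card_mono support_subset) (auto simp: restr_def)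
    finally have S2t: "card S \<le> 2 * t" using B1(2) by simp
    obtain R where R: "R \<subseteq> S" "card S \<le> 6 * card R" "0 < card R"
        "restr ((B - S) \<union> R) = restr (B - S)"
      using fixed_points_gain[OF less.prems(1,2) x] min by (auto simp: N_def S_def)
    define r where "r = card R"
    define b where "b = card (B - S)"
    have bB: "b + card S = card B" using card_Diff_subset[OF fS SB] card_mono[OF fB SB] by (simp add: b_def)
    have cu: "card ((B - S) \<union> R) = b + r"
      unfolding b_def r_def using R(1) fB fS finite_subset by (intro card_Un_disjoint) auto
    \<comment> \<open>When \<open>r\<close> is at least \<open>e\<close>, natural subtraction makes
      the exponent 0 and the trivial bound by the factorial is enough.\<close>
    have IH: "t ^ (e - r) * card (restr (B - S)) \<le> fact b"
    proof (cases "r < e")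
      case True
      have h1: "3 * t + 6 * (e - r) \<le> card (B - S)"
        using less.prems(3) bB R(2) True by (simp add: r_def b_def)
      have h2: "no_cyc3 (B - S)" using less.prems(2) by (auto simp: no_cyc3_def)
      have h3: "e - r < e" using R(3) True by (simp add: r_def)
      have h4: "B - S \<subseteq> X" using less.prems(1) by blast
      have h5: "restr B' \<noteq> {id}" if "B' \<subseteq> B - S" "card B' = 2 * t" for B'
        using less.prems(4)[of B'] that by blast
      show ?thesis unfolding b_def by (rule less.IH[OF h3 h4 h2 h1 h5])
    next
      case False
      then show ?thesis using card_restr_le[of "B - S"] fB by (simp add: b_def)
    qed
    have tb: "t \<le> b" using less.prems(3) bB S2t by simp
    have "t ^ e * card (restr B) * fact b \<le> t ^ (e - r) * t ^ r * card (restr B) * fact b"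
      using assms(3) by (intro mult_right_mono) (auto simp: power_add[symmetric] intro!: power_increasing)
    also have "\<dots> = t ^ (e - r) * card (restr B) * (t ^ r * fact b)" by simp
    also have "\<dots> \<le> t ^ (e - r) * card (restr B) * fact (b + r)"
      using power_fact_le[OF tb] by (intro mult_left_mono) auto
    also have "\<dots> = t ^ (e - r) * (fact (card ((B - S) \<union> R)) * card (restr B))" by (simp add: cu)
    also have "\<dots> \<le> t ^ (e - r) * (fact (card B) * card (restr ((B - S) \<union> R)))"
      using index_mono[of "(B - S) \<union> R" B] R(1) SB fB by (intro mult_left_mono) auto
    also have "\<dots> = fact (card B) * (t ^ (e - r) * card (restr (B - S)))" using R(4) by simp
    also have "\<dots> \<le> fact (card B) * fact b" using IH by (rule mult_left_mono) simp
    finally show ?thesis by simp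
  qed
qed

text \<open>By \<open>index_mono\<close> the index seen on any subset is at most \<open>m\<close>.
  If some \<open>2 * t\<close> points carry only the identity, that index is \<open>(2 t)!\<close>,
  at least \<open>t ^ t\<close>; otherwise \<open>growth\<close> applies with \<open>e = t\<close>,
  and \<open>9 * t\<close> is its \<open>3 * t + 6 * t\<close>.\<close>

lemma exists_cyc3:
  assumes index: "fact (card X) \<le> m * card U" and m: "m < t ^ t"
    and B: "B \<subseteq> X" "9 * t \<le> card B"
  shows "\<exists>a\<in>B. \<exists>b\<in>B. \<exists>c\<in>B. distinct [a, b, c] \<and> cyc3 a b c \<in> U"
proof (rule ccontr)
  assume n: "\<not> ?thesis"
  then have no: "no_cyc3 B" by (auto simp: no_cyc3_def)
  have idx: "fact (card B') \<le> m * card (restr B')" if "B' \<subseteq> X" for B'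
  proof -
    have "fact (card B') * card U \<le> fact (card X) * card (restr B')"
      using index_mono[OF that finite_X] by (simp add: restr_X)
    also have "\<dots> \<le> m * card U * card (restr B')" using index by (rule mult_right_mono) simp
    finally have "fact (card B') * card U \<le> m * card (restr B') * card U" by (simp add: ac_simps)
    then show ?thesis using card_restr_pos[of X] by (simp add: restr_X)
  qed
  have t0: "0 < t"
  proof (rule ccontr)
    assume "\<not> 0 < t"
    then have "m = 0" using m by simp
    then show False using index by simp
  qed
  have "restr B' \<noteq> {id}" if "B' \<subseteq> B" "card B' = 2 * t" for B'
  proof
    assume "restr B' = {id}"
    then have "fact (2 * t) \<le> m" using idx[of B'] that B(1) by auto
    moreover have "t ^ t * fact t \<le> (fact (t + t) :: nat)" by (rule power_fact_le) simp
    then have "t ^ t \<le> (fact (2 * t) :: nat)"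
      by (metis dual_order.trans fact_ge_1 mult.right_neutral mult_2 mult_le_mono2)
    ultimately show False using m by simp
  qed
  then have "t ^ t * card (restr B) \<le> fact (card B)"
    using growth[OF B(1) no t0, of t] B(2) by simp
  also have "\<dots> \<le> m * card (restr B)" by (rule idx[OF B(1)])
  finally show False using m card_restr_pos[of B] by simp
qed

section \<open>Points linked by 3-cycles\<close>

definition linked :: "'a \<Rightarrow> 'a \<Rightarrow> bool" where
  "linked a b \<longleftrightarrow> a = b \<or> (\<exists>c. distinct [a, b, c] \<and> cyc3 a b c \<in> U)"

lemma conj_mem:
  assumes "g \<in> U" "cyc3 a b c \<in> U" shows "cyc3 (g a) (g b) (g c) \<in> U"
proof -
  have "g \<circ> cyc3 a b c \<circ> inv g \<in> U" using assms by (intro comp_mem inv_mem)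
  then show ?thesis using assms(1) by (simp add: conj_cyc3 bij_mem)
qed

lemma cyc3_rotate_mem: "distinct [a, b, c] \<Longrightarrow> cyc3 a b c \<in> U \<Longrightarrow> cyc3 b c a \<in> U"
  by (subst cyc3_rotate)

lemma cyc3_rev_mem: "distinct [a, b, c] \<Longrightarrow> cyc3 a b c \<in> U \<Longrightarrow> cyc3 c b a \<in> U"
  using inv_mem inv_cyc3 by metis

lemma linked_sym: "linked a b \<Longrightarrow> linked b a"
proof -
  assume "linked a b"
  then consider "a = b" | c where "distinct [a, b, c]" "cyc3 a b c \<in> U" by (auto simp: linked_def)
  then show ?thesis
  proof cases
    case 2
    then have "cyc3 c b a \<in> U" by (rule cyc3_rev_mem)
    then have "cyc3 b a c \<in> U" using 2(1) by - (rule cyc3_rotate_mem, auto)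
    then show ?thesis using 2(1) by (auto simp: linked_def)
  qed (simp add: linked_def)
qed

text \<open>Conjugating the cycle through \<open>a\<close> and \<open>b\<close> by
  \<open>cyc3 b c m\<close> keeps \<open>a\<close> and turns \<open>b\<close> into \<open>c\<close>.
  This fails only for \<open>m = a\<close>, and then the second cycle itself contains
  \<open>a\<close> and \<open>c\<close>.\<close>

lemma linked_trans:
  assumes "linked a b" "linked b c" shows "linked a c"
proof (cases "a = b \<or> b = c \<or> a = c")
  case True
  then show ?thesis using assms by (auto simp: linked_def)
next
  case False
  then obtain k m where k: "distinct [a, b, k]" "cyc3 a b k \<in> U"
    and m: "distinct [b, c, m]" "cyc3 b c m \<in> U"
    using assms by (auto simp: linked_def)
  show ?thesis
  proof (cases "a = m")
    case True
    then have "cyc3 c a b \<in> U" using m by - (rule cyc3_rotate_mem, auto)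
    then have "linked c a" using m(1) True False by (auto simp: linked_def)
    then show ?thesis by (rule linked_sym)
  next
    case am: False
    let ?d = "cyc3 b c m"
    have "?d a = a" "?d b = c" using False am m(1) by (simp_all add: cyc3_apply)
    then have "cyc3 a c (?d k) \<in> U" using conj_mem[OF m(2) k(2)] by simp
    moreover have "?d k \<noteq> a" "?d k \<noteq> c"
      using False am m(1) k(1) by (auto simp: cyc3_apply)
    ultimately show ?thesis using False by (auto simp: linked_def)
  qed
qed

lemma linked_image:
  assumes "g \<in> U" "linked a b" shows "linked (g a) (g b)"
proof (cases "a = b")
  case False
  then obtain c where c: "distinct [a, b, c]" "cyc3 a b c \<in> U" using assms(2) by (auto simp: linked_def)
  have "distinct [g a, g b, g c]" using c(1) bij_mem[OF assms(1)] by (simp add: bij_def inj_eq)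
  then show ?thesis using conj_mem[OF assms(1) c(2)] unfolding linked_def by blast
qed (simp add: linked_def)

lemma linked_in_X: "linked a b \<Longrightarrow> a \<in> X \<Longrightarrow> b \<in> X"
proof -
  assume "linked a b" "a \<in> X"
  then consider "a = b" | c where "distinct [a, b, c]" "cyc3 a b c \<in> U" by (auto simp: linked_def)
  then show ?thesis
  proof cases
    case 2
    then have "cyc3 a b c a \<in> X" using \<open>a \<in> X\<close> permutes permutes_in_image by metis
    then show ?thesis using 2(1) by (simp add: cyc3_apply)
  qed (use \<open>a \<in> X\<close> in simp)
qed

text \<open>The third point of a cycle \<open>cyc3 i j a\<close> is exchanged for \<open>k\<close>
  by conjugating with \<open>cyc3 a k b\<close>. If \<open>b\<close> collides with \<open>i\<close>
  or \<open>j\<close>, conjugation with the inverse gives a cycle on \<open>i\<close>,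
  \<open>j\<close>, \<open>k\<close> of the opposite orientation, whose inverse is the wanted one.
  So a class carries all 3-cycles on its points.\<close>

lemma linked_cyc3:
  assumes "linked i j" "linked j k" "distinct [i, j, k]"
  shows "cyc3 i j k \<in> U"
proof -
  obtain a where a: "distinct [i, j, a]" "cyc3 i j a \<in> U" using assms(1,3) by (auto simp: linked_def)
  have "linked i a"
  proof -
    have "cyc3 j a i \<in> U" using a by (rule cyc3_rotate_mem)
    then have "cyc3 a i j \<in> U" using a(1) by - (rule cyc3_rotate_mem, auto)
    then have "linked a i" using a(1) by (auto simp: linked_def)
    then show ?thesis by (rule linked_sym)
  qed
  then have ak: "linked a k" using assms linked_trans linked_sym by blast
  show ?thesis
  proof (cases "a = k")
    case False
    then obtain b where b: "distinct [a, k, b]" "cyc3 a k b \<in> U" using ak by (auto simp: linked_def)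
    let ?e = "cyc3 a k b"
    have c1: "cyc3 (?e i) (?e j) (?e a) \<in> U" by (rule conj_mem[OF b(2) a(2)])
    have e': "cyc3 b k a \<in> U" by (rule cyc3_rev_mem[OF b])
    have c2: "cyc3 (cyc3 b k a i) (cyc3 b k a j) (cyc3 b k a a) \<in> U" by (rule conj_mem[OF e' a(2)])
    have d: "distinct [b, k, a]" using b(1) by auto
    consider "b \<noteq> i" "b \<noteq> j" | "b = j" | "b = i" by blast
    then show ?thesis
    proof cases
      case 1
      then show ?thesis using c1 assms(3) a(1) b(1) by (simp add: cyc3_apply)
    next
      case 2
      then have "cyc3 i k j \<in> U" using c2 assms(3) a(1) d by (auto simp: cyc3_apply)
      then have "cyc3 j k i \<in> U" using assms(3) by - (rule cyc3_rev_mem, auto)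
      then have "cyc3 k i j \<in> U" using assms(3) by - (rule cyc3_rotate_mem, auto)
      then show ?thesis using assms(3) by - (rule cyc3_rotate_mem, auto)
    next
      case 3
      then have "cyc3 k j i \<in> U" using c2 assms(3) a(1) d by (auto simp: cyc3_apply)
      then show ?thesis using assms(3) by - (rule cyc3_rev_mem, auto)
    qed
  qed (use a in simp)
qed

section \<open>Orbits of point sets\<close>

lemma card_stabilizer_le:
  assumes A: "A \<subseteq> X"
  shows "card {g \<in> U. g ` A = A} \<le> fact (card A) * fact (card X - card A)"
proof -
  define P Q where "P = {p. p permutes A}" and "Q = {p. p permutes (X - A)}"
  have fA: "finite A" using A finite_X finite_subset by blast
  define f where "f = (\<lambda>(g :: 'a \<Rightarrow> 'a). (\<lambda>z. if z \<in> A then g z else z, \<lambda>z. if z \<in> X - A then g z else z))"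
  have "inj_on f {g \<in> U. g ` A = A}"
  proof (rule inj_onI)
    fix g h assume gh: "g \<in> {g \<in> U. g ` A = A}" "h \<in> {g \<in> U. g ` A = A}" "f g = f h"
    have "g z = h z" for z
    proof (cases "z \<in> X")
      case True
      have "fst (f g) z = fst (f h) z" "snd (f g) z = snd (f h) z" using gh(3) by simp_all
      then show ?thesis using True by (auto simp: f_def split: if_splits)
    next
      case False
      then show ?thesis using gh(1,2) permutes by (metis (mono_tags, lifting) mem_Collect_eq permutes_not_in)
    qed
    then show "g = h" by blast
  qed
  moreover have "f ` {g \<in> U. g ` A = A} \<subseteq> P \<times> Q"
  proof -
    have "f g \<in> P \<times> Q" if g: "g \<in> U" "g ` A = A" for g
    proof -
      have inj: "inj g" using bij_mem[OF g(1)] by (simp add: bij_def)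
      have "g ` X = X" using permutes[OF g(1)] by (rule permutes_image)
      then have gX: "g ` (X - A) = X - A" using g(2) inj by (simp add: image_set_diff)
      have "bij_betw (fst (f g)) A A"
        using g(2) inj by (auto simp: f_def bij_betw_def inj_on_def inj_def cong: image_cong_simp)
      then have "fst (f g) permutes A" by (rule bij_imp_permutes) (auto simp: f_def)
      then have 1: "fst (f g) \<in> P" by (simp add: P_def)
      have "bij_betw (snd (f g)) (X - A) (X - A)"
        using gX inj by (auto simp: f_def bij_betw_def inj_on_def inj_def cong: image_cong_simp)
      then have "snd (f g) permutes (X - A)" by (rule bij_imp_permutes) (auto simp: f_def)
      then have "snd (f g) \<in> Q" by (simp add: Q_def)
      then show ?thesis using 1 by (simp add: mem_Times_iff)
    qed
    then show ?thesis by (simp add: image_subset_iff)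
  qed
  moreover have "finite (P \<times> Q)"
    using fA finite_X by (auto simp: P_def Q_def intro!: finite_permutations)
  ultimately have "card {g \<in> U. g ` A = A} \<le> card (P \<times> Q)" by (rule card_inj_on_le)
  also have "\<dots> = fact (card A) * fact (card X - card A)"
    using card_permutations[OF refl fA] card_permutations[OF refl, of "X - A"] finite_X fA A
    by (simp add: P_def Q_def card_cartesian_product card_Diff_subset)
  finally show ?thesis .
qed

text \<open>Orbit counting: the group consists of at most \<open>q\<close> cosets of the stabilizer
  of \<open>A\<close>, which embeds into the product of the symmetric groups of \<open>A\<close> and
  of its complement. A group of small index therefore cannot have a small orbit on sets of medium
  size.\<close>

lemma binomial_le_orbit:
  assumes index: "fact (card X) \<le> m * card U" and A: "A \<subseteq> X"
    and q: "card ((\<lambda>u. u ` A) ` U) \<le> q"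
  shows "card X choose card A \<le> m * q"
proof -
  let ?s = "fact (card A) * fact (card X - card A) :: nat"
  have "card {u \<in> U. u ` A = Y} \<le> ?s" if Y: "Y \<in> (\<lambda>u. u ` A) ` U" for Y
  proof -
    obtain u0 where u0: "u0 \<in> U" "Y = u0 ` A" using Y by blast
    have b0: "bij u0" using u0 by (rule_tac bij_mem)
    have "inj_on (\<lambda>u. inv u0 \<circ> u) {u \<in> U. u ` A = Y}"
    proof (rule inj_onI)
      fix u v assume "inv u0 \<circ> u = inv u0 \<circ> v"
      then have "inv u0 (u z) = inv u0 (v z)" for z by (metis comp_apply)
      then show "u = v" using b0 by (metis bij_inv_eq_iff ext)
    qed
    moreover have "(\<lambda>u. inv u0 \<circ> u) ` {u \<in> U. u ` A = Y} \<subseteq> {g \<in> U. g ` A = A}"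
    proof clarify
      fix u assume u: "u \<in> U" "Y = u ` A"
      have "(inv u0 \<circ> u) ` A = inv u0 ` u0 ` A" using u(2) u0(2) by (metis image_comp)
      also have "\<dots> = A" using b0 by (simp add: bij_def image_inv_f_f)
      finally show "inv u0 \<circ> u \<in> U \<and> (inv u0 \<circ> u) ` A = A"
        using u u0 by (auto intro: comp_mem inv_mem)
    qed
    ultimately have "card {u \<in> U. u ` A = Y} \<le> card {g \<in> U. g ` A = A}"
      by (rule card_inj_on_le) (use finite_U in auto)
    then show ?thesis using card_stabilizer_le[OF A] by linarith
  qed
  then have "card U \<le> card ((\<lambda>u. u ` A) ` U) * ?s"
    by (rule card_le_fibers[OF finite_U])
  also have "\<dots> \<le> q * ?s" using q by (rule mult_le_mono1)
  finally have U: "card U \<le> q * ?s" .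
  have aX: "card A \<le> card X" using A finite_X by (rule card_mono[rotated])
  have "?s * (card X choose card A) = fact (card X)"
    by (rule binomial_fact_lemma[OF aX])
  also have "\<dots> \<le> m * card U" by (rule index)
  also have "\<dots> \<le> ?s * (m * q)" using mult_le_mono2[OF U, of m] by (simp add: ac_simps)
  finally show ?thesis by (subst (asm) mult_le_cancel1) simp
qed

definition cls :: "'a \<Rightarrow> 'a set" where
  "cls a = {b \<in> X. linked a b}"

lemma linked_refl: "linked a a"
  by (simp add: linked_def)

lemma cls_eq_iff: "a \<in> X \<Longrightarrow> b \<in> X \<Longrightarrow> cls a = cls b \<longleftrightarrow> linked a b"
  using linked_sym linked_trans linked_refl unfolding cls_def by blast

text \<open>Representatives of \<open>9 * t\<close> classes would form a set to which
  \<open>exists_cyc3\<close> applies, and the 3-cycle found there links two of them.\<close>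

lemma card_classes:
  assumes index: "fact (card X) \<le> m * card U" and m: "m < t ^ t"
  shows "card (cls ` X) < 9 * t"
proof (rule ccontr)
  assume n: "\<not> ?thesis"
  obtain T where T: "T \<subseteq> X" "inj_on cls T" "cls ` T = cls ` X"
    by (metis inj_on_inv_into inv_into_into subset_image_inj order_refl)
  then have "9 * t \<le> card T" using n card_image[OF T(2)] by simp
  then obtain a b c where abc: "a \<in> T" "b \<in> T" "distinct [a, b, c]" "cyc3 a b c \<in> U"
    using exists_cyc3[OF index m T(1)] by blast
  then have "linked a b" by (auto simp: linked_def)
  then have "cls a = cls b" using abc(1,2) T(1) cls_eq_iff by blast
  then have "a = b" using abc(1,2) T(2) by (auto dest: inj_onD)
  then show False using abc(3) by simp
qed

lemma image_cls: "u \<in> U \<Longrightarrow> a \<in> X \<Longrightarrow> u ` cls a = cls (u a)"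
proof
  assume u: "u \<in> U" and a: "a \<in> X"
  have uX: "u z \<in> X \<longleftrightarrow> z \<in> X" for z using permutes[OF u] by (rule permutes_in_image)
  show "u ` cls a \<subseteq> cls (u a)" using linked_image[OF u] uX by (auto simp: cls_def)
  show "cls (u a) \<subseteq> u ` cls a"
  proof
    fix b assume b: "b \<in> cls (u a)"
    have "linked (inv u (u a)) (inv u b)" using b linked_image[OF inv_mem[OF u]] by (auto simp: cls_def)
    then have "linked a (inv u b)" using bij_mem[OF u] by (simp add: bij_def)
    moreover have "u (inv u b) = b" using bij_mem[OF u] by (simp add: bij_def surj_f_inv_f)
    moreover have "inv u b \<in> X" using linked_in_X[OF calculation(1) a] .
    ultimately show "b \<in> u ` cls a" unfolding cls_def by (metis (mono_tags, lifting) imageI mem_Collect_eq)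
  qed
qed

end

text \<open>If no member reaches a third, take a subfamily with the fewest members whose union still
  does. Without one of its members the union is below a third, and that member adds less than
  another third.\<close>

lemma balanced_union:
  assumes "finite P" "finite X" "\<Union> P = X" "\<And>C. C \<in> P \<Longrightarrow> 3 * card C \<le> 2 * card X"
  shows "\<exists>Q\<subseteq>P. card X \<le> 3 * card (\<Union> Q) \<and> 3 * card (\<Union> Q) \<le> 2 * card X"
proof (cases "\<exists>C\<in>P. card X \<le> 3 * card C")
  case True
  then obtain C where "C \<in> P" "card X \<le> 3 * card C" by blast
  then show ?thesis using assms(4) by (intro exI[of _ "{C}"]) auto
next
  case False
  define N where "N = (\<lambda>Q. Q \<subseteq> P \<and> card X \<le> 3 * card (\<Union> Q))"
  have "N P" using assms(3) by (simp add: N_def)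
  define Q where "Q = arg_min card N"
  have NQ: "N Q" and min: "\<And>R. N R \<Longrightarrow> card Q \<le> card R"
    using arg_min_nat_lemma[of N P card] \<open>N P\<close> by (auto simp: Q_def)
  have QP: "Q \<subseteq> P" using NQ by (simp add: N_def)
  have fQ: "finite Q" using QP assms(1) finite_subset by blast
  show ?thesis
  proof (cases "Q = {}")
    case True
    then show ?thesis using NQ by (intro exI[of _ Q]) (auto simp: N_def)
  next
    case ne: False
    then obtain C where C: "C \<in> Q" by blast
    have "card (Q - {C}) < card Q" using C fQ by (simp add: card_gt_0_iff card_Diff_singleton ne)
    then have "\<not> N (Q - {C})" using min[of "Q - {C}"] by linarith
    then have lt: "3 * card (\<Union> (Q - {C})) < card X" using QP by (auto simp: N_def)
    have "\<Union> Q = \<Union> (Q - {C}) \<union> C" using C by auto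
    then have "card (\<Union> Q) \<le> card (\<Union> (Q - {C})) + card C" by (metis card_Un_le)
    moreover have "3 * card C < card X" using False C QP by (meson linorder_not_less subsetD)
    ultimately have "3 * card (\<Union> Q) \<le> 2 * card X" using lt by linarith
    then show ?thesis using NQ by (intro exI[of _ Q]) (auto simp: N_def)
  qed
qed

text \<open>The ratio of consecutive coefficients is \<open>(n - i) / (i + 1)\<close>, which is at
  least 2 while \<open>i + 1\<close> is at most \<open>n / 3\<close>.\<close>

lemma binomial_doubling:
  assumes "k + j \<le> n div 3" shows "(n choose k) * 2 ^ j \<le> (n choose (k + j) :: nat)"
  using assms
proof (induction j)
  case (Suc j)
  let ?i = "k + j"
  have "Suc ?i * (2 * (n choose ?i)) = 2 * Suc ?i * (n choose ?i)" by simp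
  also have "\<dots> \<le> (n - ?i) * (n choose ?i)" using Suc.prems by (intro mult_right_mono) auto
  also have "\<dots> = Suc ?i * (n choose Suc ?i)" 
    using binomial_absorb_comp[of n ?i] binomial_absorption[of ?i n] by simp
  finally have "2 * (n choose ?i) \<le> n choose Suc ?i" by (simp only: mult_le_cancel1)
  moreover have "(n choose k) * 2 ^ j \<le> n choose ?i" using Suc by simp
  ultimately show ?case by simp
qed simp

context permutation_group
begin

text \<open>
  The bound on \<open>card X\<close> makes \<open>t = card X div 120\<close> at least \<open>2 ^ 240\<close>, hence
  \<open>2 ^ card X \<le> t ^ t\<close>.
\<close>
theorem small_index:
  assumes index: "fact (card X) \<le> m * card U" and m: "m < (card X choose k)"
    and k: "4 * k \<le> card X" and large: "120 * 2 ^ 240 \<le> card X"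
  shows "\<exists>W\<subseteq>X. card W \<le> k \<and> (\<forall>a b c. {a, b, c} \<subseteq> X - W \<longrightarrow> distinct [a, b, c] \<longrightarrow> cyc3 a b c \<in> U)"
proof -
  define n where "n = card X"
  define t where "t = n div 120"
  have "(120 * 2 ^ 240) div 120 \<le> t"
    unfolding t_def n_def by (rule div_le_mono[OF large])
  then have t1: "2 ^ 240 \<le> t" by simp
  moreover have "(1::nat) \<le> 2 ^ 240" by (rule one_le_power) simp
  ultimately have "1 \<le> t" by (rule order.trans[rotated])
  moreover have "n = 120 * t + n mod 120" "n mod 120 < 120" "n = 3 * (n div 3) + n mod 3" "n mod 3 < 3"
    by (simp_all add: t_def)
  \<comment> \<open>The divisor 120 is chosen so that \<open>9 * t\<close>, at most
    \<open>3 n / 40\<close>, stays below \<open>n / 3 - k\<close>, which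
    \<open>4 * k \<le> n\<close> makes at least \<open>n / 12\<close>; the gap absorbs the
    rounding.\<close>
  ultimately have t2: "n \<le> 240 * t" "9 * t + k \<le> n div 3"
    using k[folded n_def] by linarith+
  have t: "2 ^ 240 \<le> t" "n \<le> 240 * t" "9 * t \<le> n div 3 - k"
    using t1 t2 by simp_all
  have "n choose k \<le> 2 ^ n" by (rule binomial_le_pow2)
  also have "(2::nat) ^ n \<le> 2 ^ (240 * t)" using t(2) by (intro power_increasing) auto
  also have "\<dots> = (2 ^ 240) ^ t" by (simp only: power_mult)
  also have "\<dots> \<le> t ^ t" using t(1) by (intro power_mono) auto
  finally have mt: "m < t ^ t" using m by (simp add: n_def)
  have cP: "card (cls ` X) < 9 * t" by (rule card_classes[OF index mt])
  have UP: "\<Union> (cls ` X) = X" using linked_refl by (auto simp: cls_def)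
  have clsX: "cls a \<subseteq> X" for a by (auto simp: cls_def)
  have cle: "card (cls a) \<le> n" for a unfolding n_def by (rule card_mono[OF finite_X clsX])
  show ?thesis
  proof (cases "\<exists>a\<in>X. n - k \<le> card (cls a)")
    case True
    then obtain a where a: "a \<in> X" "n - k \<le> card (cls a)" by blast
    have "card (X - cls a) = n - card (cls a)"
      unfolding n_def by (rule card_Diff_subset[OF finite_subset[OF clsX finite_X] clsX])
    then have "card (X - cls a) \<le> k" using a(2) by simp
    moreover have "cyc3 x y z \<in> U" if "{x, y, z} \<subseteq> X - (X - cls a)" "distinct [x, y, z]" for x y z
    proof (rule linked_cyc3)
      have "linked a x" "linked a y" "linked a z" using that(1) by (auto simp: cls_def)
      then show "linked x y" "linked y z" using linked_sym linked_trans by blast+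
    qed (rule that(2))
    ultimately show ?thesis by (intro exI[of _ "X - cls a"]) blast
  next
    case small: False
    have False
    \<comment> \<open>A class with more than two thirds of the points is unique, hence invariant, so
      its orbit is a single set although more than \<open>k\<close> points lie outside it. Otherwise
      some union of classes has between one and two thirds of the points; its images are again
      unions of classes, so there are at most \<open>2 ^ (9 * t)\<close> of them. Either orbit is
      too small for the index.\<close>
    proof (cases "\<exists>a\<in>X. 2 * n < 3 * card (cls a)")
      case True
      then obtain a where a: "a \<in> X" "2 * n < 3 * card (cls a)" by blast
      have "u ` cls a = cls a" if u: "u \<in> U" for u
      proof -
        have ua: "u a \<in> X" using permutes[OF u] a(1) by (simp add: permutes_in_image)
        have c: "card (u ` cls a) = card (cls a)"
          using bij_mem[OF u] by (intro card_image) (auto simp: bij_def intro: inj_on_subset)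
        have "cls (u a) \<inter> cls a \<noteq> {}"
        proof
          assume "cls (u a) \<inter> cls a = {}"
          then have "card (cls (u a) \<union> cls a) = card (cls (u a)) + card (cls a)"
            using clsX finite_X finite_subset by (metis card_Un_disjoint)
          moreover have "card (cls (u a) \<union> cls a) \<le> n"
            using clsX finite_X by (auto simp: n_def intro!: card_mono)
          ultimately show False using c a(2) image_cls[OF u a(1)] by simp
        qed
        then obtain z where "linked (u a) z" "linked a z" by (auto simp: cls_def)
        then have "linked (u a) a" using linked_sym linked_trans by blast
        then show ?thesis using image_cls[OF u a(1)] cls_eq_iff[OF ua a(1)] by simp
      qed
      then have "(\<lambda>u. u ` cls a) ` U \<subseteq> {cls a}" by auto
      then have "card ((\<lambda>u. u ` cls a) ` U) \<le> card {cls a}"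
        by (rule card_mono[rotated]) simp
      then have "card ((\<lambda>u. u ` cls a) ` U) \<le> 1" by simp
      then have "n choose card (cls a) \<le> m"
        using binomial_le_orbit[OF index clsX, of a 1] by (simp add: n_def)
      moreover have "n choose card (cls a) = n choose (n - card (cls a))"
        by (rule binomial_symmetric[OF cle])
      moreover have "n choose k \<le> n choose (n - card (cls a))"
        using small a by (intro binomial_mono) auto
      ultimately show False using m by (simp add: n_def)
    next
      case False
      then have "\<exists>Q\<subseteq>cls ` X. card X \<le> 3 * card (\<Union> Q) \<and> 3 * card (\<Union> Q) \<le> 2 * card X"
        using finite_X UP by (intro balanced_union) (auto simp: n_def not_less)
      then obtain Q where Q: "Q \<subseteq> cls ` X" "n \<le> 3 * card (\<Union> Q)" "3 * card (\<Union> Q) \<le> 2 * n"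
        by (auto simp: n_def)
      define A where "A = \<Union> Q"
      have AX: "A \<subseteq> X" using Q(1) UP by (auto simp: A_def)
      have "(\<lambda>u. u ` A) ` U \<subseteq> Union ` Pow (cls ` X)"
      proof clarify
        fix u assume u: "u \<in> U"
        have "(`) u ` Q \<subseteq> cls ` X"
        proof
          fix D assume "D \<in> (`) u ` Q"
          then obtain a where "a \<in> X" "D = u ` cls a" using Q(1) by blast
          then show "D \<in> cls ` X" using image_cls[OF u] permutes[OF u] permutes_in_image by (metis imageI)
        qed
        moreover have "u ` A = \<Union> ((`) u ` Q)" by (auto simp: A_def)
        ultimately show "u ` A \<in> Union ` Pow (cls ` X)" by blast
      qed
      then have "card ((\<lambda>u. u ` A) ` U) \<le> card (Union ` Pow (cls ` X))"
        using finite_X by (intro card_mono) auto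
      also have "\<dots> \<le> card (Pow (cls ` X))" using finite_X by (intro card_image_le) auto
      also have "\<dots> \<le> 2 ^ (9 * t)" using cP finite_X by (simp add: card_Pow)
      finally have "n choose card A \<le> m * 2 ^ (9 * t)"
        using binomial_le_orbit[OF index AX] by (simp add: n_def)
      moreover have "n choose (n div 3) \<le> n choose card A"
      proof (cases "2 * card A \<le> n")
        case True
        then show ?thesis using Q by (intro binomial_mono) (auto simp: A_def)
      next
        case False
        have "card A \<le> n" using AX finite_X by (auto simp: n_def intro: card_mono)
        then have "n choose card A = n choose (n - card A)" by (rule binomial_symmetric)
        moreover have "n choose (n div 3) \<le> n choose (n - card A)"
          using Q False by (intro binomial_mono) (auto simp: A_def)
        ultimately show ?thesis by simp
      qed
      moreover have "(n choose k) * 2 ^ (9 * t) \<le> (n choose k) * 2 ^ (n div 3 - k)"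
        using t(3) by (intro mult_left_mono power_increasing) auto
      moreover have "(n choose k) * 2 ^ (n div 3 - k) \<le> n choose (n div 3)"
        using binomial_doubling[of k "n div 3 - k" n] k by (simp add: n_def)
      ultimately have "(n choose k) * 2 ^ (9 * t) \<le> m * 2 ^ (9 * t)" by linarith
      then show False using m by (simp add: n_def)
    qed
    then show ?thesis ..
  qed
qed

end

section \<open>Perfect matchings of a bipartitioned node set\<close>

text \<open>The weights are the values at 0 of the Lagrange basis polynomials of \<open>S\<close>: a
  polynomial of degree at most \<open>k\<close> is its own interpolant on \<open>k + 1\<close>
  points.\<close>

lemma lagrange_weights:
  fixes S :: "real set"
  assumes "finite S" "card S = Suc k"
  shows "\<exists>b. \<forall>q. degree q \<le> k \<longrightarrow> (\<Sum>x\<in>S. b x * poly q x) = poly q 0"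
proof -
  define P where "P = (\<lambda>x. \<Prod>y\<in>S - {x}. smult (1 / (x - y)) [:- y, 1:])"
  have at: "poly (P x) z = (if x = z then 1 else 0)" if "x \<in> S" "z \<in> S" for x z
  proof (cases "x = z")
    case True
    have "poly (smult (1 / (z - y)) [:- y, 1:]) z = 1" if "y \<in> S - {z}" for y
      using that by (simp add: diff_divide_distrib[symmetric])
    then show ?thesis using True unfolding P_def poly_prod by (auto intro!: prod.neutral)
  next
    case False
    then have "(\<Prod>y\<in>S - {x}. poly (smult (1 / (x - y)) [:- y, 1:]) z) = 0"
      using assms(1) that by (intro prod_zero bexI[of _ z]) auto
    then show ?thesis using False by (simp add: P_def poly_prod)
  qed
  have deg: "degree (P x) \<le> k" if "x \<in> S" for x
  proof -
    have "degree (P x) \<le> sum (degree \<circ> (\<lambda>y. smult (1 / (x - y)) [:- y, 1:])) (S - {x})"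
      unfolding P_def using assms(1) by (intro degree_prod_sum_le) auto
    also have "\<dots> \<le> (\<Sum>y\<in>S - {x}. 1)" by (intro sum_mono) auto
    also have "\<dots> = k" using assms that by simp
    finally show ?thesis .
  qed
  have "(\<Sum>x\<in>S. poly (P x) 0 * poly q x) = poly q 0" if q: "degree q \<le> k" for q
  proof -
    define r where "r = (\<Sum>x\<in>S. smult (poly q x) (P x))"
    have "degree r \<le> k" unfolding r_def
      using deg assms(1) by (intro degree_sum_le) (auto intro: order.trans[OF degree_smult_le])
    moreover have "poly r z = poly q z" if "z \<in> S" for z
    proof -
      have "poly r z = (\<Sum>x\<in>S. if x = z then poly q x else 0)"
        unfolding r_def poly_sum using at[OF _ that] by (intro sum.cong) auto
      then show ?thesis using assms(1) that by simp
    qed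
    ultimately have "r = q" using q assms(2) by (intro poly_eqI_degree[of S]) auto
    moreover have "poly r 0 = (\<Sum>x\<in>S. poly (P x) 0 * poly q x)"
      by (simp add: r_def poly_sum mult.commute)
    ultimately show ?thesis by simp
  qed
  then show ?thesis by (intro exI[of _ "\<lambda>x. poly (P x) 0"]) simp
qed

section \<open>Existence and images of matchings\<close>

lemma even_perfect_matching:
  assumes "finite V" "even (card V)"
  shows "\<exists>M. M \<subseteq> {e. e \<subseteq> V \<and> card e = 2} \<and> pairwise disjnt M \<and> \<Union> M = V"
  using assms
proof (induction "card V" arbitrary: V rule: less_induct)
  case less
  show ?case
  proof (cases "V = {}")
    case True
    then show ?thesis by (intro exI[of _ "{}"]) auto
  next
    case False
    have "2 \<le> card V" using False less.prems by (metis One_nat_def Suc_1 Suc_leI card_eq_0_iff dvd_refl even_Suc_Suc_iff le_neq_implies_less less_one not_less odd_one)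
    then obtain e where e: "e \<subseteq> V" "card e = 2" by (meson obtain_subset_with_card_n)
    have c: "card (V - e) = card V - 2" using e less.prems(1) by (simp add: card_Diff_subset finite_subset)
    obtain M where M: "M \<subseteq> {f. f \<subseteq> V - e \<and> card f = 2}" "pairwise disjnt M" "\<Union> M = V - e"
      using less.hyps[of "V - e"] c less.prems \<open>2 \<le> card V\<close> by (auto simp del: Union_eq)
    have "pairwise disjnt (insert e M)"
      using M by (auto simp: pairwise_insert disjnt_def)
    moreover have "insert e M \<subseteq> {e. e \<subseteq> V \<and> card e = 2}" using M(1) e by auto
    moreover have "\<Union> (insert e M) = V" using M(3) e(1) by auto
    ultimately show ?thesis by blast
  qed
qed

text \<open>Choosing a node of \<open>W\<close> in each such edge is injective because the edges are
  disjoint.\<close>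

lemma card_touching:
  assumes "pairwise disjnt A" "finite W"
  shows "card {e \<in> A. e \<inter> W \<noteq> {}} \<le> card W"
proof -
  define w where "w = (\<lambda>e. SOME v. v \<in> e \<inter> W)"
  have w: "w e \<in> e \<inter> W" if "e \<inter> W \<noteq> {}" for e
    using that unfolding w_def some_in_eq .
  have "inj_on w {e \<in> A. e \<inter> W \<noteq> {}}"
  proof (rule inj_onI)
    fix e f assume ef: "e \<in> {e \<in> A. e \<inter> W \<noteq> {}}" "f \<in> {e \<in> A. e \<inter> W \<noteq> {}}" "w e = w f"
    then have "\<not> disjnt e f" using w[of e] w[of f] by (auto simp: disjnt_def)
    then show "e = f" using assms(1) ef by (auto simp: pairwise_def)
  qed
  then show ?thesis using w assms(2) by (intro card_inj_on_le[of w]) auto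
qed

lemma pairwise_disjnt_image:
  assumes "inj \<pi>" "pairwise disjnt M" shows "pairwise disjnt ((`) \<pi> ` M)"
proof (rule pairwiseI)
  fix e g assume eg: "e \<in> (`) \<pi> ` M" "g \<in> (`) \<pi> ` M" "e \<noteq> g"
  then obtain e' g' where p: "e' \<in> M" "g' \<in> M" "e = \<pi> ` e'" "g = \<pi> ` g'" by blast
  then have "e' \<inter> g' = {}" using pairwiseD[OF assms(2) p(1,2)] eg(3) by (auto simp: disjnt_def)
  then show "disjnt e g" using image_Int[OF assms(1), of e' g'] p by (simp add: disjnt_def)
qed

lemma pairwise_disjnt_Un:
  assumes "pairwise disjnt A" "pairwise disjnt B" "\<And>a b. a \<in> A \<Longrightarrow> b \<in> B \<Longrightarrow> disjnt a b"
  shows "pairwise disjnt (A \<union> B)"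
  using assms unfolding pairwise_def by (metis UnE disjnt_sym)

section \<open>Perfect matchings with a given number of crossing edges\<close>

locale bipartition =
  fixes X Y :: "'a set"
  assumes finite_X: "finite X" and finite_Y: "finite Y" and disj: "X \<inter> Y = {}"
    and card_eq: "card X = card Y"
begin

definition inX :: "'a set set" where "inX = {e. e \<subseteq> X \<and> card e = 2}"
definition inY :: "'a set set" where "inY = {e. e \<subseteq> Y \<and> card e = 2}"
definition crossing :: "'a set set" where "crossing = {{x, y} |x y. x \<in> X \<and> y \<in> Y}"

definition PM :: "nat \<Rightarrow> 'a set set set" where
  "PM i = {M. M \<subseteq> inX \<union> inY \<union> crossing \<and> pairwise disjnt M \<and> \<Union> M = X \<union> Y \<and> card (M \<inter> crossing) = i}"

definition ext_count :: "nat \<Rightarrow> 'a set set \<Rightarrow> nat" where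
  "ext_count i A = card {M \<in> PM i. A \<subseteq> M}"

lemma finite_edges: "finite (inX \<union> inY \<union> crossing)"
proof (rule finite_subset)
  show "inX \<union> inY \<union> crossing \<subseteq> Pow (X \<union> Y)" by (auto simp: inX_def inY_def crossing_def)
qed (simp add: finite_X finite_Y)

lemma finite_PM: "finite (PM i)"
  by (rule finite_subset[of _ "Pow (inX \<union> inY \<union> crossing)"]) (use finite_edges in \<open>auto simp: PM_def simp del: finite_Un\<close>)

lemma finite_mem_PM: "M \<in> PM i \<Longrightarrow> finite M"
  using finite_edges finite_subset by (auto simp: PM_def)

lemma inX_card: "e \<in> inX \<Longrightarrow> card (e \<inter> X) = 2 \<and> card (e \<inter> Y) = 0"
proof -
  assume "e \<in> inX"
  then have "e \<inter> X = e" "e \<inter> Y = {}" "card e = 2" using disj by (auto simp: inX_def)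
  then show ?thesis by simp
qed

lemma inY_card: "e \<in> inY \<Longrightarrow> card (e \<inter> X) = 0 \<and> card (e \<inter> Y) = 2"
proof -
  assume "e \<in> inY"
  then have "e \<inter> Y = e" "e \<inter> X = {}" "card e = 2" using disj by (auto simp: inY_def)
  then show ?thesis by simp
qed

lemma crossing_card: "e \<in> crossing \<Longrightarrow> card (e \<inter> X) = 1 \<and> card (e \<inter> Y) = 1"
proof -
  assume "e \<in> crossing"
  then obtain x y where xy: "e = {x, y}" "x \<in> X" "y \<in> Y" by (auto simp: crossing_def)
  then have "e \<inter> X = {x}" "e \<inter> Y = {y}" using disj by auto
  then show ?thesis by simp
qed

lemma classes_disjoint: "inX \<inter> inY = {}" "inX \<inter> crossing = {}" "inY \<inter> crossing = {}"
  using inX_card inY_card crossing_card by fastforce+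

lemma card_split:
  assumes "A \<subseteq> inX \<union> inY \<union> crossing" "pairwise disjnt A"
  shows "card (\<Union> A \<inter> X) = 2 * card (A \<inter> inX) + card (A \<inter> crossing)"
    and "card (\<Union> A \<inter> Y) = 2 * card (A \<inter> inY) + card (A \<inter> crossing)"
proof -
  have fA: "finite A" using assms(1) finite_edges finite_subset by blast
  have dj: "pairwise (\<lambda>e f. disjnt (e \<inter> Z) (f \<inter> Z)) A" for Z
    using assms(2) by (auto simp: pairwise_def disjnt_def)
  have A: "A = (A \<inter> inX) \<union> (A \<inter> inY) \<union> (A \<inter> crossing)" using assms(1) by auto
  have s: "(\<Sum>e\<in>A. f e) = sum f (A \<inter> inX) + sum f (A \<inter> inY) + sum f (A \<inter> crossing)" for f :: "'a set \<Rightarrow> nat"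
    using fA classes_disjoint by (subst A, subst sum.union_disjoint; (subst sum.union_disjoint)?) auto
  have "card (\<Union> A \<inter> Z) = (\<Sum>e\<in>A. card (e \<inter> Z))" if "finite Z" for Z
  proof -
    have "\<Union> A \<inter> Z = (\<Union>e\<in>A. e \<inter> Z)" by auto
    moreover have "card (\<Union>e\<in>A. e \<inter> Z) = (\<Sum>e\<in>A. card (e \<inter> Z))"
      using fA that dj[of Z] by (intro card_UN_disjoint) (auto simp: pairwise_def disjnt_def)
    ultimately show ?thesis by simp
  qed
  note c = this[unfolded s]
  show "card (\<Union> A \<inter> X) = 2 * card (A \<inter> inX) + card (A \<inter> crossing)"
    using c[OF finite_X] inX_card inY_card crossing_card by simp
  show "card (\<Union> A \<inter> Y) = 2 * card (A \<inter> inY) + card (A \<inter> crossing)"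
    using c[OF finite_Y] inX_card inY_card crossing_card by simp
qed

lemma card_inner:
  assumes "M \<in> PM i"
  shows "2 * card (M \<inter> inX) + i = card X" "2 * card (M \<inter> inY) + i = card X"
proof -
  have M: "M \<subseteq> inX \<union> inY \<union> crossing" "pairwise disjnt M" "\<Union> M \<inter> X = X" "\<Union> M \<inter> Y = Y" "card (M \<inter> crossing) = i"
    using assms by (auto simp: PM_def)
  show "2 * card (M \<inter> inX) + i = card X" "2 * card (M \<inter> inY) + i = card X"
    using card_split[OF M(1,2)] M(3,4,5) card_eq by simp_all
qed

text \<open>A bijection between \<open>i\<close> nodes on either side gives the crossing edges, and
  an even number of nodes remains on each side.\<close>

lemma PM_nonempty:
  assumes "i \<le> card X" "even (card X - i)"
  shows "PM i \<noteq> {}"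
proof -
  obtain X1 where X1: "X1 \<subseteq> X" "card X1 = i" "finite X1" using obtain_subset_with_card_n[OF assms(1)] .
  obtain Y1 where Y1: "Y1 \<subseteq> Y" "card Y1 = i" "finite Y1"
    using obtain_subset_with_card_n[OF assms(1)[unfolded card_eq]] .
  obtain f where f: "bij_betw f X1 Y1" using X1 Y1 by (metis finite_same_card_bij)
  obtain MX where MX: "MX \<subseteq> {e. e \<subseteq> X - X1 \<and> card e = 2}" "pairwise disjnt MX" "\<Union> MX = X - X1"
    using even_perfect_matching[of "X - X1"] assms X1 finite_X by (auto simp: card_Diff_subset simp del: Union_eq)
  obtain MY where MY: "MY \<subseteq> {e. e \<subseteq> Y - Y1 \<and> card e = 2}" "pairwise disjnt MY" "\<Union> MY = Y - Y1"
    using even_perfect_matching[of "Y - Y1"] assms Y1 finite_Y card_eq by (auto simp: card_Diff_subset simp del: Union_eq)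
  define MC where "MC = (\<lambda>x. {x, f x}) ` X1"
  have fY: "f x \<in> Y1" if "x \<in> X1" for x using f that by (auto simp: bij_betw_def)
  have "{x, f x} \<in> crossing" if "x \<in> X1" for x
    using that fY X1(1) Y1(1) unfolding crossing_def by blast
  then have MCE: "MC \<subseteq> crossing" by (auto simp: MC_def)
  have MXE: "MX \<subseteq> inX" and MYE: "MY \<subseteq> inY" using MX(1) MY(1) by (auto simp: inX_def inY_def)
  have "\<Union> MC = X1 \<union> Y1" using f by (auto simp: MC_def bij_betw_def)
  then have U: "\<Union> (MX \<union> MY \<union> MC) = X \<union> Y" using MX(3) MY(3) X1(1) Y1(1) by auto
  have "pairwise disjnt MC"
  proof -
    have dis: "disjnt {x, f x} {y, f y}" if "x \<in> X1" "y \<in> X1" "x \<noteq> y" for x y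
    proof -
      have "f x \<noteq> f y" using f that by (auto simp: bij_betw_def inj_on_def)
      moreover have "x \<noteq> f y" "y \<noteq> f x" using fY that X1 Y1 disj by blast+
      ultimately show ?thesis using that(3) by (auto simp: disjnt_def)
    qed
    show ?thesis
    proof (rule pairwiseI)
      fix e g assume "e \<in> MC" "g \<in> MC" "e \<noteq> g"
      then obtain x y where xy: "x \<in> X1" "y \<in> X1" "e = {x, f x}" "g = {y, f y}" by (auto simp: MC_def)
      then have "x \<noteq> y" using \<open>e \<noteq> g\<close> by blast
      then show "disjnt e g" using dis[OF xy(1,2)] xy(3,4) by simp
    qed
  qed
  moreover have "disjnt e g" if "e \<in> MX" "g \<in> MY" for e g
  proof -
    have "e \<subseteq> X" "g \<subseteq> Y" using that MX(1) MY(1) by auto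
    then show ?thesis using disj by (auto simp: disjnt_def)
  qed
  moreover have "disjnt e g" if "e \<in> MX" "g \<in> MC" for e g
  proof -
    have "e \<subseteq> X - X1" "g \<subseteq> X1 \<union> Y1" using that MX(1) fY by (auto simp: MC_def)
    then show ?thesis using Y1(1) disj by (auto simp: disjnt_def)
  qed
  moreover have "disjnt e g" if "e \<in> MY" "g \<in> MC" for e g
  proof -
    have "e \<subseteq> Y - Y1" "g \<subseteq> X1 \<union> Y1" using that MY(1) fY by (auto simp: MC_def)
    then show ?thesis using X1(1) disj by (auto simp: disjnt_def)
  qed
  ultimately have "pairwise disjnt (MX \<union> MY \<union> MC)"
    using MX(2) MY(2) by (intro pairwise_disjnt_Un) blast+
  moreover have "(MX \<union> MY \<union> MC) \<inter> crossing = MC"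
    using MCE MXE MYE classes_disjoint by auto
  moreover have "card MC = i"
  proof -
    have "inj_on (\<lambda>x. {x, f x}) X1"
    proof (rule inj_onI)
      fix x y assume "x \<in> X1" "y \<in> X1" "{x, f x} = {y, f y}"
      then show "x = y" using fY X1(1) Y1(1) disj by (metis IntI doubleton_eq_iff empty_iff subsetD)
    qed
    then show ?thesis using X1(2) by (simp add: MC_def card_image)
  qed
  ultimately have "MX \<union> MY \<union> MC \<in> PM i" using U MCE MXE MYE by (auto simp: PM_def simp del: Union_Un_distrib)
  then show ?thesis by blast
qed

lemma count_symmetric:
  assumes \<pi>: "bij \<pi>" "\<pi> ` X = X" "\<pi> ` Y = Y"
  shows "ext_count i A \<le> ext_count i ((`) \<pi> ` A)"
proof -
  have inj: "inj ((`) \<pi>)" using \<pi>(1) by (simp add: bij_def inj_image_eq_iff inj_on_def)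
  have ce: "card (\<pi> ` e) = card e" for e 
    by (rule card_image[OF inj_on_subset[OF bij_is_inj[OF \<pi>(1)] subset_UNIV]])
  have cls: "\<pi> ` e \<in> inX" if "e \<in> inX" for e using that \<pi>(2) ce by (auto simp: inX_def)
  have cls2: "\<pi> ` e \<in> inY" if "e \<in> inY" for e using that \<pi>(3) ce by (auto simp: inY_def)
  have cls3: "\<pi> ` e \<in> crossing" if "e \<in> crossing" for e
  proof -
    obtain x y where "e = {x, y}" "x \<in> X" "y \<in> Y" using \<open>e \<in> crossing\<close> by (auto simp: crossing_def)
    then have "\<pi> ` e = {\<pi> x, \<pi> y}" "\<pi> x \<in> X" "\<pi> y \<in> Y" using \<pi> by auto
    then show ?thesis by (auto simp: crossing_def)
  qed
  have "(`) ((`) \<pi>) ` {M \<in> PM i. A \<subseteq> M} \<subseteq> {M \<in> PM i. (`) \<pi> ` A \<subseteq> M}"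
  proof clarify
    fix M assume M: "M \<in> PM i" "A \<subseteq> M"
    have E: "M \<subseteq> inX \<union> inY \<union> crossing" "pairwise disjnt M" "\<Union> M = X \<union> Y" "card (M \<inter> crossing) = i"
      using M by (auto simp: PM_def)
    have "(`) \<pi> ` M \<subseteq> inX \<union> inY \<union> crossing" using E(1) cls cls2 cls3 by blast
    moreover have "pairwise disjnt ((`) \<pi> ` M)"
      by (rule pairwise_disjnt_image[OF bij_is_inj[OF \<pi>(1)] E(2)])
    moreover have "\<Union> ((`) \<pi> ` M) = \<pi> ` (X \<union> Y)" using E(3) by blast
    then have "\<Union> ((`) \<pi> ` M) = X \<union> Y" using \<pi> by (simp add: image_Un)
    moreover have "(`) \<pi> ` M \<inter> crossing = (`) \<pi> ` (M \<inter> crossing)"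
    proof
      show "(`) \<pi> ` (M \<inter> crossing) \<subseteq> (`) \<pi> ` M \<inter> crossing" using cls3 by blast
      show "(`) \<pi> ` M \<inter> crossing \<subseteq> (`) \<pi> ` (M \<inter> crossing)"
      proof
        fix e assume "e \<in> (`) \<pi> ` M \<inter> crossing"
        then obtain f where f: "f \<in> M" "e = \<pi> ` f" "e \<in> crossing" by blast
        have "f \<notin> inX" using cls[of f] f classes_disjoint(2) by blast
        moreover have "f \<notin> inY" using cls2[of f] f classes_disjoint(3) by blast
        ultimately have "f \<in> crossing" using E(1) f(1) by blast
        then show "e \<in> (`) \<pi> ` (M \<inter> crossing)" using f by blast
      qed
    qed
    then have "card ((`) \<pi> ` M \<inter> crossing) = i" using E(4) card_image[OF inj_on_subset[OF inj subset_UNIV]] by metis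
    ultimately show "(`) \<pi> ` M \<in> PM i \<and> (`) \<pi> ` A \<subseteq> (`) \<pi> ` M"
      using M(2) by (auto simp: PM_def)
  qed
  moreover have ij: "inj_on ((`) ((`) \<pi>)) {M \<in> PM i. A \<subseteq> M}"
    by (rule inj_onI) (simp only: inj_image_eq_iff[OF inj])
  ultimately show ?thesis
    unfolding ext_count_def using card_inj_on_le[OF ij] finite_PM by simp
qed

text \<open>Fixes one naming of the two ends for each kind of edge, so that the ends of two edges of
  the same kind correspond side by side and can be swapped one after the other.\<close>

lemma edge_ends:
  assumes "E = inX \<or> E = inY \<or> E = crossing" "e \<in> E"
  shows "\<exists>u v. e = {u, v} \<and> u \<noteq> v \<and> (u \<in> X \<longleftrightarrow> E \<noteq> inY) \<and> (v \<in> X \<longleftrightarrow> E = inX) \<and> u \<in> X \<union> Y \<and> v \<in> X \<union> Y"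
  using assms(1)
proof (elim disjE)
  assume E: "E = inX"
  then have ne: "E \<noteq> inY" using classes_disjoint(1) assms(2) by blast
  obtain u v where "e = {u, v}" "u \<noteq> v" "e \<subseteq> X" using assms(2) E by (auto simp: inX_def card_2_iff)
  then show ?thesis using E ne by (intro exI[of _ u] exI[of _ v]) simp
next
  assume E: "E = inY"
  then have ne: "E \<noteq> inX" using classes_disjoint(1) assms(2) by blast
  obtain u v where uv: "e = {u, v}" "u \<noteq> v" "e \<subseteq> Y" using assms(2) E by (auto simp: inY_def card_2_iff)
  then have "u \<notin> X" "v \<notin> X" using disj by auto
  then show ?thesis using E ne uv by (intro exI[of _ u] exI[of _ v]) simp
next
  assume E: "E = crossing"
  then have ne: "E \<noteq> inX" "E \<noteq> inY" using classes_disjoint(2,3) assms(2) by blast+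
  obtain u v where uv: "e = {u, v}" "u \<in> X" "v \<in> Y" using assms(2) E by (auto simp: crossing_def)
  then have "v \<notin> X" "u \<noteq> v" using disj by auto
  then show ?thesis using ne uv by (intro exI[of _ u] exI[of _ v]) simp
qed

lemma count_insert_eq:
  assumes E: "E = inX \<or> E = inY \<or> E = crossing"
    and e: "e \<in> E" "e \<inter> \<Union> A = {}" and e': "e' \<in> E" "e' \<inter> \<Union> A = {}"
  shows "ext_count i (insert e A) \<le> ext_count i (insert e' A)"
proof -
  obtain u v where uv: "e = {u, v}" "u \<noteq> v" "u \<in> X \<longleftrightarrow> E \<noteq> inY" "v \<in> X \<longleftrightarrow> E = inX" "u \<in> X \<union> Y" "v \<in> X \<union> Y"
    using edge_ends[OF E e(1)] by blast
  obtain u' v' where uv': "e' = {u', v'}" "u' \<noteq> v'" "u' \<in> X \<longleftrightarrow> E \<noteq> inY" "v' \<in> X \<longleftrightarrow> E = inX" "u' \<in> X \<union> Y" "v' \<in> X \<union> Y"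
    using edge_ends[OF E e'(1)] by blast
  let ?t = "Transposition.transpose"
  \<comment> \<open>After \<open>u\<close> has been swapped with \<open>u'\<close>, the other end
    \<open>v\<close> sits at \<open>w\<close>; swapping \<open>w\<close> with \<open>v'\<close> then
    completes the move. The detour through \<open>w\<close> covers the case \<open>v = u'\<close>.
    All points involved avoid \<open>A\<close>, so its edges stay fixed.\<close>
  define w where "w = ?t u u' v"
  define \<pi> where "\<pi> = ?t w v' \<circ> ?t u u'"
  have wu: "w \<noteq> u'" using uv(2) by (auto simp: w_def Transposition.transpose_def)
  have im: "\<pi> u = u'" "\<pi> v = v'"
    using wu uv'(2) by (auto simp: \<pi>_def w_def[symmetric])
  have same: "u \<in> X \<longleftrightarrow> u' \<in> X" "u \<in> Y \<longleftrightarrow> u' \<in> Y" "v \<in> X \<longleftrightarrow> v' \<in> X" "v \<in> Y \<longleftrightarrow> v' \<in> Y"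
    using uv(3-6) uv'(3-6) disj by blast+
  have "w = (if v = u' then u else v)" using uv(2) by (simp add: w_def Transposition.transpose_def)
  then have samew: "w \<in> X \<longleftrightarrow> v' \<in> X" "w \<in> Y \<longleftrightarrow> v' \<in> Y"
    using same by (cases "v = u'"; simp)+
  have tX: "?t a b ` Z = Z" if "a \<in> Z \<longleftrightarrow> b \<in> Z" for a b and Z :: "'a set"
    using that by simp
  have "\<pi> ` Z = ?t w v' ` ?t u u' ` Z" for Z by (simp only: \<pi>_def image_comp)
  then have XY: "\<pi> ` X = X" "\<pi> ` Y = Y" using tX same samew by simp_all
  have bij: "bij \<pi>" by (simp add: \<pi>_def bij_comp)
  have notA: "u \<notin> \<Union> A" "v \<notin> \<Union> A" "u' \<notin> \<Union> A" "v' \<notin> \<Union> A" using e e' uv(1) uv'(1) by auto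
  then have "w \<notin> \<Union> A" by (auto simp: w_def Transposition.transpose_def)
  then have fix_A: "\<pi> z = z" if "z \<in> \<Union> A" for z
    using that notA by (auto simp: \<pi>_def Transposition.transpose_def)
  have "\<pi> ` f = f" if "f \<in> A" for f
  proof -
    have "\<pi> z = z" if "z \<in> f" for z using fix_A that \<open>f \<in> A\<close> by blast
    then show ?thesis by force
  qed
  then have "(`) \<pi> ` insert e A = insert e' A" using im uv(1) uv'(1) by auto
  then show ?thesis using count_symmetric[OF bij XY, of i "insert e A"] by simp
qed

text \<open>Double counting of the pairs of an edge \<open>f\<close> of kind \<open>E\<close>
  disjoint from \<open>A\<close> and a matching that contains \<open>insert f A\<close>. By symmetry
  every such \<open>f\<close> occurs in equally many matchings, and a matching above
  \<open>A\<close> offers its \<open>n\<close> edges of kind \<open>E\<close> minus those already in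
  \<open>A\<close>.\<close>

lemma count_step:
  assumes E: "E = inX \<or> E = inY \<or> E = crossing" and A: "A \<subseteq> inX \<union> inY \<union> crossing"
    and e: "e \<in> E" "e \<inter> \<Union> A = {}"
    and n: "\<And>M. M \<in> PM i \<Longrightarrow> real (card (M \<inter> E)) = n"
  shows "real (card {e \<in> E. e \<inter> \<Union> A = {}}) * real (ext_count i (insert e A))
    = real (ext_count i A) * (n - real (card (A \<inter> E)))"
proof -
  define F where "F = {e \<in> E. e \<inter> \<Union> A = {}}"
  define MA where "MA = {M \<in> PM i. A \<subseteq> M}"
  have fF: "finite F" using finite_edges E by (auto simp: F_def intro: finite_subset[of _ E])
  have fMA: "finite MA" using finite_PM by (simp add: MA_def)
  have ne: "f \<noteq> {}" if "f \<in> E" for f using that E by (auto simp: inX_def inY_def crossing_def)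
  have MF: "real (card (M \<inter> F)) = n - real (card (A \<inter> E))" if M: "M \<in> MA" for M
  proof -
    have p: "pairwise disjnt M" "A \<subseteq> M" "M \<in> PM i" using M by (auto simp: MA_def PM_def)
    have fM: "finite M" using finite_mem_PM p(3) by blast
    have "M \<inter> F = M \<inter> E - A \<inter> E"
    proof
      show "M \<inter> F \<subseteq> M \<inter> E - A \<inter> E" using ne by (fastforce simp: F_def)
      show "M \<inter> E - A \<inter> E \<subseteq> M \<inter> F"
      proof
        fix f assume f: "f \<in> M \<inter> E - A \<inter> E"
        have "f \<inter> g = {}" if "g \<in> A" for g
        proof -
          have "g \<in> M" "f \<in> M" "f \<noteq> g" using p(2) f that by auto
          then show ?thesis using pairwiseD[OF p(1)] by (simp add: disjnt_def)
        qed
        then show "f \<in> M \<inter> F" using f by (auto simp: F_def)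
      qed
    qed
    moreover have "A \<inter> E \<subseteq> M \<inter> E" using p(2) by auto
    ultimately have "card (M \<inter> F) + card (A \<inter> E) = card (M \<inter> E)"
      using fM p(2) by (metis card_Diff_subset card_mono finite_Int finite_subset le_add_diff_inverse2)
    then show ?thesis using n[OF p(3)] by linarith
  qed
  have "real (card F) * real (ext_count i (insert e A)) = (\<Sum>f\<in>F. real (ext_count i (insert f A)))"
  proof -
    have "ext_count i (insert f A) = ext_count i (insert e A)" if "f \<in> F" for f
      using count_insert_eq[OF E e, of f i] count_insert_eq[OF E _ _ e, of f i] that by (auto simp: F_def)
    then show ?thesis by simp
  qed
  also have "\<dots> = (\<Sum>f\<in>F. \<Sum>M\<in>MA. if f \<in> M then 1 else 0)"
  proof (rule sum.cong[OF refl])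
    fix f
    have "{M \<in> PM i. insert f A \<subseteq> M} = {M \<in> MA. f \<in> M}" by (auto simp: MA_def)
    then show "real (ext_count i (insert f A)) = (\<Sum>M\<in>MA. if f \<in> M then 1 else 0)"
      using fMA by (simp add: ext_count_def sum.If_cases Int_def)
  qed
  also have "\<dots> = (\<Sum>M\<in>MA. \<Sum>f\<in>F. if f \<in> M then 1 else 0)" by (rule sum.swap)
  also have "\<dots> = (\<Sum>M\<in>MA. real (card (M \<inter> F)))"
    using fF by (simp add: sum.If_cases Int_def conj_commute)
  also have "\<dots> = real (ext_count i A) * (n - real (card (A \<inter> E)))"
    using MF by (simp add: MA_def ext_count_def)
  finally show ?thesis by (simp add: F_def)
qed

text \<open>
  The factor contributed by a second crossing edge is negative at \<open>0\<close>; the induction survives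
  because the value at \<open>0\<close> already vanishes after the first one.
\<close>
lemma count_polynomial:
  assumes "finite A" "A \<subseteq> inX \<union> inY \<union> crossing" "pairwise disjnt A"
  shows "\<exists>q. degree q \<le> card A \<and> 0 \<le> poly q 0 \<and> (A \<inter> crossing \<noteq> {} \<longrightarrow> poly q 0 = 0)
    \<and> (\<forall>i. real (ext_count i A) = real (ext_count i {}) * poly q (real i))"
  using assms
proof (induction A)
  case empty
  show ?case by (rule exI[of _ 1]) auto
next
  case (insert e A)
  obtain q where q: "degree q \<le> card A" "0 \<le> poly q 0" "A \<inter> crossing \<noteq> {} \<longrightarrow> poly q 0 = 0"
      "\<And>i. real (ext_count i A) = real (ext_count i {}) * poly q (real i)"
    using insert.IH insert.prems by (auto simp: pairwise_insert)
  have A: "A \<subseteq> inX \<union> inY \<union> crossing" using insert.prems by auto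
  have dj: "e \<inter> \<Union> A = {}" using insert.prems(2) insert.hyps(2)
    by (auto simp: pairwise_insert disjnt_def)
  have step: ?case
    if E: "E = inX \<or> E = inY \<or> E = crossing" "e \<in> E"
      and n: "\<And>i M. M \<in> PM i \<Longrightarrow> real (card (M \<inter> E)) = poly r (real i)" and d: "degree r \<le> 1"
      and r0: "E = crossing \<longrightarrow> poly r 0 = 0" "E \<noteq> crossing \<longrightarrow> real (card (A \<inter> E)) \<le> poly r 0"
    for E r
  proof -
    define m where "m = real (card {e \<in> E. e \<inter> \<Union> A = {}})"
    have "finite {e \<in> E. e \<inter> \<Union> A = {}}"
      using finite_edges E by (auto intro: finite_subset[of _ E])
    then have m: "0 < m" using E(2) dj by (auto simp: m_def card_gt_0_iff)
    \<comment> \<open>This is \<open>count_step\<close> solved for the larger set; the divisor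
      \<open>m\<close> counts the free edges of this kind and is positive because \<open>e\<close>
      is one of them.\<close>
    define q' where "q' = smult (1 / m) (q * (r - [:real (card (A \<inter> E)):]))"
    have "degree (r - [:real (card (A \<inter> E)):]) \<le> 1" using d by (intro degree_diff_le) auto
    then have "degree q' \<le> card A + 1" unfolding q'_def
      using q(1) by (intro order.trans[OF degree_smult_le] order.trans[OF degree_mult_le] add_mono)
    then have 1: "degree q' \<le> card (insert e A)" using insert.hyps by simp
    have 2: "real (ext_count i (insert e A)) = real (ext_count i {}) * poly q' (real i)" for i
      using count_step[OF E(1) A E(2) dj n, of i] q(4)[of i] m by (simp add: q'_def m_def[symmetric] field_simps)
    have v: "poly q' 0 = poly q 0 * (poly r 0 - real (card (A \<inter> E))) / m" by (simp add: q'_def)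
    show ?thesis
    proof (cases "E = crossing")
      case True
      have "poly q' 0 = 0"
        using v r0(1) True q(3) by (cases "A \<inter> crossing = {}") auto
      then show ?thesis using 1 2 by (intro exI[of _ q']) auto
    next
      case False
      have "0 \<le> poly q' 0" using v r0(2) False q(2) m by simp
      moreover have "insert e A \<inter> crossing \<noteq> {} \<longrightarrow> poly q' 0 = 0"
        using q(3) v E False classes_disjoint by auto
      ultimately show ?thesis using 1 2 by (intro exI[of _ q']) auto
    qed
  qed
  \<comment> \<open>Keeps the new factor nonnegative at 0 for an edge inside a side:
    \<open>A\<close> has at most \<open>card X / 2\<close> edges there, and
    \<open>card X / 2\<close> is the value of \<open>?r\<close> at 0.\<close>
  have cX: "2 * card (A \<inter> inX) \<le> card X" "2 * card (A \<inter> inY) \<le> card X"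
  proof -
    have "pairwise disjnt A" using insert.prems by (simp add: pairwise_insert)
    note s = card_split[OF A this]
    have "card (\<Union> A \<inter> X) \<le> card X" "card (\<Union> A \<inter> Y) \<le> card Y"
      using finite_X finite_Y by (auto intro: card_mono)
    then show "2 * card (A \<inter> inX) \<le> card X" "2 * card (A \<inter> inY) \<le> card X" using s card_eq by simp_all
  qed
  let ?r = "[:real (card X) / 2, - 1 / 2:]"
  consider "e \<in> inX" | "e \<in> inY" | "e \<in> crossing" using insert.prems by auto
  then show ?case
  proof cases
    case 1
    have "real (card (M \<inter> inX)) = poly ?r (real i)" if "M \<in> PM i" for i M
      using card_inner(1)[OF that] by (simp add: field_simps)
    then show ?thesis using 1 cX classes_disjoint by (intro step[of inX ?r]) auto
  next
    case 2
    have "real (card (M \<inter> inY)) = poly ?r (real i)" if "M \<in> PM i" for i M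
      using card_inner(2)[OF that] by (simp add: field_simps)
    then show ?thesis using 2 cX classes_disjoint by (intro step[of inY ?r]) auto
  next
    case 3
    have "real (card (M \<inter> crossing)) = poly [:0, 1:] (real i)" if "M \<in> PM i" for i M
      using that by (simp add: PM_def)
    then show ?thesis using 3 by (intro step[of crossing "[:0, 1:]"]) auto
  qed
qed

text \<open>Group the matchings by their set \<open>A\<close> of edges at \<open>W\<close>. The
  proportion of \<open>PM i\<close> with a given \<open>A\<close> is the polynomial from
  \<open>count_polynomial\<close>, of degree at most \<open>card A\<close> and so at most
  \<open>k\<close>. The weights \<open>b\<close> may have either sign, but together they evaluate
  this polynomial at 0, where it is nonnegative.\<close>

lemma junta_average_nonneg:
  fixes s :: "'a set set \<Rightarrow> real"
  assumes W: "finite W" "card W \<le> k"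
    and I: "finite I" "\<And>i. i \<in> I \<Longrightarrow> PM i \<noteq> {}"
    and b: "\<And>q. degree q \<le> k \<Longrightarrow> (\<Sum>i\<in>I. b i * poly q (real i)) = poly q 0"
    and s: "\<And>i M. i \<in> I \<Longrightarrow> M \<in> PM i \<Longrightarrow> 0 \<le> s M"
    and junta: "\<And>i j M M'. i \<in> I \<Longrightarrow> j \<in> I \<Longrightarrow> M \<in> PM i \<Longrightarrow> M' \<in> PM j \<Longrightarrow>
      {e \<in> M. e \<inter> W \<noteq> {}} = {e \<in> M'. e \<inter> W \<noteq> {}} \<Longrightarrow> s M = s M'"
  shows "0 \<le> (\<Sum>i\<in>I. b i / real (card (PM i)) * (\<Sum>M\<in>PM i. s M))"
proof -
  define trace where "trace = (\<lambda>M :: 'a set set. {e \<in> M. e \<inter> W \<noteq> {}})"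
  define all where "all = (\<Union>i\<in>I. PM i)"
  define T where "T = trace ` all"
  have fT: "finite T" using I(1) finite_PM by (auto simp: T_def all_def)
  define g where "g = (\<lambda>A. s (SOME M. M \<in> all \<and> trace M = A))"
  have g: "s M = g (trace M)" if M: "M \<in> all" for M
  proof -
    define M' where "M' = (SOME M'. M' \<in> all \<and> trace M' = trace M)"
    have M': "M' \<in> all \<and> trace M' = trace M" unfolding M'_def by (rule someI[of _ M]) (use M in auto)
    obtain i j where ij: "i \<in> I" "M' \<in> PM i" "j \<in> I" "M \<in> PM j" using M M' by (auto simp: all_def)
    have "s M' = s M"
      by (rule junta[OF ij(1,3,2,4)]) (use M' in \<open>simp add: trace_def\<close>)
    then show ?thesis by (simp add: g_def M'_def)
  qed
  have g0: "0 \<le> g A" if "A \<in> T" for A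
  proof -
    obtain i M where M: "i \<in> I" "M \<in> PM i" "A = trace M" using \<open>A \<in> T\<close> by (auto simp: T_def all_def)
    then have "M \<in> all" by (auto simp: all_def)
    then show ?thesis using g[of M] s[OF M(1,2)] M(3) by simp
  qed
  have TA: "finite A" "A \<subseteq> inX \<union> inY \<union> crossing" "pairwise disjnt A" "card A \<le> k"
    and cnt: "\<And>i. {M \<in> PM i. trace M = A} = {M \<in> PM i. A \<subseteq> M}" if A: "A \<in> T" for A
  proof -
    obtain i0 M0 where M0: "M0 \<in> PM i0" "A = trace M0" using A by (auto simp: T_def all_def)
    have AM: "A \<subseteq> M0" using M0(2) by (auto simp: trace_def)
    have p0: "M0 \<subseteq> inX \<union> inY \<union> crossing" "pairwise disjnt M0" "\<Union> M0 = X \<union> Y" using M0(1) by (auto simp: PM_def)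
    show fA: "finite A" using AM finite_mem_PM[OF M0(1)] finite_subset by blast
    show "A \<subseteq> inX \<union> inY \<union> crossing" using AM p0(1) by blast
    show pA: "pairwise disjnt A" using AM p0(2) pairwise_subset by blast
    have "{e \<in> A. e \<inter> W \<noteq> {}} = A" using M0(2) by (auto simp: trace_def)
    then have "card A \<le> card W" using card_touching[OF pA W(1)] by simp
    then show "card A \<le> k" using W(2) by simp
    fix i
    \<comment> \<open>Here perfectness enters: \<open>A\<close> already covers every node of
      \<open>W\<close> that lies in \<open>X \<union> Y\<close>, so a matching containing
      \<open>A\<close> has no further edge at \<open>W\<close>.\<close>
    show "{M \<in> PM i. trace M = A} = {M \<in> PM i. A \<subseteq> M}"
    proof (intro Collect_cong conj_cong refl iffI)
      fix M assume "trace M = A" then show "A \<subseteq> M" by (auto simp: trace_def)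
    next
      fix M assume M: "M \<in> PM i" "A \<subseteq> M"
      have p: "pairwise disjnt M" "\<Union> M = X \<union> Y" using M(1) by (auto simp: PM_def)
      have "e \<in> A" if e: "e \<in> M" "e \<inter> W \<noteq> {}" for e
      proof -
        obtain v where v: "v \<in> e" "v \<in> W" using e by blast
        then have "v \<in> \<Union> M0" using p(2) p0(3) e(1) by blast
        then obtain f where f: "f \<in> M0" "v \<in> f" by blast
        then have fA: "f \<in> A" using v M0(2) by (auto simp: trace_def)
        then have "\<not> disjnt e f" "f \<in> M" using f v M(2) by (auto simp: disjnt_def)
        then have "e = f" using p(1) e(1) by (auto simp: pairwise_def)
        then show ?thesis using fA by simp
      qed
      moreover have "e \<inter> W \<noteq> {}" if "e \<in> A" for e using that M0(2) by (simp add: trace_def)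
      ultimately show "trace M = A" using M(2) by (auto simp: trace_def)
    qed
  qed
  have "\<forall>A\<in>T. \<exists>q. degree q \<le> k \<and> 0 \<le> poly q 0
      \<and> (\<forall>i. real (ext_count i A) = real (ext_count i {}) * poly q (real i))"
  proof
    fix A assume A: "A \<in> T"
    obtain q where "degree q \<le> card A" "0 \<le> poly q 0"
        "\<forall>i. real (ext_count i A) = real (ext_count i {}) * poly q (real i)"
      using count_polynomial[OF TA(1-3)[OF A]] by blast
    then show "\<exists>q. degree q \<le> k \<and> 0 \<le> poly q 0
        \<and> (\<forall>i. real (ext_count i A) = real (ext_count i {}) * poly q (real i))"
      using TA(4)[OF A] by (intro exI[of _ q]) simp
  qed
  from bchoice[OF this] obtain q where q: "\<And>A. A \<in> T \<Longrightarrow> degree (q A) \<le> k" "\<And>A. A \<in> T \<Longrightarrow> 0 \<le> poly (q A) 0"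
      "\<And>A i. A \<in> T \<Longrightarrow> real (ext_count i A) = real (ext_count i {}) * poly (q A) (real i)"
    by blast
  have avg: "(\<Sum>M\<in>PM i. s M) / real (card (PM i)) = (\<Sum>A\<in>T. g A * poly (q A) (real i))" if i: "i \<in> I" for i
  proof -
    have pos: "0 < real (card (PM i))" using I(2)[OF i] finite_PM by (simp add: card_gt_0_iff)
    have "(\<Sum>M\<in>PM i. s M) = (\<Sum>M\<in>PM i. g (trace M))"
      using g i by (intro sum.cong) (auto simp: all_def)
    also have "\<dots> = (\<Sum>A\<in>T. \<Sum>M\<in>{M \<in> PM i. trace M = A}. g (trace M))"
      using i by (intro sum.group[symmetric] finite_PM fT) (auto simp: T_def all_def)
    also have "\<dots> = (\<Sum>A\<in>T. real (ext_count i A) * g A)"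
    proof (rule sum.cong[OF refl])
      fix A assume A: "A \<in> T"
      have "(\<Sum>M\<in>{M \<in> PM i. trace M = A}. g (trace M)) = (\<Sum>M\<in>{M \<in> PM i. trace M = A}. g A)"
        by (rule sum.cong) auto
      also have "\<dots> = real (ext_count i A) * g A" by (simp add: ext_count_def cnt[OF A])
      finally show "(\<Sum>M\<in>{M \<in> PM i. trace M = A}. g (trace M)) = real (ext_count i A) * g A" .
    qed
    also have "\<dots> = real (card (PM i)) * (\<Sum>A\<in>T. g A * poly (q A) (real i))"
      unfolding sum_distrib_left using q(3) by (intro sum.cong refl) (simp add: ext_count_def)
    finally show ?thesis using pos by simp
  qed
  have "(\<Sum>i\<in>I. b i / real (card (PM i)) * (\<Sum>M\<in>PM i. s M)) = (\<Sum>i\<in>I. b i * (\<Sum>A\<in>T. g A * poly (q A) (real i)))"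
    by (intro sum.cong refl) (simp add: avg[symmetric])
  also have "\<dots> = (\<Sum>i\<in>I. \<Sum>A\<in>T. g A * (b i * poly (q A) (real i)))"
    by (simp add: sum_distrib_left algebra_simps)
  also have "\<dots> = (\<Sum>A\<in>T. \<Sum>i\<in>I. g A * (b i * poly (q A) (real i)))"
    by (rule sum.swap)
  also have "\<dots> = (\<Sum>A\<in>T. g A * poly (q A) 0)"
    using b[OF q(1)] by (intro sum.cong refl) (simp add: sum_distrib_left[symmetric])
  also have "0 \<le> \<dots>" using g0 q(2) by (intro sum_nonneg mult_nonneg_nonneg)
  finally show ?thesis .
qed

end

text \<open>Induction over the edges: once \<open>\<rho>\<close> has moved the smaller matching, two
  swaps carry the image of \<open>e\<close> to \<open>e'\<close> without disturbing the edges
  already in place.\<close>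

lemma matching_transport:
  assumes "finite N" "card N = card N'" "finite V"
    and "N \<subseteq> {e. e \<subseteq> V \<and> card e = 2}" "pairwise disjnt N"
    and "N' \<subseteq> {e. e \<subseteq> V \<and> card e = 2}" "pairwise disjnt N'"
  shows "\<exists>\<pi>. \<pi> permutes V \<and> (`) \<pi> ` N = N'"
  using assms
proof (induction N arbitrary: N' rule: finite_induct)
  case empty
  have "finite N'" using empty.prems(2,5) by (auto intro: finite_subset[of _ "Pow V"])
  then have "N' = {}" using empty.prems(1) by simp
  then show ?case by (intro exI[of _ id] conjI permutes_id) simp
next
  case (insert e N)
  have fN': "finite N'" using insert.prems(2,5) by (auto intro: finite_subset[of _ "Pow V"])
  then obtain e' where e': "e' \<in> N'" using insert.prems(1) insert.hyps by fastforce
  define N1 where "N1 = N' - {e'}"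
  have cN1: "card N = card N1" using insert.prems(1) insert.hyps fN' e' by (simp add: N1_def)
  have pN1: "pairwise disjnt N1" using insert.prems(6) by (auto simp: N1_def pairwise_def)
  have "\<exists>\<pi>. \<pi> permutes V \<and> (`) \<pi> ` N = N1"
    using insert.prems cN1 pN1 by (intro insert.IH) (auto simp: N1_def pairwise_insert)
  then obtain \<rho> where \<rho>: "\<rho> permutes V" "(`) \<rho> ` N = N1" by blast
  obtain u v where uv: "e = {u, v}" "u \<noteq> v" "u \<in> V" "v \<in> V"
    using insert.prems(3) by (auto simp: card_2_iff)
  obtain u' v' where uv': "e' = {u', v'}" "u' \<noteq> v'" "u' \<in> V" "v' \<in> V"
    using insert.prems(5) e' by (auto simp: card_2_iff)
  have inj: "\<rho> x = \<rho> y \<longleftrightarrow> x = y" for x y using \<rho>(1) by (metis permutes_inj injD)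
  have eN: "e \<inter> \<Union> N = {}" using insert.prems(4) insert.hyps(2) by (auto simp: pairwise_insert disjnt_def)
  have e'N: "e' \<inter> \<Union> N1 = {}"
  proof -
    have "e' \<inter> f = {}" if "f \<in> N1" for f
      using pairwiseD[OF insert.prems(6) e', of f] that by (auto simp: N1_def disjnt_def)
    then show ?thesis by blast
  qed
  have \<rho>e: "\<rho> x \<notin> \<Union> N1" if "x \<in> e" for x
  proof
    assume "\<rho> x \<in> \<Union> N1"
    then obtain f where "f \<in> N" "\<rho> x \<in> \<rho> ` f" using \<rho>(2) by blast
    then have "x \<in> f" using inj by auto
    then show False using eN that \<open>f \<in> N\<close> by blast
  qed
  let ?t = "Transposition.transpose"
  define w where "w = ?t (\<rho> u) u' (\<rho> v)"
  define \<sigma> where "\<sigma> = ?t w v' \<circ> ?t (\<rho> u) u'"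
  have wu: "w \<noteq> u'" using uv(2) inj by (auto simp: w_def Transposition.transpose_def)
  have im: "\<sigma> (\<rho> u) = u'" "\<sigma> (\<rho> v) = v'"
    using wu uv'(2) by (auto simp: \<sigma>_def w_def[symmetric])
  have V: "\<rho> u \<in> V" "\<rho> v \<in> V" using \<rho>(1) uv by (simp_all add: permutes_in_image)
  have wV: "w \<in> V" using V uv' by (auto simp: w_def Transposition.transpose_def)
  have \<sigma>V: "\<sigma> permutes V" unfolding \<sigma>_def
    using V wV uv' by (intro permutes_compose permutes_swap_id) auto
  have not: "\<rho> u \<notin> \<Union> N1" "\<rho> v \<notin> \<Union> N1" "u' \<notin> \<Union> N1" "v' \<notin> \<Union> N1"
    using \<rho>e e'N uv(1) uv'(1) by auto
  then have "w \<notin> \<Union> N1" by (auto simp: w_def Transposition.transpose_def)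
  then have fx: "\<sigma> z = z" if "z \<in> \<Union> N1" for z
    using that not by (auto simp: \<sigma>_def Transposition.transpose_def)
  have "\<sigma> ` f = f" if "f \<in> N1" for f
  proof -
    have "\<sigma> z = z" if "z \<in> f" for z using fx that \<open>f \<in> N1\<close> by blast
    then show ?thesis by force
  qed
  then have N1: "(`) \<sigma> ` N1 = N1" by simp
  have "(`) (\<sigma> \<circ> \<rho>) ` insert e N = insert (\<sigma> ` \<rho> ` e) ((`) \<sigma> ` (`) \<rho> ` N)"
    by (simp add: image_comp image_image)
  also have "\<dots> = insert e' N1" using N1 \<rho>(2) im uv(1) uv'(1) by simp
  also have "\<dots> = N'" using e' by (auto simp: N1_def)
  finally show ?case using permutes_compose[OF \<rho>(1) \<sigma>V] by blast
qed

section \<open>Slack functions of a polyhedron under isometries\<close>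

text \<open>Affinity on the whole type rather than on a subspace, so that affine combinations can be
  pushed through without membership conditions.\<close>

definition affine_map :: "('a::real_vector \<Rightarrow> 'b::real_vector) \<Rightarrow> bool" where
  "affine_map f \<longleftrightarrow> (\<exists>g c. linear g \<and> f = (\<lambda>x. g x + c))"

lemma affine_map_sum:
  assumes "affine_map f" "sum c I = (1 :: real)"
  shows "f (\<Sum>i\<in>I. c i *\<^sub>R x i) = (\<Sum>i\<in>I. c i *\<^sub>R f (x i))"
proof -
  obtain g b where g: "linear g" "f = (\<lambda>x. g x + b)" using assms(1) by (auto simp: affine_map_def)
  have "(\<Sum>i\<in>I. c i *\<^sub>R f (x i)) = (\<Sum>i\<in>I. c i *\<^sub>R g (x i)) + sum c I *\<^sub>R b"
    by (simp add: g(2) scaleR_right_distrib sum.distrib scaleR_left.sum)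
  then show ?thesis using assms(2) by (simp add: g linear_sum linear_scale)
qed

lemma affine_map_comb:
  assumes "affine_map f"
  shows "f ((1 - u) *\<^sub>R x + u *\<^sub>R y) = (1 - u) *\<^sub>R f x + u *\<^sub>R f y"
proof -
  obtain g b where g: "linear g" "f = (\<lambda>x. g x + b)" using assms by (auto simp: affine_map_def)
  have "f ((1 - u) *\<^sub>R x + u *\<^sub>R y) = (1 - u) *\<^sub>R g x + u *\<^sub>R g y + b"
    by (simp add: g linear_add linear_scale)
  then show ?thesis by (simp add: g algebra_simps)
qed

lemma affine_map_comp: "affine_map f \<Longrightarrow> affine_map g \<Longrightarrow> affine_map (f \<circ> g)"
proof -
  assume "affine_map f" "affine_map g"
  then obtain f' g' b c where fg: "linear f'" "f = (\<lambda>x. f' x + b)" "linear g'" "g = (\<lambda>x. g' x + c)"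
    by (auto simp: affine_map_def)
  have "f \<circ> g = (\<lambda>x. (f' \<circ> g') x + (f' c + b))"
    using fg by (auto simp: linear_add algebra_simps)
  moreover have "linear (f' \<circ> g')" using fg by (intro linear_compose) auto
  ultimately show ?thesis unfolding affine_map_def by blast
qed

lemma affine_map_scale:
  assumes "affine_map (h :: 'a::real_vector \<Rightarrow> real)" shows "affine_map (\<lambda>x. h x / c)"
proof -
  obtain g b where g: "linear g" "h = (\<lambda>x. g x + b)" using assms by (auto simp: affine_map_def)
  have "linear (\<lambda>x. g x / c)"
    using g(1) by (auto simp: linear_iff add_divide_distrib)
  moreover have "(\<lambda>x. h x / c) = (\<lambda>x. g x / c + b / c)" by (simp add: g(2) add_divide_distrib)
  ultimately show ?thesis unfolding affine_map_def by blast
qed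

lemma affine_map_zero: "affine_map (\<lambda>_. 0)"
  unfolding affine_map_def by (intro exI[of _ "\<lambda>_. 0"] exI[of _ 0]) (auto simp: linear_iff)

text \<open>\<open>L\<close> stands for a coordinate space and \<open>D\<close> for the squared
  Euclidean distance. Of the metric only nonnegativity, definiteness on \<open>Q\<close> and the
  Lipschitz property of the defining functions are kept; faces are handled through the finitely many
  functions in \<open>H\<close> instead of dimension and relative interior.\<close>

locale polyhedron_isometry =
  fixes L Q :: "'a::real_vector set" and H :: "('a \<Rightarrow> real) set" and D :: "'a \<Rightarrow> 'a \<Rightarrow> real"
  assumes Q_eq: "Q = {y \<in> L. \<forall>h\<in>H. 0 \<le> h y}"
    and subspace_L: "subspace L"
    and finite_H: "finite H"
    and affine_H: "h \<in> H \<Longrightarrow> affine_map h"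
    and Q_nonempty: "Q \<noteq> {}"
    and D_nonneg: "0 \<le> D x y"
    and D_zero: "x \<in> Q \<Longrightarrow> y \<in> Q \<Longrightarrow> D x y = 0 \<longleftrightarrow> x = y"
    and D_bound: "h \<in> H \<Longrightarrow> \<exists>K. \<forall>x\<in>Q. \<forall>y\<in>Q. (h x - h y)\<^sup>2 \<le> K * D x y"
begin

text \<open>The inequalities that are not implicit equations of \<open>Q\<close>; the other members
  of \<open>H\<close> vanish on all of \<open>Q\<close>.\<close>

definition Hp :: "('a \<Rightarrow> real) set" where
  "Hp = {h \<in> H. \<exists>y\<in>Q. 0 < h y}"

definition tight :: "('a \<Rightarrow> real) \<Rightarrow> 'a set" where
  "tight h = {y \<in> Q. h y = 0}"

lemma H_nonneg: "h \<in> H \<Longrightarrow> y \<in> Q \<Longrightarrow> 0 \<le> h y"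
  by (auto simp: Q_eq)

lemma H_comb: "h \<in> H \<Longrightarrow> h ((1 - u) *\<^sub>R x + u *\<^sub>R y) = (1 - u) * h x + u * h y"
  using affine_map_comb[OF affine_H] by simp

lemma L_comb: "x \<in> L \<Longrightarrow> y \<in> L \<Longrightarrow> a *\<^sub>R x + b *\<^sub>R y \<in> L"
  using subspace_L by (simp add: subspace_add subspace_scale)

lemma Q_L: "Q \<subseteq> L"
  by (auto simp: Q_eq)

section \<open>Faces and facets through tight inequalities\<close>

lemma convex_Q: "convex Q"
proof (unfold convex_alt, intro ballI allI impI)
  fix x y u assume xy: "x \<in> Q" "y \<in> Q" "0 \<le> u \<and> u \<le> (1::real)"
  have "0 \<le> h ((1 - u) *\<^sub>R x + u *\<^sub>R y)" if h: "h \<in> H" for h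
    using H_comb[OF h] H_nonneg[OF h] xy by simp
  then show "(1 - u) *\<^sub>R x + u *\<^sub>R y \<in> Q" using xy Q_L L_comb by (auto simp: Q_eq)
qed

lemma common_positive:
  assumes "convex C" "C \<noteq> {}" "C \<subseteq> Q" "G \<subseteq> H" "\<And>h. h \<in> G \<Longrightarrow> \<exists>y\<in>C. 0 < h y"
  shows "\<exists>z\<in>C. \<forall>h\<in>G. 0 < h z"
proof -
  have "finite G" using assms(4) finite_H finite_subset by blast
  then show ?thesis using assms(4,5)
  proof (induction G)
    case empty
    then show ?case using assms(2) by auto
  next
    case (insert g G)
    then obtain z where z: "z \<in> C" "\<forall>h\<in>G. 0 < h z" by auto
    obtain w where w: "w \<in> C" "0 < g w" using insert.prems by blast
    define v where "v = (1 - 1/2) *\<^sub>R z + (1/2::real) *\<^sub>R w"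
    have v: "v \<in> C" unfolding v_def by (rule convexD_alt[OF assms(1) z(1) w(1)]) auto
    have hv: "h v = h z / 2 + h w / 2" if "h \<in> H" for h
      using H_comb[OF that, of "1/2" z w] by (simp add: v_def)
    have nn: "0 \<le> h z" "0 \<le> h w" if "h \<in> H" for h
      using H_nonneg[OF that] z(1) w(1) assms(3) by auto
    have "0 < h v" if h: "h \<in> insert g G" for h
    proof (cases "h = g")
      case True
      then show ?thesis using hv[of g] nn[of g] w(2) insert.prems(1) by simp
    next
      case False
      then have "h \<in> G" "h \<in> H" using h insert.prems(1) by auto
      then show ?thesis using hv[of h] nn[of h] z(2) by (simp add: add_pos_nonneg)
    qed
    then show ?case using v by blast
  qed
qed

text \<open>Inequalities that are strict at \<open>z\<close> survive a short step, and those tight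
  at \<open>z\<close> survive because \<open>y\<close> satisfies them.\<close>

lemma move_inside:
  assumes z: "z \<in> Q" and y: "y \<in> L" and t: "\<And>h. h \<in> H \<Longrightarrow> h z = 0 \<Longrightarrow> 0 \<le> h y"
  shows "\<exists>e::real. 0 < e \<and> (1 - e) *\<^sub>R z + e *\<^sub>R y \<in> Q"
proof -
  have "eventually (\<lambda>e. \<forall>h\<in>H. 0 \<le> (1 - e) * h z + e * h y) (at_right (0::real))"
  proof (rule eventually_ball_finite[OF finite_H], rule ballI)
    fix h assume h: "h \<in> H"
    show "eventually (\<lambda>e. 0 \<le> (1 - e) * h z + e * h y) (at_right 0)"
    proof (cases "h z = 0")
      case True
      have "eventually (\<lambda>e::real. 0 < e) (at_right 0)" by (simp add: eventually_at_right_less)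
      then show ?thesis using t[OF h True] True by (auto elim!: eventually_mono)
    next
      case False
      then have "0 < h z" using H_nonneg[OF h z] by simp
      moreover have "((\<lambda>e. (1 - e) * h z + e * h y) \<longlongrightarrow> (1 - 0) * h z + 0 * h y) (at_right 0)"
        by (intro tendsto_intros)
      ultimately have "eventually (\<lambda>e. 0 < (1 - e) * h z + e * h y) (at_right 0)"
        by (intro order_tendstoD(1)) auto
      then show ?thesis by (auto elim!: eventually_mono)
    qed
  qed
  then have "eventually (\<lambda>e. 0 < e \<and> (\<forall>h\<in>H. 0 \<le> (1 - e) * h z + e * h y)) (at_right (0::real))"
    by (intro eventually_conj) (simp_all add: eventually_at_right_less)
  then obtain e :: real where e: "0 < e" "\<forall>h\<in>H. 0 \<le> (1 - e) * h z + e * h y"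
    using eventually_happens[of _ "at_right (0::real)"] by (auto simp: trivial_limit_at_right_real)
  then have "(1 - e) *\<^sub>R z + e *\<^sub>R y \<in> Q"
    using z y Q_L L_comb by (auto simp: Q_eq H_comb)
  then show ?thesis using e(1) by blast
qed

lemma tight_face: "h \<in> H \<Longrightarrow> tight h face_of Q"
  unfolding face_of_def
proof (intro conjI ballI impI)
  assume h: "h \<in> H"
  show "tight h \<subseteq> Q" by (auto simp: tight_def)
  show "convex (tight h)" unfolding convex_alt
    using convex_Q h by (auto simp: tight_def H_comb convexD_alt)
  fix a b x assume ab: "a \<in> Q" "b \<in> Q" "x \<in> tight h" "x \<in> open_segment a b"
  then obtain u where u: "0 < u" "u < 1" "x = (1 - u) *\<^sub>R a + u *\<^sub>R b" by (auto simp: in_segment)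
  have "(1 - u) * h a + u * h b = 0" using ab(3) H_comb[OF h] u(3) by (simp add: tight_def)
  moreover have "0 \<le> (1 - u) * h a" "0 \<le> u * h b" using H_nonneg[OF h] ab u by auto
  ultimately have "(1 - u) * h a = 0" "u * h b = 0" by linarith+
  then show "a \<in> tight h" "b \<in> tight h" using ab u by (auto simp: tight_def)
qed

lemma tight_neq: "h \<in> Hp \<Longrightarrow> tight h \<noteq> Q"
  unfolding Hp_def tight_def by force

lemma Hp_H: "h \<in> Hp \<Longrightarrow> h \<in> H"
  by (simp add: Hp_def)

lemma not_Hp: "h \<in> H \<Longrightarrow> h \<notin> Hp \<Longrightarrow> y \<in> Q \<Longrightarrow> h y = 0"
  using H_nonneg[of h y] by (force simp: Hp_def)

lemma face_with_interior_point:
  assumes F: "F face_of Q" and z: "z \<in> F" "\<And>h. h \<in> Hp \<Longrightarrow> 0 < h z"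
  shows "F = Q"
proof
  show "F \<subseteq> Q" using F by (rule face_of_imp_subset)
  show "Q \<subseteq> F"
  proof
    fix x assume x: "x \<in> Q"
    have zQ: "z \<in> Q" using z(1) \<open>F \<subseteq> Q\<close> by blast
    show "x \<in> F"
    proof (cases "x = z")
      case False
      \<comment> \<open>The reflection of \<open>x\<close> in \<open>z\<close>. A short step from
        \<open>z\<close> towards it stays in \<open>Q\<close> and puts \<open>z\<close> strictly
        between \<open>x\<close> and a point \<open>w\<close> of \<open>Q\<close>, so the face
        property pulls \<open>x\<close> into \<open>F\<close>.\<close>
      define y where "y = (1 - 2) *\<^sub>R x + (2::real) *\<^sub>R z"
      have "y \<in> L" using x zQ Q_L unfolding y_def by (intro L_comb) auto
      moreover have "0 \<le> h y" if h: "h \<in> H" "h z = 0" for h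
      proof -
        have "h \<notin> Hp" using z(2) h by force
        then have "h x = 0" using not_Hp h(1) x by blast
        then show ?thesis using H_comb[OF h(1), of 2 x z] h(2) by (simp add: y_def)
      qed
      ultimately obtain e where e: "0 < e" "(1 - e) *\<^sub>R z + e *\<^sub>R y \<in> Q"
        using move_inside[OF zQ] by blast
      define w where "w = (1 - e) *\<^sub>R z + e *\<^sub>R y"
      have "(1 + e) *\<^sub>R z = (1 - e) *\<^sub>R z + (e * 2) *\<^sub>R z" by (simp add: scaleR_left_distrib[symmetric])
      then have w: "w = (1 + e) *\<^sub>R z - e *\<^sub>R x" by (simp add: w_def y_def scaleR_right_diff_distrib)
      have "z = (1 - 1 / (1 + e)) *\<^sub>R x + (1 / (1 + e)) *\<^sub>R w"
      proof -
        have "1 - 1 / (1 + e) = e / (1 + e)" "(1 / (1 + e)) * (1 + e) = 1" using e(1) by (auto simp: field_simps)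
        then show ?thesis by (simp add: w scaleR_right_diff_distrib)
      qed
      moreover have "x \<noteq> w"
      proof
        assume "x = w"
        then have "(1 + e) *\<^sub>R x = (1 + e) *\<^sub>R z" using w by (simp add: algebra_simps)
        then show False using e(1) False by simp
      qed
      ultimately have "z \<in> open_segment x w" using e(1)
        by (auto simp: in_segment intro!: exI[of _ "1 / (1 + e)"])
      moreover have "\<forall>a\<in>Q. \<forall>b\<in>Q. \<forall>x\<in>F. x \<in> open_segment a b \<longrightarrow> a \<in> F \<and> b \<in> F"
        using F by (auto simp: face_of_def)
      moreover have "w \<in> Q" using e(2) by (simp add: w_def)
      ultimately show ?thesis using x z(1) by blast
    qed (use z in simp)
  qed
qed

text \<open>Otherwise each inequality of \<open>Hp\<close> would be strict somewhere on
  \<open>F\<close>, and averaging would make all of them strict at one point of \<open>F\<close>,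
  which only the face \<open>Q\<close> permits.\<close>

lemma proper_face_tight:
  assumes "F face_of Q" "F \<noteq> Q" "F \<noteq> {}"
  shows "\<exists>h\<in>Hp. F \<subseteq> tight h"
proof (rule ccontr)
  assume n: "\<not> ?thesis"
  have FQ: "F \<subseteq> Q" using assms(1) by (rule face_of_imp_subset)
  have "\<exists>y\<in>F. 0 < h y" if h: "h \<in> Hp" for h
  proof -
    obtain y where "y \<in> F" "y \<notin> tight h" using n h by blast
    then show ?thesis using H_nonneg[OF Hp_H[OF h], of y] FQ by (force simp: tight_def)
  qed
  then obtain z where "z \<in> F" "\<forall>h\<in>Hp. 0 < h z"
    using common_positive[OF face_of_imp_convex[OF assms(1)] assms(3) FQ, of Hp] Hp_H by blast
  then show False using face_with_interior_point[OF assms(1)] assms(2) by blast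
qed

lemma finite_Hp: "finite Hp"
  using finite_H by (simp add: Hp_def)

lemma facet_tight:
  assumes "F \<in> facets Q" "F \<noteq> {}"
  shows "\<exists>h\<in>Hp. F = tight h"
proof -
  have F: "F face_of Q" "F \<noteq> Q" and m: "\<And>F'. F' face_of Q \<Longrightarrow> F' \<noteq> Q \<Longrightarrow> F \<subseteq> F' \<Longrightarrow> F' = F"
    using assms(1) by (auto simp: facets_def)
  obtain h where "h \<in> Hp" "F \<subseteq> tight h" using proper_face_tight[OF F assms(2)] by blast
  then show ?thesis using m[of "tight h"] tight_face tight_neq Hp_H by blast
qed

lemma finite_facets: "finite (facets Q)"
proof (rule finite_subset)
  show "facets Q \<subseteq> insert {} (tight ` Hp)" using facet_tight by blast
qed (simp add: finite_Hp)

text \<open>A maximal one among the finitely many tight sets is maximal among all proper faces,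
  since every nonempty proper face lies in a tight set.\<close>

lemma facet_above:
  assumes h: "h \<in> Hp" "tight h \<noteq> {}"
  shows "\<exists>F\<in>facets Q. tight h \<subseteq> F"
proof -
  obtain T where T: "T \<in> tight ` Hp" "tight h \<subseteq> T" "\<And>S. S \<in> tight ` Hp \<Longrightarrow> T \<subseteq> S \<Longrightarrow> T = S"
    using finite_has_maximal2[of "tight ` Hp" "tight h"] finite_Hp h(1) by (metis (no_types, lifting) finite_imageI imageI)
  have "F' = T" if F': "F' face_of Q" "F' \<noteq> Q" "T \<subseteq> F'" for F'
  proof -
    have "F' \<noteq> {}" using F'(3) T(2) h(2) by blast
    then obtain g where "g \<in> Hp" "F' \<subseteq> tight g" using proper_face_tight F' by blast
    then show ?thesis using T(3)[of "tight g"] F'(3) by blast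
  qed
  moreover have "T face_of Q" "T \<noteq> Q" using T(1) tight_face tight_neq Hp_H by auto
  ultimately have "T \<in> facets Q" by (auto simp: facets_def)
  then show ?thesis using T(2) by blast
qed

text \<open>Yields size at least 1, which settles the cases where the binomial coefficient is
  bounded. If no inequality of \<open>Hp\<close> is ever tight, the empty face is the facet.\<close>

lemma facets_nonempty: "facets Q \<noteq> {}"
proof (cases "\<exists>h\<in>Hp. tight h \<noteq> {}")
  case True
  then show ?thesis using facet_above by blast
next
  case False
  have "F' = {}" if "F' face_of Q" "F' \<noteq> Q" for F'
    using proper_face_tight[OF that] False by blast
  then have "{} \<in> facets Q" using Q_nonempty by (auto simp: facets_def)
  then show ?thesis by blast
qed

text \<open>
  For \<open>b\<close> minimal among the ratios \<open>g y0 / g y1\<close>, moving from a relative interior point of the facet in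
  direction \<open>(y0 - z) - b (y1 - z)\<close> stays inside \<open>Q\<close> and on the facet, which forces all ratios to agree.
\<close>
lemma facet_proportional:
  assumes F: "F \<in> facets Q" "F = tight h" "F \<noteq> {}" and h: "h \<in> Hp"
    and a: "affine_map a" "\<And>y. y \<in> F \<Longrightarrow> a y = (0::real)"
    and y: "y0 \<in> Q - F" "y1 \<in> Q - F"
  shows "a y0 * h y1 = a y1 * h y0"
proof -
  have Ff: "F face_of Q" and max: "\<And>F'. F' face_of Q \<Longrightarrow> F' \<noteq> Q \<Longrightarrow> F \<subseteq> F' \<Longrightarrow> F' = F"
    using F(1) by (auto simp: facets_def)
  have FQ: "F \<subseteq> Q" using Ff by (rule face_of_imp_subset)
  have "\<exists>z\<in>F. \<forall>g\<in>{g \<in> H. \<exists>y\<in>F. 0 < g y}. 0 < g z"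
    by (rule common_positive[OF face_of_imp_convex[OF Ff] F(3) FQ]) auto
  then obtain z where z: "z \<in> F" "\<forall>g\<in>{g \<in> H. \<exists>y\<in>F. 0 < g y}. 0 < g z" by blast
  \<comment> \<open>Other inequalities may cut out the same facet as \<open>h\<close>. All of them
    restrict the step from \<open>z\<close>, so the minimum below ranges over
    \<open>J\<close>.\<close>
  define J where "J = {g \<in> Hp. tight g = F}"
  have J: "g \<in> J" if g: "g \<in> Hp" "g z = 0" for g
  proof -
    have "g y = 0" if "y \<in> F" for y
      using z(2) g Hp_H[OF g(1)] H_nonneg[of g y] FQ that by force
    then have "F \<subseteq> tight g" using FQ by (auto simp: tight_def)
    then have "tight g = F" using max[of "tight g"] tight_face tight_neq Hp_H g(1) by blast
    then show ?thesis using g(1) by (simp add: J_def)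
  qed
  have hJ: "h \<in> J" using F(2) h by (simp add: J_def)
  have fJ: "finite J" using finite_Hp by (simp add: J_def)
  have pos: "0 < g y" if "g \<in> J" "y \<in> Q - F" for g y
    using that H_nonneg[of g y] Hp_H[of g] by (force simp: J_def tight_def)
  define b where "b = Min ((\<lambda>g. g y0 / g y1) ` J)"
  have "b \<in> (\<lambda>g. g y0 / g y1) ` J" unfolding b_def using fJ hJ by (intro Min_in) auto
  then obtain g0 where g0: "g0 \<in> J" "b = g0 y0 / g0 y1" by blast
  have bmin: "b * g y1 \<le> g y0" if "g \<in> J" for g
  proof -
    have "b \<le> g y0 / g y1" unfolding b_def using fJ that by (intro Min_le) auto
    then show ?thesis using pos[OF that y(2)] by (simp add: field_simps)
  qed
  \<comment> \<open>This is \<open>z + (y0 - z) - b (y1 - z)\<close>, written as a sum whose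
    coefficients \<open>b\<close>, \<open>1\<close>, \<open>- b\<close> add up to 1 so that
    \<open>affine_map_sum\<close> evaluates it.\<close>
  define w where "w = (\<Sum>i\<in>{0,1,2::nat}. (if i = 0 then b else if i = 1 then 1 else - b) *\<^sub>R (if i = 0 then z else if i = 1 then y0 else y1))"
  have w_aff: "f w = b * f z + f y0 - b * f y1" if "affine_map f" for f :: "'a \<Rightarrow> real"
    unfolding w_def by (subst affine_map_sum[OF that]) auto
  have zQ: "z \<in> Q" using z(1) FQ by blast
  have "w \<in> L" unfolding w_def using subspace_L y zQ Q_L
    by (intro subspace_sum subspace_scale) auto
  moreover have "0 \<le> g w" if g: "g \<in> H" "g z = 0" for g
  proof (cases "g \<in> Hp")
    case True
    then show ?thesis using J[OF True g(2)] bmin[of g] w_aff[OF affine_H[OF g(1)]] g(2) by simp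
  next
    case False
    then show ?thesis using not_Hp[OF g(1) False] y zQ w_aff[OF affine_H[OF g(1)]] by simp
  qed
  ultimately obtain e where e: "0 < e" "(1 - e) *\<^sub>R z + e *\<^sub>R w \<in> Q"
    using move_inside[OF zQ] by blast
  define v where "v = (1 - e) *\<^sub>R z + e *\<^sub>R w"
  have v_aff: "f v = e * (f y0 - b * f y1)" if "affine_map f" "f z = 0" for f :: "'a \<Rightarrow> real"
    unfolding v_def using affine_map_comb[OF that(1), of e z w] w_aff[OF that(1)] that(2) by simp
  have Jz: "g z = 0" if "g \<in> J" for g using that z(1) by (auto simp: J_def tight_def)
  have affJ: "affine_map g" if "g \<in> J" for g using that by (auto simp: J_def Hp_H affine_H)
  have "g0 v = 0" using v_aff[OF affJ Jz, OF g0(1) g0(1)] g0(2) pos[OF g0(1) y(2)] by simp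
  then have vF: "v \<in> F" using g0(1) e(2) by (auto simp: J_def tight_def v_def)
  then have "h v = 0" "a v = 0" using F(2) a(2) by (auto simp: tight_def)
  then have "h y0 = b * h y1" "a y0 = b * a y1"
    using v_aff[OF affJ Jz, OF hJ hJ] v_aff[OF a(1) a(2), OF z(1)] e(1) by auto
  then show ?thesis by simp
qed

text \<open>The square of the Lipschitz constant on \<open>Q\<close>, as \<open>D\<close> is a
  squared distance; hence the square root in \<open>slack\<close>. Dividing by that root removes the
  arbitrary positive factor in the choice of a facet inequality.\<close>

definition lip :: "('a \<Rightarrow> real) \<Rightarrow> real" where
  "lip h = Sup ((\<lambda>(x, y). (h x - h y)\<^sup>2 / D x y) ` {(x, y). x \<in> Q \<and> y \<in> Q \<and> x \<noteq> y})"

definition facet_form :: "'a set \<Rightarrow> 'a \<Rightarrow> real" where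
  "facet_form F = (SOME h. h \<in> Hp \<and> F = tight h)"

text \<open>
  The empty facet has no tight inequality; it occurs only when \<open>Q\<close> is an affine subspace, where
  no inequality is needed.
\<close>
definition slack :: "'a set \<Rightarrow> 'a \<Rightarrow> real" where
  "slack F y = (if F = {} then 0 else facet_form F y / sqrt (lip (facet_form F)))"

lemma facet_form:
  assumes "F \<in> facets Q" "F \<noteq> {}" shows "facet_form F \<in> Hp" "F = tight (facet_form F)"
proof -
  have "facet_form F \<in> Hp \<and> F = tight (facet_form F)"
    unfolding facet_form_def using facet_tight[OF assms]
    by (intro someI_ex[of "\<lambda>h. h \<in> Hp \<and> F = tight h"]) blast
  then show "facet_form F \<in> Hp" "F = tight (facet_form F)" by blast+
qed

lemma lip_upper:
  assumes "h \<in> H" "x \<in> Q" "y \<in> Q" "x \<noteq> y"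
  shows "(h x - h y)\<^sup>2 / D x y \<le> lip h"
  unfolding lip_def
proof (rule cSup_upper)
  obtain K where K: "\<forall>x\<in>Q. \<forall>y\<in>Q. (h x - h y)\<^sup>2 \<le> K * D x y" using D_bound[OF assms(1)] by blast
  show "bdd_above ((\<lambda>(x, y). (h x - h y)\<^sup>2 / D x y) ` {(x, y). x \<in> Q \<and> y \<in> Q \<and> x \<noteq> y})"
  proof (rule bdd_aboveI[of _ K])
    fix r assume "r \<in> (\<lambda>(x, y). (h x - h y)\<^sup>2 / D x y) ` {(x, y). x \<in> Q \<and> y \<in> Q \<and> x \<noteq> y}"
    then obtain x y where xy: "x \<in> Q" "y \<in> Q" "x \<noteq> y" "r = (h x - h y)\<^sup>2 / D x y" by auto
    then have "0 < D x y" using D_nonneg[of x y] D_zero[of x y] by simp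
    moreover have "(h x - h y)\<^sup>2 \<le> K * D x y" using K xy by blast
    ultimately show "r \<le> K" using xy(4) by (simp add: pos_divide_le_eq)
  qed
qed (use assms in auto)

lemma lip_pos:
  assumes "h \<in> Hp" "tight h \<noteq> {}" shows "0 < lip h"
proof -
  obtain x y where xy: "x \<in> Q" "0 < h x" "y \<in> Q" "h y = 0" using assms by (auto simp: Hp_def tight_def)
  then have "x \<noteq> y" by auto
  moreover from this have "0 < D x y" using D_nonneg[of x y] D_zero[of x y] xy by simp
  ultimately have "0 < (h x - h y)\<^sup>2 / D x y" using xy by simp
  also have "\<dots> \<le> lip h" using lip_upper[OF Hp_H[OF assms(1)] xy(1,3)] \<open>x \<noteq> y\<close> by simp
  finally show ?thesis .
qed

lemma slack_affine:
  assumes "F \<in> facets Q" shows "affine_map (slack F)"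
proof (cases "F = {}")
  case True
  then have "slack F = (\<lambda>_. 0)" by (auto simp: slack_def)
  then show ?thesis using affine_map_zero by simp
next
  case False
  then have "slack F = (\<lambda>y. facet_form F y / sqrt (lip (facet_form F)))" by (auto simp: slack_def)
  then show ?thesis using affine_map_scale[OF affine_H[OF Hp_H[OF facet_form(1)[OF assms False]]]] by simp
qed

lemma slack_nonneg:
  assumes "F \<in> facets Q" "y \<in> Q" shows "0 \<le> slack F y"
proof (cases "F = {}")
  case False
  have "0 < lip (facet_form F)" using facet_form[OF assms(1) False] False by (metis lip_pos)
  moreover have "0 \<le> facet_form F y" by (rule H_nonneg[OF Hp_H[OF facet_form(1)[OF assms(1) False]] assms(2)])
  ultimately show ?thesis by (simp add: slack_def)
qed (simp add: slack_def)

text \<open>On the way from a point strictly inside to a \<open>y\<close> outside \<open>Q\<close>,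
  the exit point lies on some facet. The form of this facet is positive at the start and 0 at the
  exit, hence negative at \<open>y\<close>. The hypothesis on \<open>H\<close> outside
  \<open>Hp\<close> makes \<open>y\<close> satisfy the implicit equations of
  \<open>Q\<close>.\<close>

lemma slack_complete:
  assumes y: "y \<in> L" "\<And>h. h \<in> H \<Longrightarrow> h \<notin> Hp \<Longrightarrow> h y = 0"
    and s: "\<And>F. F \<in> facets Q \<Longrightarrow> 0 \<le> slack F y"
  shows "y \<in> Q"
proof (rule ccontr)
  assume n: "y \<notin> Q"
  have "\<exists>x\<in>Q. \<forall>h\<in>Hp. 0 < h x"
    by (rule common_positive[OF convex_Q Q_nonempty order.refl]) (auto simp: Hp_def)
  then obtain x where x: "x \<in> Q" "\<forall>h\<in>Hp. 0 < h x" by blast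
  define B where "B = {h \<in> Hp. h y < 0}"
  have "B \<noteq> {}" using n y by (force simp: Q_eq B_def not_le)
  moreover have fB: "finite B" using finite_Hp by (simp add: B_def)
  \<comment> \<open>The parameter at which an inequality violated by \<open>y\<close> first becomes
    tight; taking the minimum keeps all others valid there.\<close>
  define t where "t = Min ((\<lambda>h. h x / (h x - h y)) ` B)"
  have "t \<in> (\<lambda>h. h x / (h x - h y)) ` B" unfolding t_def using fB \<open>B \<noteq> {}\<close> by (intro Min_in) auto
  then obtain h0 where h0: "h0 \<in> B" "t = h0 x / (h0 x - h0 y)" by blast
  have h0p: "h0 \<in> Hp" "h0 y < 0" "0 < h0 x" using h0(1) x(2) by (auto simp: B_def)
  then have t01: "0 < t" "t < 1" unfolding h0(2) by simp_all
  define z where "z = (1 - t) *\<^sub>R x + t *\<^sub>R y"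
  have hz: "h z = (1 - t) * h x + t * h y" if "h \<in> H" for h
    using H_comb[OF that] by (simp add: z_def)
  have "0 \<le> h z" if h: "h \<in> H" for h
  proof -
    consider "h \<in> B" | "h \<in> Hp" "0 \<le> h y" | "h \<notin> Hp" unfolding B_def by force
    then show ?thesis
    proof cases
      case 1
      then have hp: "0 < h x - h y" using x(2) by (auto simp: B_def)
      have "t \<le> h x / (h x - h y)" unfolding t_def using fB 1 by (intro Min_le) auto
      then have "t * (h x - h y) \<le> h x" using hp by (simp add: field_simps)
      then show ?thesis using hz[OF h] by (simp add: algebra_simps)
    next
      case 2
      then show ?thesis using hz[OF h] x(2) t01 by (simp add: less_imp_le)
    next
      case 3
      then show ?thesis using hz[OF h] y(2)[OF h] not_Hp[OF h _ x(1)] by simp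
    qed
  qed
  moreover have "z \<in> L" unfolding z_def using x(1) Q_L y(1) by (intro L_comb) auto
  ultimately have zQ: "z \<in> Q" by (auto simp: Q_eq)
  have "h0 z = h0 x - t * (h0 x - h0 y)" using hz[OF Hp_H[OF h0p(1)]] by (simp add: algebra_simps)
  also have "\<dots> = 0" using h0p h0(2) by simp
  finally have "z \<in> tight h0" using zQ by (simp add: tight_def)
  then obtain F where F: "F \<in> facets Q" "z \<in> F" using facet_above[OF h0p(1)] by blast
  let ?f = "facet_form F"
  have Fne: "F \<noteq> {}" using F(2) by auto
  have f: "?f \<in> Hp" "F = tight ?f" by (rule facet_form[OF F(1) Fne])+
  have "?f z = 0" using F(2) f(2) by (auto simp: tight_def)
  moreover have "0 < (1 - t) * ?f x" using x(2) f(1) t01 by simp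
  ultimately have "t * ?f y < 0" using hz[OF Hp_H[OF f(1)]] by linarith
  then have "?f y < 0" using t01 by (simp add: mult_less_0_iff)
  moreover have "0 < lip ?f" using lip_pos[OF f(1)] f(2) Fne by simp
  ultimately have "slack F y < 0" using Fne by (simp add: slack_def divide_neg_pos)
  then show False using s[OF F(1)] by simp
qed

section \<open>Isometries permute the facets and preserve the slacks\<close>

definition isometry :: "('a \<Rightarrow> 'a) \<Rightarrow> bool" where
  "isometry \<kappa> \<longleftrightarrow> affine_map \<kappa> \<and> \<kappa> ` Q = Q \<and> (\<forall>x\<in>Q. \<forall>y\<in>Q. D (\<kappa> x) (\<kappa> y) = D x y)"

lemma isometry_comp:
  assumes "isometry \<kappa>" "isometry \<kappa>'" shows "isometry (\<kappa> \<circ> \<kappa>')"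
proof -
  have "(\<kappa> \<circ> \<kappa>') ` Q = \<kappa> ` (\<kappa>' ` Q)" by (rule image_comp[symmetric])
  moreover have "\<kappa>' x \<in> Q" if "x \<in> Q" for x using that assms(2) by (auto simp: isometry_def)
  ultimately show ?thesis using assms by (simp add: isometry_def affine_map_comp)
qed

context
  fixes \<kappa> assumes \<kappa>: "isometry \<kappa>"
begin

lemma isometry_Q: "y \<in> Q \<Longrightarrow> \<kappa> y \<in> Q"
  using \<kappa> by (auto simp: isometry_def)

lemma isometry_surj: "y \<in> Q \<Longrightarrow> \<exists>x\<in>Q. y = \<kappa> x"
  using \<kappa> by (auto simp: isometry_def)

lemma isometry_eq_iff: "x \<in> Q \<Longrightarrow> y \<in> Q \<Longrightarrow> \<kappa> x = \<kappa> y \<longleftrightarrow> x = y"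
  using \<kappa> D_zero[of x y] D_zero[of "\<kappa> x" "\<kappa> y"] isometry_Q by (auto simp: isometry_def)

lemma isometry_aff: "\<kappa> ((1 - u) *\<^sub>R x + u *\<^sub>R y) = (1 - u) *\<^sub>R \<kappa> x + u *\<^sub>R \<kappa> y"
  using \<kappa> affine_map_comb by (auto simp: isometry_def)

lemma image_face:
  assumes "F face_of Q" shows "\<kappa> ` F face_of Q"
proof -
  have FQ: "F \<subseteq> Q" using assms by (rule face_of_imp_subset)
  have cF: "convex F" using assms by (rule face_of_imp_convex)
  show ?thesis unfolding face_of_def
  proof (intro conjI ballI impI)
    show "\<kappa> ` F \<subseteq> Q" using FQ isometry_Q by auto
    show "convex (\<kappa> ` F)" unfolding convex_alt
    proof (clarify)
      fix x y u assume "x \<in> F" "y \<in> F" "0 \<le> u" "u \<le> (1::real)"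
      then have "(1 - u) *\<^sub>R x + u *\<^sub>R y \<in> F" using cF by (auto simp: convex_alt)
      then show "(1 - u) *\<^sub>R \<kappa> x + u *\<^sub>R \<kappa> y \<in> \<kappa> ` F" by (metis isometry_aff imageI)
    qed
    fix a b x assume ab: "a \<in> Q" "b \<in> Q" "x \<in> \<kappa> ` F" "x \<in> open_segment a b"
    obtain a' b' x' where p: "a' \<in> Q" "a = \<kappa> a'" "b' \<in> Q" "b = \<kappa> b'" "x' \<in> F" "x = \<kappa> x'"
      using isometry_surj ab(1-3) by blast
    obtain u where u: "a \<noteq> b" "0 < u" "u < 1" "x = (1 - u) *\<^sub>R a + u *\<^sub>R b" using ab(4) by (auto simp: in_segment)
    have "(1 - u) *\<^sub>R a' + u *\<^sub>R b' \<in> Q" using convexD_alt[OF convex_Q p(1,3)] u by simp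
    moreover have "\<kappa> x' = \<kappa> ((1 - u) *\<^sub>R a' + u *\<^sub>R b')" using u(4) p by (simp add: isometry_aff)
    ultimately have "x' = (1 - u) *\<^sub>R a' + u *\<^sub>R b'" using isometry_eq_iff p(5) FQ by blast
    then have "x' \<in> open_segment a' b'" using u p by (auto simp: in_segment)
    moreover have "\<forall>a\<in>Q. \<forall>b\<in>Q. \<forall>x\<in>F. x \<in> open_segment a b \<longrightarrow> a \<in> F \<and> b \<in> F"
      using assms by (auto simp: face_of_def)
    ultimately have "a' \<in> F \<and> b' \<in> F" using p by blast
    then show "a \<in> \<kappa> ` F" "b \<in> \<kappa> ` F" using p by auto
  qed
qed

text \<open>Takes the place of the image under an inverse: injectivity of \<open>\<kappa>\<close> is
  known on \<open>Q\<close> only, so the preimage is formed within \<open>Q\<close>.\<close>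

lemma preimage_face:
  assumes "F face_of Q" shows "{y \<in> Q. \<kappa> y \<in> F} face_of Q"
proof -
  have cF: "convex F" using assms by (rule face_of_imp_convex)
  show ?thesis unfolding face_of_def
  proof (intro conjI ballI impI)
    show "convex {y \<in> Q. \<kappa> y \<in> F}" unfolding convex_alt
      using convex_Q cF by (auto simp: isometry_aff convex_alt)
    fix a b x assume ab: "a \<in> Q" "b \<in> Q" "x \<in> {y \<in> Q. \<kappa> y \<in> F}" "x \<in> open_segment a b"
    obtain u where u: "a \<noteq> b" "0 < u" "u < 1" "x = (1 - u) *\<^sub>R a + u *\<^sub>R b" using ab(4) by (auto simp: in_segment)
    have "\<kappa> x \<in> open_segment (\<kappa> a) (\<kappa> b)"
      using u ab isometry_eq_iff by (auto simp: in_segment isometry_aff)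
    moreover have "\<forall>a\<in>Q. \<forall>b\<in>Q. \<forall>x\<in>F. x \<in> open_segment a b \<longrightarrow> a \<in> F \<and> b \<in> F"
      using assms by (auto simp: face_of_def)
    ultimately have "\<kappa> a \<in> F \<and> \<kappa> b \<in> F" using ab isometry_Q by blast
    then show "a \<in> {y \<in> Q. \<kappa> y \<in> F}" "b \<in> {y \<in> Q. \<kappa> y \<in> F}" using ab by auto
  qed auto
qed

lemma image_facet:
  assumes "F \<in> facets Q" shows "\<kappa> ` F \<in> facets Q"
proof -
  have F: "F face_of Q" "F \<noteq> Q" and m: "\<And>F'. F' face_of Q \<Longrightarrow> F' \<noteq> Q \<Longrightarrow> F \<subseteq> F' \<Longrightarrow> F' = F"
    using assms by (auto simp: facets_def)
  have FQ: "F \<subseteq> Q" using F(1) by (rule face_of_imp_subset)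
  have "\<kappa> ` F \<noteq> Q"
  proof
    assume e: "\<kappa> ` F = Q"
    have "x \<in> F" if x: "x \<in> Q" for x
    proof -
      obtain w where "w \<in> F" "\<kappa> x = \<kappa> w" using isometry_Q[OF x] e by blast
      then show ?thesis using isometry_eq_iff[of x w] x FQ by auto
    qed
    then show False using F(2) FQ by blast
  qed
  moreover have "F' = \<kappa> ` F" if F': "F' face_of Q" "F' \<noteq> Q" "\<kappa> ` F \<subseteq> F'" for F'
  proof -
    have F'Q: "F' \<subseteq> Q" using F'(1) by (rule face_of_imp_subset)
    have im: "\<kappa> ` {y \<in> Q. \<kappa> y \<in> F'} = F'" using F'Q isometry_surj by blast
    have "{y \<in> Q. \<kappa> y \<in> F'} \<noteq> Q"
    proof
      assume "{y \<in> Q. \<kappa> y \<in> F'} = Q"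
      then have "F' = \<kappa> ` Q" using im by simp
      then show False using F'(2) \<kappa> by (simp add: isometry_def)
    qed
    then have "{y \<in> Q. \<kappa> y \<in> F'} = F" using m preimage_face[OF F'(1)] F'(3) FQ by blast
    then show ?thesis using im by simp
  qed
  ultimately show ?thesis using image_face[OF F(1)] by (auto simp: facets_def)
qed

text \<open>\<open>\<kappa>\<close> permutes the pairs of distinct points of \<open>Q\<close> and
  keeps their distances, so the two families of difference quotients agree up to the factor
  \<open>c\<^sup>2\<close>.\<close>

lemma lip_scaled:
  assumes "g \<in> H" and e: "\<And>y. y \<in> Q \<Longrightarrow> g (\<kappa> y) = c * h y" and h: "h \<in> H" and c: "0 < c"
    and ne: "x0 \<in> Q" "y0 \<in> Q" "x0 \<noteq> y0"
  shows "lip g = c\<^sup>2 * lip h"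
proof (rule antisym)
  have r: "(g (\<kappa> x) - g (\<kappa> y))\<^sup>2 / D (\<kappa> x) (\<kappa> y) = c\<^sup>2 * ((h x - h y)\<^sup>2 / D x y)" if "x \<in> Q" "y \<in> Q" for x y
  proof -
    have "g (\<kappa> x) - g (\<kappa> y) = c * (h x - h y)" using e that by (simp add: algebra_simps)
    then show ?thesis using that \<kappa> by (simp add: power_mult_distrib isometry_def)
  qed
  show "lip g \<le> c\<^sup>2 * lip h"
    unfolding lip_def[of g]
  proof (rule cSup_least)
    fix s assume "s \<in> (\<lambda>(x, y). (g x - g y)\<^sup>2 / D x y) ` {(x, y). x \<in> Q \<and> y \<in> Q \<and> x \<noteq> y}"
    then obtain x y where xy: "x \<in> Q" "y \<in> Q" "x \<noteq> y" "s = (g x - g y)\<^sup>2 / D x y" by auto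
    obtain x' y' where p: "x' \<in> Q" "x = \<kappa> x'" "y' \<in> Q" "y = \<kappa> y'" using isometry_surj xy by metis
    then have "s = c\<^sup>2 * ((h x' - h y')\<^sup>2 / D x' y')" using r xy by simp
    also have "\<dots> \<le> c\<^sup>2 * lip h" using p xy by (intro mult_left_mono lip_upper[OF h]) auto
    finally show "s \<le> c\<^sup>2 * lip h" .
  qed (use ne in auto)
  have "lip h \<le> lip g / c\<^sup>2"
    unfolding lip_def[of h]
  proof (rule cSup_least)
    fix s assume "s \<in> (\<lambda>(x, y). (h x - h y)\<^sup>2 / D x y) ` {(x, y). x \<in> Q \<and> y \<in> Q \<and> x \<noteq> y}"
    then obtain x y where xy: "x \<in> Q" "y \<in> Q" "x \<noteq> y" "s = (h x - h y)\<^sup>2 / D x y" by auto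
    have "c\<^sup>2 * s = (g (\<kappa> x) - g (\<kappa> y))\<^sup>2 / D (\<kappa> x) (\<kappa> y)" using r[OF xy(1,2)] xy(4) by simp
    also have "\<dots> \<le> lip g" using xy isometry_Q isometry_eq_iff by (intro lip_upper[OF assms(1)]) auto
    finally show "s \<le> lip g / c\<^sup>2" using c by (simp add: field_simps)
  qed (use ne in auto)
  then show "c\<^sup>2 * lip h \<le> lip g" using c by (simp add: field_simps)
qed

text \<open>The form chosen for the image facet, composed with \<open>\<kappa>\<close>, is affine
  and vanishes on \<open>F\<close>, so on \<open>Q\<close> it is a positive multiple of the form
  chosen for \<open>F\<close>. The Lipschitz constants differ by the same multiple, which
  cancels.\<close>

lemma slack_equivariant:
  assumes F: "F \<in> facets Q" and y: "y \<in> Q"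
  shows "slack (\<kappa> ` F) (\<kappa> y) = slack F y"
proof (cases "F = {}")
  case False
  define h g where "h = facet_form F" and "g = facet_form (\<kappa> ` F)"
  have h: "h \<in> Hp" "F = tight h" using facet_form[OF F False] by (simp_all add: h_def)
  have g: "g \<in> Hp" "\<kappa> ` F = tight g" using facet_form[OF image_facet[OF F]] False by (simp_all add: g_def)
  have FQ: "F \<subseteq> Q" using h(2) by (auto simp: tight_def)
  obtain y1 where y1: "y1 \<in> Q" "0 < h y1" using h(1) by (auto simp: Hp_def)
  then have y1F: "y1 \<in> Q - F" using h(2) by (auto simp: tight_def)
  have gpos: "0 < g (\<kappa> y1)"
  proof -
    have "\<kappa> y1 \<notin> \<kappa> ` F" using y1F FQ isometry_eq_iff by blast
    then have "g (\<kappa> y1) \<noteq> 0" using g(2) isometry_Q y1 by (auto simp: tight_def)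
    then show ?thesis using H_nonneg[OF Hp_H[OF g(1)] isometry_Q[OF y1(1)]] by simp
  qed
  define c where "c = g (\<kappa> y1) / h y1"
  have c: "0 < c" using gpos y1 by (simp add: c_def)
  have gF: "g (\<kappa> w) = 0" if "w \<in> F" for w using that g(2) by (auto simp: tight_def)
  have e: "g (\<kappa> w) = c * h w" if w: "w \<in> Q" for w
  proof (cases "w \<in> F")
    case True
    then show ?thesis using gF h(2) by (auto simp: tight_def)
  next
    case wF: False
    have "affine_map (g \<circ> \<kappa>)" using \<kappa> affine_H[OF Hp_H[OF g(1)]] by (auto simp: isometry_def affine_map_comp)
    then have "(g \<circ> \<kappa>) w * h y1 = (g \<circ> \<kappa>) y1 * h w"
      by (rule facet_proportional[OF F h(2) False h(1)]) (use gF w wF y1F in auto)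
    then show ?thesis using y1 by (simp add: c_def field_simps)
  qed
  obtain x0 where "x0 \<in> F" using False by blast
  then have "lip g = c\<^sup>2 * lip h"
    using lip_scaled[OF Hp_H[OF g(1)] e Hp_H[OF h(1)] c, of x0 y1] FQ y1F by auto
  then have "sqrt (lip g) = c * sqrt (lip h)" using c by (simp add: real_sqrt_mult)
  then show ?thesis using False c e[OF y] by (simp add: slack_def g_def[symmetric] h_def[symmetric])
qed (simp add: slack_def)

end

end

section \<open>Symmetric extensions of the matching polytope\<close>

lemma transpose_fixes_matching:
  assumes "pairwise disjnt M" "{c, d} \<in> M"
  shows "(`) (Transposition.transpose c d) ` M = M"
proof -
  have "Transposition.transpose c d ` e = e" if e: "e \<in> M" for e
  proof (cases "e = {c, d}")
    case True
    then show ?thesis by auto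
  next
    case False
    then have "disjnt e {c, d}" using pairwiseD[OF assms(1) e assms(2)] by simp
    then have "c \<in> e \<longleftrightarrow> d \<in> e" by (auto simp: disjnt_def)
    then show ?thesis by simp
  qed
  then show ?thesis by simp
qed

text \<open>Two different transpositions either share a point, and their product is a 3-cycle, or
  are disjoint; then inserting the transposition of \<open>b\<close> and \<open>c\<close> twice
  splits the product into two 3-cycles.\<close>

lemma (in permutation_group) transpose_pair_mem:
  assumes cyc: "\<And>a b c. {a, b, c} \<subseteq> X - W \<Longrightarrow> distinct [a, b, c] \<Longrightarrow> cyc3 a b c \<in> U"
    and "{a, b, c, d} \<subseteq> X - W" "a \<noteq> b" "c \<noteq> d" "{a, b} \<noteq> {c, d}"
  shows "Transposition.transpose a b \<circ> Transposition.transpose c d \<in> U"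
proof -
  let ?t = "Transposition.transpose"
  have share: "?t x y \<circ> ?t y z \<in> U" if "{x, y, z} \<subseteq> X - W" "distinct [x, y, z]" for x y z
    using cyc[OF that] by (simp add: cyc3_def)
  consider "b = c" | "b = d" | "a = c" | "a = d" | "distinct [a, b, c, d]"
    using assms(3,4) by auto
  then show ?thesis
  proof cases
    case 1
    then show ?thesis using share[of a b d] assms(2-5) by auto
  next
    case 2
    then show ?thesis using share[of a b c] assms(2-5) by (auto simp: transpose_commute[of c d])
  next
    case 3
    then have "?t b a \<circ> ?t a d \<in> U" using share[of b a d] assms(2-5) by auto
    then show ?thesis using 3 by (metis transpose_commute)
  next
    case 4
    then have "?t b a \<circ> ?t a c \<in> U" using share[of b a c] assms(2-5) by auto
    then show ?thesis using 4 by (metis transpose_commute)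
  next
    case 5
    have "?t a b \<circ> ?t c d = (?t a b \<circ> ?t b c) \<circ> (?t b c \<circ> ?t c d)"
      by (simp add: fun_eq_iff)
    moreover have "?t a b \<circ> ?t b c \<in> U" "?t b c \<circ> ?t c d \<in> U"
      using share[of a b c] share[of b c d] 5 assms(2) by auto
    ultimately show ?thesis by (metis comp_mem)
  qed
qed

text \<open>3-cycles generate only even permutations. The missing sign comes from the edge
  \<open>e\<close> of \<open>M\<close> off \<open>W\<close>: swapping the two ends of its current
  image fixes the matching, so each transposition can be paired with this swap to give an element of
  \<open>U\<close>.\<close>

lemma (in permutation_group) invariant_off:
  assumes cyc: "\<And>a b c. {a, b, c} \<subseteq> X - W \<Longrightarrow> distinct [a, b, c] \<Longrightarrow> cyc3 a b c \<in> U"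
    and inv: "\<And>u M. u \<in> U \<Longrightarrow> M \<in> \<M> \<Longrightarrow> s ((`) u ` M) = s M"
    and closed: "\<And>\<pi> M. \<pi> permutes X \<Longrightarrow> M \<in> \<M> \<Longrightarrow> (`) \<pi> ` M \<in> \<M>"
    and match: "\<And>M. M \<in> \<M> \<Longrightarrow> pairwise disjnt M"
    and M: "M \<in> \<M>" "e \<in> M" "e \<subseteq> X - W" "card e = 2"
    and \<pi>: "\<pi> permutes (X - W)"
  shows "s ((`) \<pi> ` M) = s M"
proof -
  let ?t = "Transposition.transpose"
  have "finite (X - W)" using finite_X by simp
  have "s ((`) \<pi> ` M) = s M \<and> (`) \<pi> ` M \<in> \<M>"
    using \<pi> \<open>finite (X - W)\<close>
  proof (induction rule: permutes_induct)
    case id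
    then show ?case using M by simp
  next
    case (swap a b p)
    define N where "N = (`) p ` M"
    have N: "N \<in> \<M>" "s N = s M" using swap by (simp_all add: N_def)
    have "p ` e \<subseteq> X - W" 
      using permutes_in_image[OF swap.hyps(4)] M(3) by blast
    moreover have "card (p ` e) = 2" using M(4) card_image[OF inj_on_subset[OF permutes_inj[OF swap.hyps(4)] subset_UNIV]] by metis
    ultimately obtain c d where cd: "p ` e = {c, d}" "c \<noteq> d" "c \<in> X - W" "d \<in> X - W"
      by (auto simp: card_2_iff)
    have fix_N: "(`) (?t c d) ` N = N"
    proof (rule transpose_fixes_matching[OF match[OF N(1)]])
      show "{c, d} \<in> N" using M(2) cd(1) unfolding N_def by (metis imageI)
    qed
    have "(`) (?t a b \<circ> p) ` M = (`) (?t a b) ` N" by (auto simp: N_def image_comp image_image)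
    moreover have "s ((`) (?t a b) ` N) = s N"
    proof (cases "{a, b} = {c, d}")
      case True
      then have "?t a b = ?t c d" by (auto simp: doubleton_eq_iff transpose_commute)
      then show ?thesis using fix_N by simp
    next
      case False
      have "(`) (?t a b) ` N = (`) (?t a b) ` (`) (?t c d) ` N" by (simp add: fix_N)
      also have "\<dots> = (`) (?t a b \<circ> ?t c d) ` N" by (simp add: image_comp image_image)
      finally have "(`) (?t a b) ` N = (`) (?t a b \<circ> ?t c d) ` N" .
      moreover have "?t a b \<circ> ?t c d \<in> U"
        using swap.hyps cd False by (intro transpose_pair_mem[OF cyc]) auto
      then have "s ((`) (?t a b \<circ> ?t c d) ` N) = s N" by (rule inv[OF _ N(1)])
      ultimately show ?thesis by (simp only:)
    qed
    moreover have "(`) (?t a b) ` N \<in> \<M>"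
      using swap.hyps N(1) by (intro closed permutes_swap_id) auto
    ultimately show ?case using N(2) by simp
  qed
  then show ?thesis ..
qed

section \<open>Node permutations acting on matchings and vectors\<close>

lemma lookup_scaleR: "Poly_Mapping.lookup (c *\<^sub>R x) i = c * Poly_Mapping.lookup x i"
proof -
  have "finite {i. c * Poly_Mapping.lookup x i \<noteq> 0}"
    by (rule finite_subset[OF _ finite_lookup[of x]]) auto
  then show ?thesis by (simp add: scaleR_poly_mapping_def Abs_poly_mapping_inverse)
qed

lemma lookup_char_vec:
  "finite M \<Longrightarrow> Poly_Mapping.lookup (char_vec M) e = (if e \<in> M then 1 else 0)"
  by (simp add: char_vec_def lookup_sum lookup_single when_def sum.delta')

lemma finite_matching: "M \<in> matchings l n \<Longrightarrow> finite M"
proof -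
  have "finite (complete_edges n)"
    by (rule finite_subset[of _ "Pow {1..n}"]) (auto simp: complete_edges_def)
  then show "M \<in> matchings l n \<Longrightarrow> finite M" using finite_subset by (auto simp: matchings_def)
qed

lemma image_matching:
  assumes \<pi>: "\<pi> permutes {1..n}" and M: "M \<in> matchings l n"
  shows "(`) \<pi> ` M \<in> matchings l n"
proof -
  have inj: "inj \<pi>" using \<pi> by (rule permutes_inj)
  have E: "M \<subseteq> complete_edges n" "pairwise disjnt M" "card M = l" using M by (auto simp: matchings_def)
  have "\<pi> ` e \<in> complete_edges n" if "e \<in> complete_edges n" for e
  proof -
    obtain v w where vw: "e = {v, w}" "v \<in> {1..n}" "w \<in> {1..n}" "v \<noteq> w"
      using \<open>e \<in> complete_edges n\<close> unfolding complete_edges_def by blast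
    then have "\<pi> ` e = {\<pi> v, \<pi> w}" "\<pi> v \<in> {1..n}" "\<pi> w \<in> {1..n}" "\<pi> v \<noteq> \<pi> w"
      using permutes_in_image[OF \<pi>] inj by (auto simp: inj_eq)
    then show ?thesis unfolding complete_edges_def by blast
  qed
  then have "(`) \<pi> ` M \<subseteq> complete_edges n" using E(1) by blast
  moreover have "pairwise disjnt ((`) \<pi> ` M)" by (rule pairwise_disjnt_image[OF inj E(2)])
  moreover have "inj_on ((`) \<pi>) M" using inj by (auto simp: inj_on_def inj_image_eq_iff)
  then have "card ((`) \<pi> ` M) = l" using E(3) card_image by metis
  ultimately show ?thesis by (simp add: matchings_def)
qed

lemma node_action_inj:
  assumes \<pi>: "\<pi> permutes {1..n}" and "node_action \<pi> x = node_action \<pi> y"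
  shows "x = y"
proof (rule poly_mapping_eqI)
  fix e
  have "Poly_Mapping.lookup x (inv \<pi> ` \<pi> ` e) = Poly_Mapping.lookup y (inv \<pi> ` \<pi> ` e)"
    using assms(2) lookup_node_action[OF \<pi>] by metis
  moreover have "inv \<pi> ` \<pi> ` e = e" using permutes_inj[OF \<pi>] by (simp add: image_inv_f_f)
  ultimately show "Poly_Mapping.lookup x e = Poly_Mapping.lookup y e" by simp
qed

lemma node_action_char_vec:
  assumes \<pi>: "\<pi> permutes {1..n}" and "finite M"
  shows "node_action \<pi> (char_vec M) = char_vec ((`) \<pi> ` M)"
proof (rule poly_mapping_eqI)
  fix e
  have "inv \<pi> ` e \<in> M \<longleftrightarrow> e \<in> (`) \<pi> ` M"
  proof
    assume "inv \<pi> ` e \<in> M"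
    then have "\<pi> ` inv \<pi> ` e \<in> (`) \<pi> ` M" by (rule imageI)
    then show "e \<in> (`) \<pi> ` M" using permutes_surj[OF \<pi>] by (simp add: image_f_inv_f)
  next
    assume "e \<in> (`) \<pi> ` M"
    then show "inv \<pi> ` e \<in> M" using permutes_inj[OF \<pi>] by (auto simp: image_inv_f_f)
  qed
  then show "Poly_Mapping.lookup (node_action \<pi> (char_vec M)) e = Poly_Mapping.lookup (char_vec ((`) \<pi> ` M)) e"
    using assms by (simp add: lookup_node_action lookup_char_vec)
qed

lemma node_action_comp:
  assumes "\<pi> permutes {1..n}" "\<rho> permutes {1..n}"
  shows "node_action \<pi> (node_action \<rho> x) = node_action (\<pi> \<circ> \<rho>) x"
proof (rule poly_mapping_eqI)
  fix e
  have "inv (\<pi> \<circ> \<rho>) = inv \<rho> \<circ> inv \<pi>" using assms permutes_bij by (intro o_inv_distrib) auto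
  then show "Poly_Mapping.lookup (node_action \<pi> (node_action \<rho> x)) e = Poly_Mapping.lookup (node_action (\<pi> \<circ> \<rho>) x) e"
    using lookup_node_action[OF assms(1)] lookup_node_action[OF assms(2)]
      lookup_node_action[OF permutes_compose[OF assms(2,1)]] by (simp add: image_comp)
qed

section \<open>An equivariant choice of points above the vertices\<close>

locale symmetric_matching_extension = polyhedron_isometry L Q H D
  for L Q :: "'a::real_vector set" and H :: "('a \<Rightarrow> real) set" and D :: "'a \<Rightarrow> 'a \<Rightarrow> real" +
  fixes p :: "'a \<Rightarrow> (nat set \<Rightarrow>\<^sub>0 real)" and n l :: nat
  assumes affine_p: "affine_map p"
    and p_Q: "p ` Q = match_polytope l n"
    and symmetric: "\<pi> permutes {1..n} \<Longrightarrow> \<exists>\<kappa>. isometry \<kappa> \<and> (\<forall>y\<in>Q. p (\<kappa> y) = node_action \<pi> (p y))"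
begin

definition lifts :: "('a \<Rightarrow> 'a) \<Rightarrow> (nat \<Rightarrow> nat) \<Rightarrow> bool" where
  "lifts \<kappa> \<pi> \<longleftrightarrow> isometry \<kappa> \<and> \<pi> permutes {1..n} \<and> (\<forall>y\<in>Q. p (\<kappa> y) = node_action \<pi> (p y))"

lemma lifts_comp:
  assumes "lifts \<kappa> \<pi>" "lifts \<kappa>' \<pi>'" shows "lifts (\<kappa> \<circ> \<kappa>') (\<pi> \<circ> \<pi>')"
proof -
  have "p ((\<kappa> \<circ> \<kappa>') y) = node_action (\<pi> \<circ> \<pi>') (p y)" if "y \<in> Q" for y
  proof -
    have "\<kappa>' y \<in> Q" using assms(2) that isometry_Q by (auto simp: lifts_def)
    then have "p ((\<kappa> \<circ> \<kappa>') y) = node_action \<pi> (node_action \<pi>' (p y))"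
      using assms that by (simp add: lifts_def)
    also have "\<dots> = node_action (\<pi> \<circ> \<pi>') (p y)"
      using assms unfolding lifts_def by (intro node_action_comp) blast+
    finally show ?thesis .
  qed
  then show ?thesis using assms by (auto simp: lifts_def intro: isometry_comp permutes_compose)
qed

lemma exists_lift: "\<pi> permutes {1..n} \<Longrightarrow> \<exists>\<kappa>. lifts \<kappa> \<pi>"
  using symmetric by (auto simp: lifts_def)

text \<open>The restriction to facets leaves only finitely many such functions and lets equality
  mean agreement on facets.\<close>

definition facet_action :: "('a \<Rightarrow> 'a) \<Rightarrow> 'a set \<Rightarrow> 'a set" where
  "facet_action \<kappa> = restrict (image \<kappa>) (facets Q)"

text \<open>
  The isometries lifting node permutations may form an infinite group, but only finitely many
  pairs of a facet permutation and a node permutation arise from them.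
\<close>
definition action_pairs :: "(('a set \<Rightarrow> 'a set) \<times> (nat \<Rightarrow> nat)) set" where
  "action_pairs = {(facet_action \<kappa>, \<pi>) |\<kappa> \<pi>. lifts \<kappa> \<pi>}"

lemma facet_action_mem: "isometry \<kappa> \<Longrightarrow> facet_action \<kappa> \<in> facets Q \<rightarrow>\<^sub>E facets Q"
  by (auto simp: facet_action_def image_facet)

lemma finite_action_pairs: "finite action_pairs"
proof (rule finite_subset)
  show "action_pairs \<subseteq> (facets Q \<rightarrow>\<^sub>E facets Q) \<times> {\<pi>. \<pi> permutes {1..n}}"
    using facet_action_mem by (auto simp: action_pairs_def lifts_def)
  show "finite ((facets Q \<rightarrow>\<^sub>E facets Q) \<times> {\<pi>. \<pi> permutes {1..n}})"
    by (intro finite_cartesian_product finite_PiE finite_facets finite_permutations) auto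
qed

lemma action_pairs_nonempty: "action_pairs \<noteq> {}"
  using exists_lift[OF permutes_id] by (auto simp: action_pairs_def)

lemma facet_action_surj:
  assumes "isometry \<kappa>" "G \<in> facets Q" shows "\<exists>F\<in>facets Q. G = \<kappa> ` F"
proof -
  have inj: "inj_on (image \<kappa>) (facets Q)"
  proof (rule inj_onI)
    fix F G assume FG: "F \<in> facets Q" "G \<in> facets Q" "\<kappa> ` F = \<kappa> ` G"
    have "inj_on \<kappa> Q" using isometry_eq_iff[OF assms(1)] by (auto simp: inj_on_def)
    moreover have "F \<subseteq> Q" "G \<subseteq> Q" using FG face_of_imp_subset by (auto simp: facets_def)
    ultimately show "F = G" using FG(3) inj_on_image_eq_iff by metis
  qed
  have "image \<kappa> ` facets Q \<subseteq> facets Q" using image_facet[OF assms(1)] by auto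
  then have "image \<kappa> ` facets Q = facets Q" using inj finite_facets by (rule endo_inj_surj[rotated])
  then show ?thesis using assms(2) by blast
qed

text \<open>Lifts compose, so right multiplication maps pairs to pairs; being injective on a finite
  set it is bijective. Averages over the pairs are therefore invariant under it.\<close>

lemma action_pairs_translate:
  assumes "lifts \<kappa> \<pi>"
  shows "bij_betw (\<lambda>(\<sigma>, \<rho>). (restrict (\<sigma> \<circ> image \<kappa>) (facets Q), \<rho> \<circ> \<pi>)) action_pairs action_pairs"
proof -
  let ?f = "\<lambda>(\<sigma>, \<rho>). (restrict (\<sigma> \<circ> image \<kappa>) (facets Q), \<rho> \<circ> \<pi>)"
  have iso: "isometry \<kappa>" and perm: "\<pi> permutes {1..n}" using assms by (auto simp: lifts_def)
  have "?f g \<in> action_pairs" if "g \<in> action_pairs" for g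
  proof -
    obtain \<kappa>' \<pi>' where g: "g = (facet_action \<kappa>', \<pi>')" "lifts \<kappa>' \<pi>'"
      using \<open>g \<in> action_pairs\<close> by (auto simp: action_pairs_def)
    have "restrict (facet_action \<kappa>' \<circ> image \<kappa>) (facets Q) = facet_action (\<kappa>' \<circ> \<kappa>)"
      using image_facet[OF iso] by (auto simp: facet_action_def fun_eq_iff image_comp)
    then have "?f g = (facet_action (\<kappa>' \<circ> \<kappa>), \<pi>' \<circ> \<pi>)" using g(1) by simp
    then show ?thesis using lifts_comp[OF g(2) assms] unfolding action_pairs_def by blast
  qed
  moreover have "inj_on ?f action_pairs"
  proof (rule inj_onI)
    fix g h assume gh: "g \<in> action_pairs" "h \<in> action_pairs" "?f g = ?f h"
    obtain \<sigma> \<rho> \<sigma>' \<rho>' where p: "g = (\<sigma>, \<rho>)" "h = (\<sigma>', \<rho>')" by fastforce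
    have ext: "\<sigma> \<in> facets Q \<rightarrow>\<^sub>E facets Q" "\<sigma>' \<in> facets Q \<rightarrow>\<^sub>E facets Q"
      using gh(1,2) p facet_action_mem by (auto simp: action_pairs_def lifts_def)
    have r: "restrict (\<sigma> \<circ> image \<kappa>) (facets Q) = restrict (\<sigma>' \<circ> image \<kappa>) (facets Q)" "\<rho> \<circ> \<pi> = \<rho>' \<circ> \<pi>"
      using gh(3) p by simp_all
    have "\<sigma> G = \<sigma>' G" if G: "G \<in> facets Q" for G
    proof -
      obtain F where F: "F \<in> facets Q" "G = \<kappa> ` F" using facet_action_surj[OF iso G] by blast
      then show ?thesis using fun_cong[OF r(1), of F] by simp
    qed
    then have "\<sigma> = \<sigma>'" using ext by (intro PiE_ext) auto
    moreover have "\<rho> x = \<rho>' x" for x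
      using fun_cong[OF r(2), of "inv \<pi> x"] permutes_surj[OF perm] by (simp add: surj_f_inv_f)
    then have "\<rho> = \<rho>'" by blast
    ultimately show "g = h" using p by simp
  qed
  moreover from calculation have "?f ` action_pairs \<subseteq> action_pairs" by (intro image_subsetI)
  ultimately show ?thesis
    unfolding bij_betw_def using endo_inj_surj[OF finite_action_pairs, of ?f] by blast
qed

definition base_point :: "nat set set \<Rightarrow> 'a" where
  "base_point M = (SOME y. y \<in> Q \<and> p y = char_vec M)"

lemma base_point:
  assumes "M \<in> matchings l n" shows "base_point M \<in> Q" "p (base_point M) = char_vec M"
proof -
  have "char_vec M \<in> match_polytope l n" using assms by (auto simp: match_polytope_def hull_inc)
  then have "\<exists>y. y \<in> Q \<and> p y = char_vec M" unfolding p_Q[symmetric] by auto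
  then have "base_point M \<in> Q \<and> p (base_point M) = char_vec M" unfolding base_point_def by (rule someI_ex)
  then show "base_point M \<in> Q" "p (base_point M) = char_vec M" by auto
qed

text \<open>Pull the base point over the image matching back along a lift. The resulting point
  depends on the lift, but its slacks depend only on the pair, which is why an average over finitely
  many pairs suffices.\<close>

lemma pulled_back_point:
  assumes M: "M \<in> matchings l n" and g: "(\<sigma>, \<pi>) \<in> action_pairs"
  shows "\<exists>z\<in>Q. p z = char_vec M \<and> (\<forall>F\<in>facets Q. slack F z = slack (\<sigma> F) (base_point ((`) \<pi> ` M)))"
proof -
  obtain \<kappa> where k: "lifts \<kappa> \<pi>" "\<sigma> = facet_action \<kappa>" using g by (auto simp: action_pairs_def)
  have iso: "isometry \<kappa>" and perm: "\<pi> permutes {1..n}" using k(1) by (auto simp: lifts_def)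
  have M': "(`) \<pi> ` M \<in> matchings l n" by (rule image_matching[OF perm M])
  obtain z where z: "z \<in> Q" "base_point ((`) \<pi> ` M) = \<kappa> z"
    using isometry_surj[OF iso base_point(1)[OF M']] by blast
  have "node_action \<pi> (p z) = p (\<kappa> z)" using k(1) z(1) by (simp add: lifts_def)
  also have "\<dots> = char_vec ((`) \<pi> ` M)" using base_point(2)[OF M'] z(2) by simp
  also have "\<dots> = node_action \<pi> (char_vec M)" using node_action_char_vec[OF perm finite_matching[OF M]] by simp
  finally have "p z = char_vec M" by (rule node_action_inj[OF perm])
  moreover have "slack F z = slack (\<sigma> F) (base_point ((`) \<pi> ` M))" if "F \<in> facets Q" for F
    using slack_equivariant[OF iso that z(1)] z(2) that k(2) by (simp add: facet_action_def)
  ultimately show ?thesis using z(1) by blast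
qed

definition facet_value :: "'a set \<Rightarrow> nat set set \<Rightarrow> real" where
  "facet_value F M = (\<Sum>(\<sigma>, \<pi>)\<in>action_pairs. slack (\<sigma> F) (base_point ((`) \<pi> ` M)))"

text \<open>The average of the pulled back points is a convex combination, so it stays in
  \<open>Q\<close> and above the same vertex, and the affine slacks average along. The invariance is
  recorded in the slack values, not in the points.\<close>

lemma equivariant_section:
  "\<exists>y. \<forall>M\<in>matchings l n. y M \<in> Q \<and> p (y M) = char_vec M
    \<and> (\<forall>F\<in>facets Q. slack F (y M) = facet_value F M / real (card action_pairs))"
proof (rule bchoice, rule ballI)
  fix M assume M: "M \<in> matchings l n"
  define c where "c = 1 / real (card action_pairs)"
  have cp: "0 < card action_pairs" using finite_action_pairs action_pairs_nonempty by (simp add: card_gt_0_iff)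
  have sc: "(\<Sum>g\<in>action_pairs. c) = 1" using cp by (simp add: c_def)
  have "\<forall>g\<in>action_pairs. \<exists>z. z \<in> Q \<and> p z = char_vec M
      \<and> (\<forall>F\<in>facets Q. slack F z = slack (fst g F) (base_point ((`) (snd g) ` M)))"
    using pulled_back_point[OF M] by force
  from bchoice[OF this] obtain z where z: "\<And>g. g \<in> action_pairs \<Longrightarrow> z g \<in> Q" "\<And>g. g \<in> action_pairs \<Longrightarrow> p (z g) = char_vec M"
      "\<And>g F. g \<in> action_pairs \<Longrightarrow> F \<in> facets Q \<Longrightarrow> slack F (z g) = slack (fst g F) (base_point ((`) (snd g) ` M))"
    by blast
  define y where "y = (\<Sum>g\<in>action_pairs. c *\<^sub>R z g)"
  have "y \<in> Q" unfolding y_def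
    using finite_action_pairs convex_Q sc z(1) by (intro convex_sum) (auto simp: c_def)
  moreover have "p y = (\<Sum>g\<in>action_pairs. c *\<^sub>R char_vec M)"
    unfolding y_def affine_map_sum[OF affine_p sc] using z(2) by (intro sum.cong) auto
  then have "p y = char_vec M" by (simp only: scaleR_sum_left[symmetric] sc scaleR_one)
  moreover have "slack F y = facet_value F M / real (card action_pairs)" if F: "F \<in> facets Q" for F
  proof -
    have "slack F y = (\<Sum>g\<in>action_pairs. c *\<^sub>R slack F (z g))"
      unfolding y_def by (rule affine_map_sum[OF slack_affine[OF F] sc])
    also have "\<dots> = c * facet_value F M"
      unfolding facet_value_def sum_distrib_left using z(3)[OF _ F] by (intro sum.cong) (auto simp: split_def)
    finally show ?thesis by (simp add: c_def)
  qed
  ultimately show "\<exists>y. y \<in> Q \<and> p y = char_vec M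
    \<and> (\<forall>F\<in>facets Q. slack F y = facet_value F M / real (card action_pairs))" by blast
qed

lemma facet_value_equivariant:
  assumes k: "lifts \<kappa> \<pi>" and F: "F \<in> facets Q"
  shows "facet_value (\<kappa> ` F) ((`) \<pi> ` M) = facet_value F M"
proof -
  let ?f = "\<lambda>(\<sigma>, \<rho>). (restrict (\<sigma> \<circ> image \<kappa>) (facets Q), \<rho> \<circ> \<pi>)"
  have "facet_value F M = (\<Sum>g\<in>action_pairs. (\<lambda>(\<sigma>, \<rho>). slack (\<sigma> F) (base_point ((`) \<rho> ` M))) (?f g))"
    unfolding facet_value_def
    by (rule sum.reindex_bij_betw[OF action_pairs_translate[OF k], symmetric])
  also have "\<dots> = facet_value (\<kappa> ` F) ((`) \<pi> ` M)"
    unfolding facet_value_def using F by (intro sum.cong refl) (auto simp: image_comp image_image)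
  finally show ?thesis by simp
qed

text \<open>Fixes the function \<open>facet_value F\<close> on matchings rather than the facet
  \<open>F\<close>: different lifts of one node permutation may move the facets differently, whereas
  its action on functions of matchings is well defined.\<close>

definition stabilizer :: "'a set \<Rightarrow> (nat \<Rightarrow> nat) set" where
  "stabilizer F = {\<pi>. \<pi> permutes {1..n} \<and> (\<forall>M\<in>matchings l n. facet_value F ((`) \<pi> ` M) = facet_value F M)}"

lemma stabilizer_group: "permutation_group {1..n} (stabilizer F)"
proof
  fix u v assume u: "u \<in> stabilizer F"
  then have pu: "u permutes {1..n}" by (simp add: stabilizer_def)
  then show "u permutes {1..n}" .
  have "facet_value F ((`) (inv u) ` M) = facet_value F M" if M: "M \<in> matchings l n" for M
  proof -
    have "(`) (inv u) ` M \<in> matchings l n" using pu M by (intro image_matching permutes_inv)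
    then have "facet_value F ((`) u ` (`) (inv u) ` M) = facet_value F ((`) (inv u) ` M)"
      using u by (auto simp: stabilizer_def)
    moreover have "(`) u ` (`) (inv u) ` M = M"
      using permutes_surj[OF pu] by (simp add: image_image surj_f_inv_f)
    ultimately show ?thesis by simp
  qed
  then show "inv u \<in> stabilizer F" using pu by (simp add: stabilizer_def permutes_inv)
  assume v: "v \<in> stabilizer F"
  have "facet_value F ((`) (u \<circ> v) ` M) = facet_value F M" if M: "M \<in> matchings l n" for M
  proof -
    have "(`) v ` M \<in> matchings l n" using v M by (intro image_matching) (auto simp: stabilizer_def)
    moreover have "(`) (u \<circ> v) ` M = (`) u ` (`) v ` M" by (simp add: image_image image_comp)
    ultimately show ?thesis using u v M by (simp add: stabilizer_def)
  qed
  then show "u \<circ> v \<in> stabilizer F" using u v by (auto simp: stabilizer_def intro: permutes_compose)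
qed (auto simp: stabilizer_def permutes_id)

text \<open>Every translate of \<open>facet_value F\<close> is \<open>facet_value G\<close> for some
  facet \<open>G\<close>, so there are at most as many translates as facets; permutations assigned
  the same \<open>G\<close> lie in one coset of the stabilizer.\<close>

lemma stabilizer_index:
  assumes F: "F \<in> facets Q"
  shows "fact n \<le> card (facets Q) * card (stabilizer F)"
proof -
  define P where "P = {\<pi>. \<pi> permutes {1..n}}"
  have fP: "finite P" by (simp add: P_def finite_permutations)
  have "\<forall>\<pi>\<in>P. \<exists>G. G \<in> facets Q \<and> (\<forall>M. facet_value F ((`) \<pi> ` M) = facet_value G M)"
  proof
    fix \<pi> assume "\<pi> \<in> P"
    then obtain \<kappa> where k: "lifts \<kappa> \<pi>" using exists_lift by (auto simp: P_def)
    then have "isometry \<kappa>" by (simp add: lifts_def)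
    then obtain G where G: "G \<in> facets Q" "F = \<kappa> ` G" using facet_action_surj[OF _ F] by blast
    then show "\<exists>G. G \<in> facets Q \<and> (\<forall>M. facet_value F ((`) \<pi> ` M) = facet_value G M)"
      using facet_value_equivariant[OF k G(1)] by blast
  qed
  from bchoice[OF this] obtain h where h: "\<And>\<pi>. \<pi> \<in> P \<Longrightarrow> h \<pi> \<in> facets Q"
      "\<And>\<pi> M. \<pi> \<in> P \<Longrightarrow> facet_value F ((`) \<pi> ` M) = facet_value (h \<pi>) M" by blast
  have fibre: "card {\<pi> \<in> P. h \<pi> = G} \<le> card (stabilizer F)" if G: "G \<in> h ` P" for G
  proof -
    obtain \<rho> where \<rho>: "\<rho> \<in> P" "h \<rho> = G" using G by blast
    have p\<rho>: "\<rho> permutes {1..n}" using \<rho>(1) by (simp add: P_def)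
    have "inj_on (\<lambda>\<pi>. \<pi> \<circ> inv \<rho>) {\<pi> \<in> P. h \<pi> = G}"
    proof (rule inj_onI)
      fix a b assume "a \<circ> inv \<rho> = b \<circ> inv \<rho>"
      then have "a (inv \<rho> (\<rho> x)) = b (inv \<rho> (\<rho> x))" for x by (metis comp_apply)
      then show "a = b" using permutes_inj[OF p\<rho>] by (simp add: fun_eq_iff)
    qed
    moreover have "(\<lambda>\<pi>. \<pi> \<circ> inv \<rho>) ` {\<pi> \<in> P. h \<pi> = G} \<subseteq> stabilizer F"
    proof clarify
      fix \<pi> assume \<pi>: "\<pi> \<in> P" "G = h \<pi>"
      have "facet_value F ((`) (\<pi> \<circ> inv \<rho>) ` M) = facet_value F M" for M
      proof -
        have "(`) (\<pi> \<circ> inv \<rho>) ` M = (`) \<pi> ` (`) (inv \<rho>) ` M" by (simp add: image_image image_comp)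
        then have "facet_value F ((`) (\<pi> \<circ> inv \<rho>) ` M) = facet_value G ((`) (inv \<rho>) ` M)"
          using h(2)[OF \<pi>(1)] \<pi>(2) by simp
        also have "\<dots> = facet_value F ((`) \<rho> ` (`) (inv \<rho>) ` M)" using h(2)[OF \<rho>(1)] \<rho>(2) by simp
        also have "(`) \<rho> ` (`) (inv \<rho>) ` M = M" using permutes_surj[OF p\<rho>] by (simp add: image_image surj_f_inv_f)
        finally show ?thesis .
      qed
      then show "\<pi> \<circ> inv \<rho> \<in> stabilizer F"
        using \<pi>(1) p\<rho> by (auto simp: stabilizer_def P_def intro: permutes_compose permutes_inv)
    qed
    moreover have "finite (stabilizer F)"
      by (rule finite_subset[OF _ fP]) (auto simp: stabilizer_def P_def)
    ultimately show ?thesis by (rule card_inj_on_le)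
  qed
  have "fact n = card P" using card_permutations[of "{1..n}" n] by (simp add: P_def)
  also have "\<dots> \<le> card (h ` P) * card (stabilizer F)" by (rule card_le_fibers[OF fP fibre])
  also have "\<dots> \<le> card (facets Q) * card (stabilizer F)"
    using h(1) finite_facets by (intro mult_right_mono card_mono) auto
  finally show ?thesis .
qed

end

context symmetric_matching_extension
begin

lemma facet_value_junta:
  assumes F: "F \<in> facets Q" and small: "card (facets Q) < (n choose k)"
    and k: "k < l" "4 * k \<le> n" and large: "120 * 2 ^ 240 \<le> n"
  shows "\<exists>W\<subseteq>{1..n}. card W \<le> k \<and>
    (\<forall>M\<in>matchings l n. \<forall>\<pi>. \<pi> permutes ({1..n} - W) \<longrightarrow> facet_value F ((`) \<pi> ` M) = facet_value F M)"
proof -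
  interpret U: permutation_group "{1..n}" "stabilizer F" by (rule stabilizer_group)
  have "\<exists>W\<subseteq>{1..n}. card W \<le> k \<and> (\<forall>a b c. {a, b, c} \<subseteq> {1..n} - W \<longrightarrow> distinct [a, b, c] \<longrightarrow> cyc3 a b c \<in> stabilizer F)"
    by (rule U.small_index) (use stabilizer_index[OF F] small k(2) large in simp_all)
  then obtain W where W: "W \<subseteq> {1..n}" "card W \<le> k"
      "\<And>a b c. {a, b, c} \<subseteq> {1..n} - W \<Longrightarrow> distinct [a, b, c] \<Longrightarrow> cyc3 a b c \<in> stabilizer F" by blast
  have "facet_value F ((`) \<pi> ` M) = facet_value F M"
    if M: "M \<in> matchings l n" and \<pi>: "\<pi> permutes ({1..n} - W)" for M \<pi>
  proof -
    have pM: "pairwise disjnt M" "card M = l" "M \<subseteq> complete_edges n" using M by (auto simp: matchings_def)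
    have "finite W" using W(1) finite_subset by blast
    \<comment> \<open>At most \<open>k\<close> edges touch \<open>W\<close> and
      \<open>k < l\<close>, so one edge misses it; this is the edge on which
      \<open>invariant_off\<close> relies for odd permutations.\<close>
    then have "card {e \<in> M. e \<inter> W \<noteq> {}} < card M"
      using card_touching[OF pM(1)] W(2) k(1) pM(2) by fastforce
    then have "{e \<in> M. e \<inter> W \<noteq> {}} \<noteq> M" by (metis less_irrefl)
    then obtain e where e: "e \<in> M" "e \<inter> W = {}" by blast
    obtain v w where vw: "e = {v, w}" "v \<in> {1..n}" "w \<in> {1..n}" "v \<noteq> w"
      using e(1) pM(3) unfolding complete_edges_def by blast
    then have e2: "e \<subseteq> {1..n} - W" "card e = 2" using e(2) by auto
    show ?thesis
    proof (rule U.invariant_off[where s = "facet_value F" and \<M> = "matchings l n", OF W(3) _ _ _ M e(1) e2 \<pi>])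
      show "facet_value F ((`) u ` N) = facet_value F N" if "u \<in> stabilizer F" "N \<in> matchings l n" for u N
        using that by (simp add: stabilizer_def)
      show "(`) \<rho> ` N \<in> matchings l n" if "\<rho> permutes {1..n}" "N \<in> matchings l n" for \<rho> N
        using that by (rule image_matching)
      show "pairwise disjnt N" if "N \<in> matchings l n" for N using that by (simp add: matchings_def)
    qed
  qed
  then show ?thesis using W(1,2) by blast
qed

end

section \<open>Perfect matchings with the same edges at few nodes\<close>

lemma (in bipartition) card_inX_le:
  assumes "pairwise disjnt M" shows "2 * card (M \<inter> inX) \<le> card X"
proof -
  have "pairwise disjnt (M \<inter> inX)" using assms by (rule pairwise_subset) simp
  then have "card (\<Union> (M \<inter> inX) \<inter> X) = 2 * card (M \<inter> inX \<inter> inX) + card (M \<inter> inX \<inter> crossing)"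
    by (intro card_split) auto
  moreover have "card (\<Union> (M \<inter> inX) \<inter> X) \<le> card X" using finite_X by (intro card_mono) auto
  ultimately show ?thesis by (simp add: Int_assoc)
qed

lemma (in bipartition) card_PM_member:
  assumes "M \<in> PM i" shows "card M = card X"
proof -
  have fM: "finite M" by (rule finite_mem_PM[OF assms])
  have "M = (M \<inter> inX) \<union> (M \<inter> inY) \<union> (M \<inter> crossing)" using assms by (auto simp: PM_def)
  then have "card M = card ((M \<inter> inX) \<union> (M \<inter> inY) \<union> (M \<inter> crossing))" by simp
  also have "\<dots> = card (M \<inter> inX) + card (M \<inter> inY) + card (M \<inter> crossing)"
    using fM classes_disjoint by (subst card_Un_disjoint, simp, simp, blast)+ simp
  also have "card (M \<inter> crossing) = i" using assms by (simp add: PM_def)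
  finally show ?thesis using card_inner[OF assms] by linarith
qed

lemma (in bipartition) edge_subset:
  assumes "e \<in> inX \<union> inY \<union> crossing" shows "e \<subseteq> X \<union> Y \<and> card e = 2"
proof (cases "e \<in> crossing")
  case True
  then obtain x y where "e = {x, y}" "x \<in> X" "y \<in> Y" by (auto simp: crossing_def)
  moreover from this have "x \<noteq> y" using disj by blast
  ultimately show ?thesis by auto
next
  case False
  then show ?thesis using assms by (auto simp: inX_def inY_def)
qed

text \<open>After removing the common edges at \<open>W\<close>, the matchings have equally many
  edges, all on nodes that avoid \<open>W\<close> and the removed edges. A permutation of these
  nodes carries one to the other and fixes everything else.\<close>

lemma (in bipartition) perfect_matching_transport:
  assumes M: "M \<in> PM i" "M' \<in> PM j"
    and tr: "{e \<in> M. e \<inter> W \<noteq> {}} = {e \<in> M'. e \<inter> W \<noteq> {}}"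
  shows "\<exists>\<pi>. \<pi> permutes (X \<union> Y - W) \<and> (`) \<pi> ` M = M'"
proof -
  define A where "A = {e \<in> M. e \<inter> W \<noteq> {}}"
  have A': "A = {e \<in> M'. e \<inter> W \<noteq> {}}" using tr by (simp add: A_def)
  define V where "V = X \<union> Y - W - \<Union> A"
  have f: "finite M" "finite M'" using M finite_mem_PM by auto
  have pw: "pairwise disjnt M" "pairwise disjnt M'" using M by (auto simp: PM_def)
  have sub: "N - A \<subseteq> {e. e \<subseteq> V \<and> card e = 2}" if N: "N \<in> PM m" "A = {e \<in> N. e \<inter> W \<noteq> {}}" for N m
  proof
    fix e assume e: "e \<in> N - A"
    have "e \<in> inX \<union> inY \<union> crossing" using e N(1) by (auto simp: PM_def)
    then have 1: "e \<subseteq> X \<union> Y" "card e = 2" using edge_subset by auto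
    have 2: "e \<inter> W = {}" using e N(2) by blast
    have "e \<inter> f = {}" if "f \<in> A" for f
    proof -
      have "f \<in> N" "e \<in> N" "e \<noteq> f" using e that N(2) by auto
      then show ?thesis using N(1) pairwiseD[of disjnt N e f] by (auto simp: PM_def disjnt_def)
    qed
    then have "e \<inter> \<Union> A = {}" by blast
    then show "e \<in> {e. e \<subseteq> V \<and> card e = 2}" using 1 2 by (auto simp: V_def)
  qed
  have AM: "A \<subseteq> M" "A \<subseteq> M'" using A' by (auto simp: A_def)
  have fA: "finite A" using AM(1) f(1) finite_subset by blast
  have "card (M - A) = card (M' - A)"
    using card_PM_member[OF M(1)] card_PM_member[OF M(2)] AM fA by (simp add: card_Diff_subset)
  then have "\<exists>\<pi>. \<pi> permutes V \<and> (`) \<pi> ` (M - A) = M' - A"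
    using f finite_X finite_Y sub[OF M(1) A_def] sub[OF M(2) A'] pw
    by (intro matching_transport) (auto simp: V_def intro: pairwise_subset)
  then obtain \<pi> where \<pi>: "\<pi> permutes V" "(`) \<pi> ` (M - A) = M' - A" by blast
  have "\<pi> ` e = e" if "e \<in> A" for e
  proof -
    have "\<pi> z = z" if "z \<in> e" for z
      using permutes_not_in[OF \<pi>(1), of z] that \<open>e \<in> A\<close> by (auto simp: V_def)
    then show ?thesis by force
  qed
  then have "(`) \<pi> ` A = A" by simp
  moreover have "M = (M - A) \<union> A" "M' = (M' - A) \<union> A" using AM by auto
  ultimately have "(`) \<pi> ` M = M'" using \<pi>(2) by (metis image_Un)
  moreover have "\<pi> permutes (X \<union> Y - W)" using \<pi>(1) by (rule permutes_subset) (auto simp: V_def)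
  ultimately show ?thesis by blast
qed

section \<open>Extrapolation to a point violating an odd set inequality\<close>

context symmetric_matching_extension
begin

theorem facets_lower_bound:
  assumes k: "k = (l - 1) div 2" "1 \<le> k" and n: "2 * l \<le> n" and large: "120 * 2 ^ 240 \<le> n"
  shows "n choose k \<le> card (facets Q)"
proof (rule ccontr)
  assume "\<not> ?thesis"
  then have small: "card (facets Q) < (n choose k)" by simp
  define X Y where "X = {1..2 * k + 1}" and "Y = {2 * k + 2..4 * k + 2}"
  interpret bipartition X Y by unfold_locales (auto simp: X_def Y_def)
  have cX: "card X = 2 * k + 1" by (simp add: X_def)
  \<comment> \<open>A perfect matching of \<open>X \<union> Y\<close> has \<open>2 * k + 1\<close>
    edges; when \<open>l = 2 * k + 2\<close>, one fixed edge outside is added to all of them. Its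
    ends reach up to \<open>4 * k + 4 = 2 * l\<close>, which is within \<open>n\<close>.\<close>
  define E0 :: "nat set set" where "E0 = (if l = 2 * k + 1 then {} else {{4 * k + 3, 4 * k + 4}})"
  have l: "l = 2 * k + 1 \<or> l = 2 * k + 2" using k by linarith
  have n4: "4 * k + 2 \<le> n" "l \<noteq> 2 * k + 1 \<Longrightarrow> 4 * k + 4 \<le> n" using n l by auto
  have E0: "e \<inter> (X \<union> Y) = {}" "e \<in> complete_edges n" if "e \<in> E0" for e
  proof -
    have e: "e = {4 * k + 3, 4 * k + 4}" "4 * k + 4 \<le> n"
      using that n4(2) by (auto simp: E0_def split: if_splits)
    then show "e \<inter> (X \<union> Y) = {}" by (auto simp: X_def Y_def)
    have "4 * k + 3 \<in> {1..n}" "4 * k + 4 \<in> {1..n}" "4 * k + 3 \<noteq> 4 * k + 4" using e(2) by auto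
    then show "e \<in> complete_edges n" unfolding complete_edges_def e(1) by blast
  qed
  have XYn: "X \<union> Y \<subseteq> {1..n}" using n4 by (auto simp: X_def Y_def)
  have edges: "inX \<union> inY \<union> crossing \<subseteq> complete_edges n"
  proof
    fix e assume "e \<in> inX \<union> inY \<union> crossing"
    then have e: "e \<subseteq> {1..n}" "card e = 2" using edge_subset XYn by blast+
    then obtain v w where "e = {v, w}" "v \<noteq> w" by (auto simp: card_2_iff)
    then show "e \<in> complete_edges n" using e(1) unfolding complete_edges_def by auto
  qed
  have MM: "M \<union> E0 \<in> matchings l n" "M \<inter> E0 = {}" if M: "M \<in> PM i" for M i
  proof -
    have p: "M \<subseteq> inX \<union> inY \<union> crossing" "pairwise disjnt M" "\<Union> M = X \<union> Y" using M by (auto simp: PM_def)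
    have dj: "disjnt e f" if "e \<in> M" "f \<in> E0" for e f
      using E0(1)[OF that(2)] p(3) that(1) by (auto simp: disjnt_def)
    then have "pairwise disjnt (M \<union> E0)"
      using p(2) by (intro pairwise_disjnt_Un) (auto simp: E0_def)
    moreover show disj0: "M \<inter> E0 = {}"
    proof (rule ccontr)
      assume "M \<inter> E0 \<noteq> {}"
      then obtain e where "e \<in> M" "e \<in> E0" by blast
      then have "e = {}" using dj[of e e] by (simp add: disjnt_def)
      then show False using edge_subset[of e] p(1) \<open>e \<in> M\<close> by auto
    qed
    then have "card (M \<union> E0) = card M + card E0"
      using finite_mem_PM[OF M] by (intro card_Un_disjoint) (auto simp: E0_def)
    then have "card (M \<union> E0) = l" using card_PM_member[OF M] cX l by (auto simp: E0_def)
    ultimately show "M \<union> E0 \<in> matchings l n"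
      using p(1) edges E0(2) by (auto simp: matchings_def)
  qed
  \<comment> \<open>An even number \<open>2 k + 1 - i\<close> of nodes of \<open>X\<close> is
    matched inside \<open>X\<close>, so \<open>i\<close> is odd; all \<open>k + 1\<close> odd values
    are taken, one more than the degree.\<close>
  define I where "I = (\<lambda>j. 2 * j + 1) ` {..k}"
  have fI: "finite I" by (simp add: I_def)
  have cI: "card I = Suc k" by (simp add: I_def card_image inj_on_def)
  have ne: "PM i \<noteq> {}" if "i \<in> I" for i
  proof -
    obtain j where "i = 2 * j + 1" "j \<le> k" using \<open>i \<in> I\<close> by (auto simp: I_def)
    then show ?thesis by (intro PM_nonempty) (simp_all add: cX)
  qed
  have "card (real ` I) = Suc k" using cI by (simp add: card_image)
  then obtain b0 where b0: "\<forall>q. degree q \<le> k \<longrightarrow> (\<Sum>x\<in>real ` I. b0 x * poly q x) = poly q 0"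
    using lagrange_weights[of "real ` I" k] fI by auto
  define b where "b = (\<lambda>i. b0 (real i))"
  have b: "(\<Sum>i\<in>I. b i * poly q (real i)) = poly q 0" if "degree q \<le> k" for q
    using b0 that by (simp add: b_def sum.reindex)
  define J where "J = Sigma I PM"
  \<comment> \<open>Uniform average over \<open>PM i\<close>, times the extrapolation weight of
    \<open>i\<close>. The total is 1 because the weights reproduce the constant polynomial.\<close>
  define c where "c = (\<lambda>(i, M :: nat set set). b i / real (card (PM i)))"
  have sumJ: "(\<Sum>z\<in>J. c z * f (snd z)) = (\<Sum>i\<in>I. b i / real (card (PM i)) * (\<Sum>M\<in>PM i. f M))" for f :: "nat set set \<Rightarrow> real"
  proof -
    have "(\<Sum>z\<in>J. c z * f (snd z)) = (\<Sum>(i, M)\<in>Sigma I PM. b i / real (card (PM i)) * f M)"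
      unfolding J_def c_def by (intro sum.cong) auto
    also have "\<dots> = (\<Sum>i\<in>I. \<Sum>M\<in>PM i. b i / real (card (PM i)) * f M)"
      using fI finite_PM by (intro sum.Sigma[symmetric]) auto
    finally show ?thesis by (simp only: sum_distrib_left)
  qed
  have cp: "real (card (PM i)) \<noteq> 0" if "i \<in> I" for i using ne[OF that] finite_PM by simp
  have sc: "sum c J = 1"
  proof -
    have "sum c J = (\<Sum>z\<in>J. c z * 1)" by simp
    also have "\<dots> = (\<Sum>i\<in>I. b i / real (card (PM i)) * (\<Sum>M\<in>PM i. 1))" by (rule sumJ)
    also have "\<dots> = (\<Sum>i\<in>I. b i * poly 1 (real i))" using cp by (intro sum.cong) auto
    finally show ?thesis using b[of 1] by simp
  qed
  obtain y where y: "\<And>M. M \<in> matchings l n \<Longrightarrow> y M \<in> Q" "\<And>M. M \<in> matchings l n \<Longrightarrow> p (y M) = char_vec M"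
      "\<And>M F. M \<in> matchings l n \<Longrightarrow> F \<in> facets Q \<Longrightarrow> slack F (y M) = facet_value F M / real (card action_pairs)"
    using equivariant_section by blast
  have Jm: "snd z \<union> E0 \<in> matchings l n" if "z \<in> J" for z using that MM by (auto simp: J_def)
  define ys where "ys = (\<Sum>z\<in>J. c z *\<^sub>R y (snd z \<union> E0))"
  have "ys \<in> Q"
  proof (rule slack_complete)
    show "ys \<in> L" unfolding ys_def using y(1)[OF Jm] Q_L
      by (intro subspace_sum[OF subspace_L] subspace_scale[OF subspace_L]) blast
    show "h ys = 0" if h: "h \<in> H" "h \<notin> Hp" for h
    proof -
      have "h ys = (\<Sum>z\<in>J. c z *\<^sub>R h (y (snd z \<union> E0)))"
        unfolding ys_def by (rule affine_map_sum[OF affine_H[OF h(1)] sc])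
      also have "\<dots> = 0" using not_Hp[OF h] y(1)[OF Jm] by (intro sum.neutral) simp
      finally show ?thesis .
    qed
    fix F assume F: "F \<in> facets Q"
    define s where "s = (\<lambda>M. slack F (y (M \<union> E0)))"
    \<comment> \<open>The set \<open>W\<close> depends on the facet \<open>F\<close>, but the
      coefficients do not: the one point \<open>ys\<close> is tested against all facets.\<close>
    obtain W where W: "W \<subseteq> {1..n}" "card W \<le> k"
        "\<And>M \<pi>. M \<in> matchings l n \<Longrightarrow> \<pi> permutes ({1..n} - W) \<Longrightarrow> facet_value F ((`) \<pi> ` M) = facet_value F M"
      using facet_value_junta[OF F small _ _ large] l n4 by auto
    have "slack F ys = (\<Sum>z\<in>J. c z *\<^sub>R slack F (y (snd z \<union> E0)))"
      unfolding ys_def by (rule affine_map_sum[OF slack_affine[OF F] sc])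
    also have "\<dots> = (\<Sum>z\<in>J. c z * s (snd z))" by (simp add: s_def)
    also have "\<dots> = (\<Sum>i\<in>I. b i / real (card (PM i)) * (\<Sum>M\<in>PM i. s M))" by (rule sumJ)
    also have "0 \<le> \<dots>"
    proof (rule junta_average_nonneg)
      show "finite W" using W(1) finite_subset by blast
      show "card W \<le> k" by (rule W(2))
      show "finite I" by (rule fI)
      show "0 \<le> s M" if "M \<in> PM i" for i M
        unfolding s_def using y(1)[OF MM(1)[OF that]] by (rule slack_nonneg[OF F])
      fix i j M M' assume M: "M \<in> PM i" "M' \<in> PM j"
        "{e \<in> M. e \<inter> W \<noteq> {}} = {e \<in> M'. e \<inter> W \<noteq> {}}"
      obtain \<pi> where \<pi>: "\<pi> permutes (X \<union> Y - W)" "(`) \<pi> ` M = M'"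
        using perfect_matching_transport[OF M] by blast
      have "\<pi> ` e = e" if "e \<in> E0" for e
      proof -
        have "\<pi> z = z" if "z \<in> e" for z
          using permutes_not_in[OF \<pi>(1), of z] E0(1)[OF \<open>e \<in> E0\<close>] that by blast
        then show ?thesis by force
      qed
      then have "(`) \<pi> ` (M \<union> E0) = M' \<union> E0" using \<pi>(2) by (simp add: image_Un)
      moreover have "\<pi> permutes ({1..n} - W)" using \<pi>(1) by (rule permutes_subset) (use XYn in blast)
      ultimately have "facet_value F (M' \<union> E0) = facet_value F (M \<union> E0)"
        using W(3)[OF MM(1)[OF M(1)], of \<pi>] by simp
      then show "s M = s M'" using y(3)[OF MM(1)[OF M(1)] F] y(3)[OF MM(1)[OF M(2)] F] by (simp add: s_def)
    qed (use ne b in auto)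
    finally show "0 \<le> slack F ys" .
  qed
  then have inP: "p ys \<in> match_polytope l n" using p_Q by blast
  \<comment> \<open>The left-hand side of the odd set inequality: a matching has at most
    \<open>k\<close> edges inside the \<open>2 * k + 1\<close> nodes of \<open>X\<close>.\<close>
  define \<phi> where "\<phi> = (\<lambda>x :: nat set \<Rightarrow>\<^sub>0 real. \<Sum>e\<in>inX. Poly_Mapping.lookup x e)"
  have lin: "linear \<phi>"
    by (rule linearI) (simp_all add: \<phi>_def lookup_add lookup_scaleR sum.distrib sum_distrib_left)
  have finX: "finite inX" using finite_edges by simp
  have \<phi>_char: "\<phi> (char_vec M) = real (card (M \<inter> inX))" if "finite M" for M
    using that finX by (simp add: \<phi>_def lookup_char_vec sum.If_cases Int_commute)
  have "convex {x. \<phi> x \<le> real k}"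
  proof -
    have "{x. \<phi> x \<le> real k} = \<phi> -` {..real k}" by auto
    then show ?thesis using convex_linear_vimage[OF lin, of "{..real k}"] by simp
  qed
  moreover have "char_vec ` matchings l n \<subseteq> {x. \<phi> x \<le> real k}"
  proof clarify
    fix M assume M: "M \<in> matchings l n"
    then have "pairwise disjnt M" by (simp add: matchings_def)
    then have "card (M \<inter> inX) \<le> k" using card_inX_le[of M] cX by linarith
    then show "\<phi> (char_vec M) \<le> real k" using \<phi>_char[OF finite_matching[OF M]] by simp
  qed
  ultimately have "match_polytope l n \<subseteq> {x. \<phi> x \<le> real k}"
    unfolding match_polytope_def by (rule hull_minimal[rotated])
  then have le: "\<phi> (p ys) \<le> real k" using inP by blast
  have "p ys = (\<Sum>z\<in>J. c z *\<^sub>R p (y (snd z \<union> E0)))"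
    unfolding ys_def by (rule affine_map_sum[OF affine_p sc])
  also have "\<dots> = (\<Sum>z\<in>J. c z *\<^sub>R char_vec (snd z \<union> E0))"
    using y(2)[OF Jm] by (intro sum.cong) auto
  finally have "\<phi> (p ys) = (\<Sum>z\<in>J. c z * \<phi> (char_vec (snd z \<union> E0)))"
    by (simp add: linear_sum[OF lin] linear_scale[OF lin])
  also have "\<dots> = (\<Sum>i\<in>I. b i / real (card (PM i)) * (\<Sum>M\<in>PM i. \<phi> (char_vec (M \<union> E0))))"
    by (rule sumJ)
  also have "\<dots> = (\<Sum>i\<in>I. b i * poly [:real (2 * k + 1) / 2, - 1 / 2:] (real i))"
  proof (rule sum.cong[OF refl])
    fix i assume i: "i \<in> I"
    have "\<phi> (char_vec (M \<union> E0)) = (real (2 * k + 1) - real i) / 2" if M: "M \<in> PM i" for M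
    proof -
      have "E0 \<inter> inX = {}"
      proof (rule ccontr)
        assume "E0 \<inter> inX \<noteq> {}"
        then obtain e where e: "e \<in> E0" "e \<in> inX" by blast
        then have "e \<subseteq> X" "card e = 2" by (auto simp: inX_def)
        then have "e = {}" using E0(1)[OF e(1)] by auto
        then show False using \<open>card e = 2\<close> by simp
      qed
      then have "(M \<union> E0) \<inter> inX = M \<inter> inX" by auto
      moreover have "finite (M \<union> E0)" by (rule finite_matching[OF MM(1)[OF M]])
      ultimately have "\<phi> (char_vec (M \<union> E0)) = real (card (M \<inter> inX))" using \<phi>_char by simp
      then show ?thesis using card_inner(1)[OF M] cX by (simp add: field_simps)
    qed
    then have "(\<Sum>M\<in>PM i. \<phi> (char_vec (M \<union> E0))) = (\<Sum>M\<in>PM i. (real (2 * k + 1) - real i) / 2)"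
      by (rule sum.cong[OF refl])
    then have "(\<Sum>M\<in>PM i. \<phi> (char_vec (M \<union> E0))) = real (card (PM i)) * ((real (2 * k + 1) - real i) / 2)"
      by (simp only: sum_constant)
    moreover have "poly [:real (2 * k + 1) / 2, - 1 / 2:] (real i) = (real (2 * k + 1) - real i) / 2"
      by (simp add: field_simps)
    moreover have "x / N * (N * t) = x * t" if "N \<noteq> 0" for x N t :: real
      using that by simp
    ultimately show "b i / real (card (PM i)) * (\<Sum>M\<in>PM i. \<phi> (char_vec (M \<union> E0)))
        = b i * poly [:real (2 * k + 1) / 2, - 1 / 2:] (real i)"
      using cp[OF i] by (simp only:)
  qed
  \<comment> \<open>The number of edges inside \<open>X\<close> is linear in \<open>i\<close>, and
    its value at 0 is \<open>k + 1/2\<close>. Degree 1 must not exceed \<open>k\<close>, which is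
    where \<open>1 \<le> k\<close> enters.\<close>
  also have "\<dots> = real (2 * k + 1) / 2"
    using k(2) by (subst b) auto
  finally show False using le by simp
qed

end

section \<open>From coordinates to the abstract setting\<close>

lemma match_polytope_nonempty:
  assumes "2 * l \<le> n" shows "match_polytope l n \<noteq> {}"
proof -
  obtain V where V: "V \<subseteq> {1..n}" "card V = 2 * l" "finite V"
    using obtain_subset_with_card_n[of "2 * l" "{1..n}"] assms by auto
  obtain M where M: "M \<subseteq> {e. e \<subseteq> V \<and> card e = 2}" "pairwise disjnt M" "\<Union> M = V"
    using even_perfect_matching[OF V(3)] V(2) by (auto simp del: Union_eq)
  have "M \<subseteq> complete_edges n"
  proof
    fix e assume "e \<in> M"
    then have e: "e \<subseteq> {1..n}" "card e = 2" using M(1) V(1) by auto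
    then obtain v w where "e = {v, w}" "v \<noteq> w" by (auto simp: card_2_iff)
    then show "e \<in> complete_edges n" using e(1) unfolding complete_edges_def by auto
  qed
  moreover have "card M = l"
  proof -
    have "finite e" if "e \<in> M" for e
    proof -
      have "e \<subseteq> V" using that M(1) by blast
      then show ?thesis using V(3) by (rule finite_subset)
    qed
    then have "card (\<Union> M) = sum card M"
      using M(2) by (intro card_Union_disjoint) auto
    also have "\<dots> = (\<Sum>e\<in>M. 2)" using M(1) by (intro sum.cong) auto
    finally show ?thesis using M(3) V(2) by simp
  qed
  ultimately have "M \<in> matchings l n" using M(2) by (simp add: matchings_def)
  then show ?thesis by (auto simp: match_polytope_def)
qed

text \<open>Sees only the first \<open>d\<close> coordinates, so it separates the points of
  \<open>coord_space {..<d}\<close> but not those of the whole type.\<close>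

definition sq_dist :: "nat \<Rightarrow> (nat \<Rightarrow>\<^sub>0 real) \<Rightarrow> (nat \<Rightarrow>\<^sub>0 real) \<Rightarrow> real" where
  "sq_dist d x y = (\<Sum>i<d. (Poly_Mapping.lookup x i - Poly_Mapping.lookup y i)\<^sup>2)"

lemma subspace_coord_space: "subspace (coord_space I)"
proof (rule subspaceI)
  show "0 \<in> coord_space I" by (simp add: coord_space_def)
  show "x + y \<in> coord_space I" if "x \<in> coord_space I" "y \<in> coord_space I" for x y
    using that keys_add[of x y] by (auto simp: coord_space_def)
  show "c *\<^sub>R x \<in> coord_space I" if "x \<in> coord_space I" for c x
    using that by (auto simp: coord_space_def in_keys_iff lookup_scaleR)
qed

lemma sq_dist_zero:
  assumes "x \<in> coord_space {..<d}" "y \<in> coord_space {..<d}"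
  shows "sq_dist d x y = 0 \<longleftrightarrow> x = y"
proof
  assume "sq_dist d x y = 0"
  then have "\<forall>i\<in>{..<d}. (Poly_Mapping.lookup x i - Poly_Mapping.lookup y i)\<^sup>2 = 0"
    unfolding sq_dist_def by (subst (asm) sum_nonneg_eq_0_iff) auto
  then have lt: "Poly_Mapping.lookup x i = Poly_Mapping.lookup y i" if "i < d" for i
    using that by simp
  show "x = y"
  proof (rule poly_mapping_eqI)
    fix i
    show "Poly_Mapping.lookup x i = Poly_Mapping.lookup y i"
    proof (cases "i < d")
      case False
      then have "i \<notin> Poly_Mapping.keys x" "i \<notin> Poly_Mapping.keys y"
        using assms by (auto simp: coord_space_def)
      then show ?thesis by (simp add: in_keys_iff)
    qed (rule lt)
  qed
qed (simp add: sq_dist_def)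

lemma polyhedron_representation:
  assumes "polyhedron_in {..<d} Q" "Q \<noteq> {}"
  shows "\<exists>H. polyhedron_isometry (coord_space {..<d}) Q H (sq_dist d)"
proof -
  obtain H0 :: "((nat \<Rightarrow> real) \<times> real) set" where H0: "finite H0"
      "Q = {y \<in> coord_space {..<d}. \<forall>(a, b)\<in>H0. (\<Sum>i\<in>{..<d}. a i * Poly_Mapping.lookup y i) \<le> b}"
    using assms(1) by (auto simp: polyhedron_in_def)
  define form where "form = (\<lambda>(a, b) (y :: nat \<Rightarrow>\<^sub>0 real). b - (\<Sum>i<d. a i * Poly_Mapping.lookup y i))"
  define H where "H = form ` H0"
  have "polyhedron_isometry (coord_space {..<d}) Q H (sq_dist d)"
  proof
    show "Q = {y \<in> coord_space {..<d}. \<forall>h\<in>H. 0 \<le> h y}"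
      unfolding H0(2) H_def form_def by auto
    show "subspace (coord_space {..<d} :: (nat \<Rightarrow>\<^sub>0 real) set)" by (rule subspace_coord_space)
    show "finite H" using H0(1) by (simp add: H_def)
    show "Q \<noteq> {}" by (rule assms(2))
    show "0 \<le> sq_dist d x y" for x y by (simp add: sq_dist_def sum_nonneg)
    show "sq_dist d x y = 0 \<longleftrightarrow> x = y" if "x \<in> Q" "y \<in> Q" for x y
      using that H0(2) by (intro sq_dist_zero) auto
    fix h assume "h \<in> H"
    then obtain a b where h: "h = (\<lambda>y. b - (\<Sum>i<d. a i * Poly_Mapping.lookup y i))"
      by (auto simp: H_def form_def)
    have "linear (\<lambda>y. - (\<Sum>i<d. a i * Poly_Mapping.lookup y i))"
      by (rule linearI) (simp_all add: lookup_add lookup_scaleR algebra_simps sum.distrib sum_distrib_left)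
    moreover have "h = (\<lambda>y. - (\<Sum>i<d. a i * Poly_Mapping.lookup y i) + b)" by (simp add: h)
    ultimately show "affine_map h" unfolding affine_map_def by blast
    \<comment> \<open>Cauchy-Schwarz, with the squared norm of the coefficient vector as the
      bound.\<close>
    have "(h x - h y)\<^sup>2 \<le> (\<Sum>i<d. (a i)\<^sup>2) * sq_dist d x y" for x y
    proof -
      have "h x - h y = - (\<Sum>i<d. a i * (Poly_Mapping.lookup x i - Poly_Mapping.lookup y i))"
        by (simp add: h sum_subtractf algebra_simps)
      then show ?thesis unfolding sq_dist_def by (simp add: Cauchy_Schwarz_ineq_sum)
    qed
    then show "\<exists>K. \<forall>x\<in>Q. \<forall>y\<in>Q. (h x - h y)\<^sup>2 \<le> K * sq_dist d x y" by blast
  qed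
  then show ?thesis by blast
qed

text \<open>\<open>affine_isometry\<close> prescribes \<open>\<kappa>\<close> only on the coordinate
  space, while \<open>affine_map\<close> asks for affinity everywhere; the replacement is the
  defining formula read on the whole type. It preserves \<open>sq_dist\<close> because the columns
  of \<open>U\<close> are orthonormal.\<close>

lemma affine_isometry_extends:
  assumes "affine_isometry {..<d} \<kappa>"
  shows "\<exists>\<kappa>'. affine_map \<kappa>' \<and> (\<forall>y\<in>coord_space {..<d}. \<kappa>' y = \<kappa> y) \<and> (\<forall>x y. sq_dist d (\<kappa>' x) (\<kappa>' y) = sq_dist d x y)"
proof -
  obtain U u where U: "orthogonal_mat_on {..<d} U"
    and k: "\<forall>y\<in>coord_space {..<d}. \<kappa> y = (\<Sum>i\<in>{..<d}. (\<Sum>j\<in>{..<d}. U i j * Poly_Mapping.lookup y j) *\<^sub>R unit_vec_at i) + u"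
    using assms by (auto simp: affine_isometry_def)
  define g where "g = (\<lambda>y :: nat \<Rightarrow>\<^sub>0 real. \<Sum>i<d. (\<Sum>j<d. U i j * Poly_Mapping.lookup y j) *\<^sub>R unit_vec_at i)"
  have lin: "linear g"
    by (rule linearI)
      (simp_all add: g_def lookup_add lookup_scaleR distrib_left sum.distrib scaleR_left_distrib scaleR_sum_right
        sum_distrib_left mult.left_commute)
  have lk: "Poly_Mapping.lookup (g y) i = (\<Sum>j<d. U i j * Poly_Mapping.lookup y j)" if "i < d" for y i
  proof -
    have "Poly_Mapping.lookup (g y) i = (\<Sum>m<d. (\<Sum>j<d. U m j * Poly_Mapping.lookup y j) * (if m = i then 1 else 0))"
      by (simp add: g_def lookup_sum lookup_scaleR lookup_single when_def)
    then show ?thesis using that by (simp add: if_distrib cong: if_cong)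
  qed
  have "sq_dist d (g x + u) (g y + u) = sq_dist d x y" for x y
  proof -
    define z where "z = (\<lambda>j. Poly_Mapping.lookup x j - Poly_Mapping.lookup y j)"
    have "sq_dist d (g x + u) (g y + u) = (\<Sum>i<d. (\<Sum>j<d. U i j * z j)\<^sup>2)"
      unfolding sq_dist_def by (intro sum.cong refl) (simp add: lookup_add lk z_def sum_subtractf right_diff_distrib)
    also have "\<dots> = (\<Sum>i<d. \<Sum>j<d. \<Sum>m<d. z j * z m * (U i j * U i m))"
      by (simp add: power2_eq_square sum_product algebra_simps)
    also have "\<dots> = (\<Sum>j<d. \<Sum>i<d. \<Sum>m<d. z j * z m * (U i j * U i m))" by (rule sum.swap)
    also have "\<dots> = (\<Sum>j<d. \<Sum>m<d. \<Sum>i<d. z j * z m * (U i j * U i m))"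
      by (intro sum.cong refl sum.swap)
    also have "\<dots> = (\<Sum>j<d. \<Sum>m<d. z j * z m * (if j = m then 1 else 0))"
      unfolding sum_distrib_left[symmetric] using U by (intro sum.cong refl) (simp add: orthogonal_mat_on_def)
    also have "\<dots> = (\<Sum>j<d. (z j)\<^sup>2)"
      by (intro sum.cong refl) (simp add: power2_eq_square if_distrib cong: if_cong)
    finally show ?thesis by (simp add: sq_dist_def z_def)
  qed
  moreover have "affine_map (\<lambda>y. g y + u)" using lin unfolding affine_map_def by blast
  ultimately show ?thesis using k by (intro exI[of _ "\<lambda>y. g y + u"]) (simp add: g_def)
qed

lemma symmetric_extension_locale:
  assumes ext: "extension d Q p (complete_edges n) (match_polytope l n)"
    and symm: "symmetric_extension d Q p (node_symmetries n)" and l: "2 * l \<le> n"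
  shows "\<exists>H p'. symmetric_matching_extension (coord_space {..<d}) Q H (sq_dist d) p' n l"
proof -
  have Q: "polyhedron_in {..<d} Q" and pQ: "p ` Q = match_polytope l n"
    and p: "affine_map_between {..<d} (complete_edges n) p"
    using ext by (auto simp: extension_def)
  have "Q \<noteq> {}" using pQ match_polytope_nonempty[OF l] by auto
  then obtain H where "polyhedron_isometry (coord_space {..<d}) Q H (sq_dist d)"
    using polyhedron_representation[OF Q] by blast
  then interpret polyhedron_isometry "coord_space {..<d}" Q H "sq_dist d" .
  obtain f c where f: "linear f" "\<forall>y\<in>coord_space {..<d}. p y = f y + c"
    using p by (auto simp: affine_map_between_def)
  \<comment> \<open>As with the isometries, \<open>p\<close> is replaced by a map that is affine on
    the whole type and agrees with it on \<open>Q\<close>.\<close>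
  define p' where "p' = (\<lambda>y. f y + c)"
  have pp: "p' y = p y" if "y \<in> Q" for y using that f(2) Q_L by (auto simp: p'_def)
  have "symmetric_matching_extension (coord_space {..<d}) Q H (sq_dist d) p' n l"
  proof
    show "affine_map p'" using f(1) unfolding affine_map_def p'_def by blast
    show "p' ` Q = match_polytope l n" using pQ pp by (simp cong: image_cong)
    fix \<pi> assume "\<pi> permutes {1..n}"
    then have "node_action \<pi> \<in> node_symmetries n" by (auto simp: node_symmetries_def)
    then obtain \<kappa> where k: "affine_isometry {..<d} \<kappa>" "\<kappa> ` Q = Q" "\<forall>y\<in>Q. p (\<kappa> y) = node_action \<pi> (p y)"
      using symm by (auto simp: symmetric_extension_def)
    obtain \<kappa>' where k': "affine_map \<kappa>'" "\<And>y. y \<in> coord_space {..<d} \<Longrightarrow> \<kappa>' y = \<kappa> y"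
        "\<And>x y. sq_dist d (\<kappa>' x) (\<kappa>' y) = sq_dist d x y"
      using affine_isometry_extends[OF k(1)] by blast
    have eq: "\<kappa>' y = \<kappa> y" if "y \<in> Q" for y using that Q_L by (intro k'(2)) blast
    then have "\<kappa>' ` Q = Q" using k(2) by (simp cong: image_cong)
    then have "isometry \<kappa>'" using k'(1,3) by (simp add: isometry_def)
    moreover have "p' (\<kappa>' y) = node_action \<pi> (p' y)" if y: "y \<in> Q" for y
    proof -
      have "\<kappa> y \<in> Q" using k(2) y by blast
      then show ?thesis using k(3) y eq pp by simp
    qed
    ultimately show "\<exists>\<kappa>. isometry \<kappa> \<and> (\<forall>y\<in>Q. p' (\<kappa> y) = node_action \<pi> (p' y))" by blast
  qed
  then show ?thesis by blast
qed

theorem theorem17: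
  shows "\<exists>C::real. C > 0 \<and>
    (\<forall>(n::nat) (l::nat) (d::nat) (Q :: (nat \<Rightarrow>\<^sub>0 real) set)
       (p :: (nat \<Rightarrow>\<^sub>0 real) \<Rightarrow> (nat set \<Rightarrow>\<^sub>0 real)).
       1 \<le> l \<and> real l \<le> real n / 2 \<and>
       extension d Q p (complete_edges n) (match_polytope l n) \<and>
       symmetric_extension d Q p (node_symmetries n)
       \<longrightarrow> C * real (n choose ((l - 1) div 2)) \<le> real (extension_size Q))"
proof -
  define N :: nat where "N = 120 * 2 ^ 240"
  \<comment> \<open>For \<open>n \<le> N\<close> the binomial coefficient is at most
    \<open>2 ^ N\<close>, so this factor brings the bound down to 1, which every nonempty polyhedron
    meets by \<open>facets_nonempty\<close>. The same trivial bound serves \<open>k = 0\<close>,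
    where the coefficient is 1.\<close>
  define C :: real where "C = 1 / 2 ^ N"
  have C: "0 < C" "C \<le> 1" by (simp_all add: C_def)
  have "C * real (n choose ((l - 1) div 2)) \<le> real (extension_size Q)"
    if l: "1 \<le> l" "real l \<le> real n / 2"
      and ext: "extension d Q p (complete_edges n) (match_polytope l n)"
      and symm: "symmetric_extension d Q p (node_symmetries n)"
    for n l d and Q :: "(nat \<Rightarrow>\<^sub>0 real) set" and p :: "(nat \<Rightarrow>\<^sub>0 real) \<Rightarrow> (nat set \<Rightarrow>\<^sub>0 real)"
  proof -
    define k where "k = (l - 1) div 2"
    have ln: "2 * l \<le> n" using l(2) by linarith
    obtain H p' where "symmetric_matching_extension (coord_space {..<d}) Q H (sq_dist d) p' n l"
      using symmetric_extension_locale[OF ext symm ln] by blast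
    then interpret symmetric_matching_extension "coord_space {..<d}" Q H "sq_dist d" p' n l .
    have size: "1 \<le> extension_size Q"
      using facets_nonempty finite_facets by (simp add: extension_size_def Suc_le_eq card_gt_0_iff)
    have "C * real (n choose k) \<le> real (extension_size Q)"
    proof (cases "1 \<le> k \<and> N \<le> n")
      case True
      then have "n choose k \<le> extension_size Q"
        using facets_lower_bound[of k] ln by (simp add: k_def N_def extension_size_def)
      then have "1 * real (n choose k) \<le> real (extension_size Q)" by simp
      moreover have "C * real (n choose k) \<le> 1 * real (n choose k)" using C(2) by (intro mult_right_mono) auto
      ultimately show ?thesis by linarith
    next
      case False
      have "C * real (n choose k) \<le> 1"
      proof (cases "k = 0")
        case True
        then show ?thesis using C(2) by simp
      next
        case k0: False
        then have "n \<le> N" using False by simp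
        have "n choose k \<le> 2 ^ n" by (rule binomial_le_pow2)
        also have "\<dots> \<le> 2 ^ N" using \<open>n \<le> N\<close> by (rule power_increasing) simp
        finally have "real (n choose k) \<le> 2 ^ N"
          by (metis of_nat_le_iff of_nat_numeral of_nat_power)
        then show ?thesis by (simp add: C_def)
      qed
      then show ?thesis using size by linarith
    qed
    then show ?thesis by (simp add: k_def)
  qed
  then show ?thesis using C(1) by blast
qed

end
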